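(* Let $\mathfrak{g}=\mathfrak{k}\oplus\mathfrak{p}$ be a Cartan decomposition of a semisimple real Lie algebra, with $K$ acting on $\mathfrak{p}$ by the adjoint action. Let $x\in C$ be such that $P_x=\mathrm{conv}(Wx)$ is full-dimensional in $\mathfrak{a}$. Then the coorbitope $\mathcal{O}_x^o\subset\mathfrak{p}$ is the convex hull of the union of the $K$-orbits of the elements $z_i=h_{\mu_i}/\mu_i(x)\in C$, for $i$ running through $I(x)$.
   Context: Let $\langle\cdot,\cdot\rangle$ be the Killing form, which is positive definite on $\mathfrak{p}$. $K$ is the analytic subgroup of $\mathrm{Aut}(\mathfrak{g})_0$ with Lie algebra $\mathfrak{k}$; it acts on $\mathfrak{p}$ by $gx:=\mathrm{Ad}(g)x$. Fix a maximal commutative subspace $\mathfrak{a}\subset\mathfrak{p}$, let $\Sigma\subset\mathfrak{a}^\vee=\mathrm{Hom}(\mathfrak{a},\mathbb{R})$ be the system of restricted roots of $(\mathfrak{g},\mathfrak{a})$, $W$ its Weyl group acting on $\mathfrak{a}$, and, for a fixed ordering on $\mathfrak{a}^\vee$, $\Gamma=\{\beta_1,\dots,\beta_n\}$ the simple restricted roots. The closed Weyl chamber is $C=\{x\in\mathfrak{a}:\beta_1(x)\ge0,\dots,\beta_n(x)\ge0\}$. The inner product on $\mathfrak{a}$ is transferred to $\mathfrak{a}^\vee$, and $\mu_1,\dots,\mu_n\in\mathfrak{a}^\vee$ is the basis dual to $\Gamma$: $\langle\beta_j,\mu_k\rangle=\delta_{jk}$. For $\mu\in\mathfrak{a}^\vee$,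 $h_\mu\in\mathfrak{a}$ is the element with $\langle h_\mu,y\rangle=\mu(y)$ for all $y\in\mathfrak{a}$. (When $x\in C$ and $P_x$ is full-dimensional, $\mu_i(x)>0$ for all $i$.) For $x\in\mathfrak{p}$, $\mathcal{O}_x=\mathrm{conv}(Kx)$ is the orbitope of $x$, and the coorbitope is the polar set $\mathcal{O}_x^o=\{y\in\mathfrak{p}:\langle z,y\rangle\le1\ \text{for all }z\in\mathcal{O}_x\}$. For $x\in C$, a subset $I\subset\Gamma$ is $x$-connected if every connected component of $I$ (in the Dynkin graph) contains a root $\beta$ with $\beta(x)\ne0$ (the empty set is $x$-connected). Put $I(x)=\{i\in\{1,\dots,n\}:\Gamma\setminus\{\beta_i\}\text{ is }x\text{-connected}\}$.
   Formalization: The formal theorem assumes that 𝔭 is nonzero; for compact 𝔤 (𝔭 = 0) the claim fails as stated, since I(x) is empty and the convex hull of the empty union is empty while the coorbitope is {0}. *)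

theory Defs
  imports "HOL-Analysis.Analysis" "HOL-Algebra.Bij" "HOL-Algebra.Generated_Groups"
begin

text \<open>
  A finite-dimensional real Lie algebra is given by its bracket on a type of class
  \<^class>\<open>euclidean_space\<close>. That class serves to provide finite dimension, the topology,
  and a basis; its inner product has no Lie-theoretic meaning and is never used as such.
  The inner product of the theory is the Killing form.
\<close>

section \<open>Lie algebras\<close>

definition lie_algebra :: "('g::euclidean_space \<Rightarrow> 'g \<Rightarrow> 'g) \<Rightarrow> bool" where
  "lie_algebra br \<longleftrightarrow> bilinear br \<and> (\<forall>x. br x x = 0) \<and>
     (\<forall>x y z. br x (br y z) + br y (br z x) + br z (br x y) = 0)"

definition lie_ideal :: "('g::euclidean_space \<Rightarrow> 'g \<Rightarrow> 'g) \<Rightarrow> 'g set \<Rightarrow> bool" where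
  "lie_ideal br I \<longleftrightarrow> subspace I \<and> (\<forall>x. \<forall>y\<in>I. br x y \<in> I)"

definition derived_algebra :: "('g::euclidean_space \<Rightarrow> 'g \<Rightarrow> 'g) \<Rightarrow> 'g set \<Rightarrow> 'g set" where
  "derived_algebra br A = span {br x y | x y. x \<in> A \<and> y \<in> A}"

definition solvable_lie :: "('g::euclidean_space \<Rightarrow> 'g \<Rightarrow> 'g) \<Rightarrow> 'g set \<Rightarrow> bool" where
  "solvable_lie br A \<longleftrightarrow> (\<exists>n. (derived_algebra br ^^ n) A = {0})"

definition semisimple_lie_algebra :: "('g::euclidean_space \<Rightarrow> 'g \<Rightarrow> 'g) \<Rightarrow> bool" where
  "semisimple_lie_algebra br \<longleftrightarrow> lie_algebra br \<and>
     (\<forall>I. lie_ideal br I \<and> solvable_lie br I \<longrightarrow> I = {0})"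

text \<open>The trace of a linear map, computed in the distinguished basis (as for every basis,
  the value does not depend on this choice).\<close>

definition lin_trace :: "('g::euclidean_space \<Rightarrow> 'g) \<Rightarrow> real" where
  "lin_trace f = (\<Sum>b\<in>Basis. f b \<bullet> b)"

definition killing_form :: "('g::euclidean_space \<Rightarrow> 'g \<Rightarrow> 'g) \<Rightarrow> 'g \<Rightarrow> 'g \<Rightarrow> real" where
  "killing_form br x y = lin_trace (br x \<circ> br y)"

section \<open>Cartan decompositions and the group K\<close>

definition cartan_involution ::
    "('g::euclidean_space \<Rightarrow> 'g \<Rightarrow> 'g) \<Rightarrow> ('g \<Rightarrow> 'g) \<Rightarrow> bool" where
  "cartan_involution br \<theta> \<longleftrightarrow> linear \<theta> \<and> (\<forall>x. \<theta> (\<theta> x) = x) \<and>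
     (\<forall>x y. \<theta> (br x y) = br (\<theta> x) (\<theta> y)) \<and>
     (\<forall>x. x \<noteq> 0 \<longrightarrow> - killing_form br x (\<theta> x) > 0)"

definition cartan_decomposition ::
    "('g::euclidean_space \<Rightarrow> 'g \<Rightarrow> 'g) \<Rightarrow> 'g set \<Rightarrow> 'g set \<Rightarrow> bool" where
  "cartan_decomposition br k p \<longleftrightarrow>
     (\<exists>\<theta>. cartan_involution br \<theta> \<and> k = {x. \<theta> x = x} \<and> p = {x. \<theta> x = - x})"

definition lin_exp :: "('g::euclidean_space \<Rightarrow> 'g) \<Rightarrow> 'g \<Rightarrow> 'g" where
  "lin_exp f v = (\<Sum>n. (1 / fact n) *\<^sub>R (f ^^ n) v)"

text \<open>
  The analytic (connected Lie) subgroup belonging to a Lie algebra \<open>h\<close> of endomorphisms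
  is the group generated by the exponentials of the elements of \<open>h\<close>.
\<close>

definition analytic_subgroup :: "('g::euclidean_space \<Rightarrow> 'g) set \<Rightarrow> ('g \<Rightarrow> 'g) set" where
  "analytic_subgroup h = generate (BijGroup UNIV) (lin_exp ` h)"

text \<open>
  The subalgebra \<open>k\<close> is identified with \<open>ad k\<close> inside \<open>ad g\<close>, the Lie algebra of the
  automorphism group of \<open>g\<close>. For an automorphism \<open>\<phi>\<close> of \<open>g\<close> one has
  \<open>\<phi> (ad x) \<phi>\<^sup>-\<^sup>1 = ad (\<phi> x)\<close>, so that the adjoint action of this group on \<open>g\<close> is
  plain evaluation.
\<close>

definition K_group :: "('g::euclidean_space \<Rightarrow> 'g \<Rightarrow> 'g) \<Rightarrow> 'g set \<Rightarrow> ('g \<Rightarrow> 'g) set" where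
  "K_group br k = analytic_subgroup (br ` k)"

definition K_orbit :: "('g::euclidean_space \<Rightarrow> 'g \<Rightarrow> 'g) \<Rightarrow> 'g set \<Rightarrow> 'g \<Rightarrow> 'g set" where
  "K_orbit br k x = (\<lambda>\<phi>. \<phi> x) ` K_group br k"

definition orbitope :: "('g::euclidean_space \<Rightarrow> 'g \<Rightarrow> 'g) \<Rightarrow> 'g set \<Rightarrow> 'g \<Rightarrow> 'g set" where
  "orbitope br k x = convex hull (K_orbit br k x)"

definition coorbitope ::
    "('g::euclidean_space \<Rightarrow> 'g \<Rightarrow> 'g) \<Rightarrow> 'g set \<Rightarrow> 'g set \<Rightarrow> 'g \<Rightarrow> 'g set" where
  "coorbitope br k p x = {y \<in> p. \<forall>z \<in> orbitope br k x. killing_form br z y \<le> 1}"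

section \<open>Restricted roots and the Weyl group\<close>

definition commutative_subspace :: "('g::euclidean_space \<Rightarrow> 'g \<Rightarrow> 'g) \<Rightarrow> 'g set \<Rightarrow> bool" where
  "commutative_subspace br a \<longleftrightarrow> subspace a \<and> (\<forall>x\<in>a. \<forall>y\<in>a. br x y = 0)"

definition maximal_commutative ::
    "('g::euclidean_space \<Rightarrow> 'g \<Rightarrow> 'g) \<Rightarrow> 'g set \<Rightarrow> 'g set \<Rightarrow> bool" where
  "maximal_commutative br p a \<longleftrightarrow> commutative_subspace br a \<and> a \<subseteq> p \<and>
     (\<forall>b. commutative_subspace br b \<and> a \<subseteq> b \<and> b \<subseteq> p \<longrightarrow> b = a)"

text \<open>Linear functionals on the subspace \<open>a\<close> are represented by functions on the whole type
  that vanish outside \<open>a\<close>, so that distinct functions are distinct functionals and the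
  vector space operations are pointwise.\<close>

definition dual_of :: "'g::euclidean_space set \<Rightarrow> ('g \<Rightarrow> real) set" where
  "dual_of a = {f. (\<forall>x\<in>a. \<forall>y\<in>a. f (x + y) = f x + f y) \<and>
     (\<forall>c. \<forall>x\<in>a. f (c *\<^sub>R x) = c * f x) \<and> (\<forall>x. x \<notin> a \<longrightarrow> f x = 0)}"

definition restricted_root_space ::
    "('g::euclidean_space \<Rightarrow> 'g \<Rightarrow> 'g) \<Rightarrow> 'g set \<Rightarrow> ('g \<Rightarrow> real) \<Rightarrow> 'g set" where
  "restricted_root_space br a \<alpha> = {y. \<forall>h\<in>a. br h y = \<alpha> h *\<^sub>R y}"

definition restricted_roots ::
    "('g::euclidean_space \<Rightarrow> 'g \<Rightarrow> 'g) \<Rightarrow> 'g set \<Rightarrow> ('g \<Rightarrow> real) set" where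
  "restricted_roots br a =
     {\<alpha> \<in> dual_of a. \<alpha> \<noteq> (\<lambda>_. 0) \<and> restricted_root_space br a \<alpha> \<noteq> {0}}"

definition h_vec :: "('g::euclidean_space \<Rightarrow> 'g \<Rightarrow> 'g) \<Rightarrow> 'g set \<Rightarrow> ('g \<Rightarrow> real) \<Rightarrow> 'g" where
  "h_vec br a \<mu> = (THE h. h \<in> a \<and> (\<forall>y\<in>a. killing_form br h y = \<mu> y))"

definition dual_inner ::
    "('g::euclidean_space \<Rightarrow> 'g \<Rightarrow> 'g) \<Rightarrow> 'g set \<Rightarrow> ('g \<Rightarrow> real) \<Rightarrow> ('g \<Rightarrow> real) \<Rightarrow> real" where
  "dual_inner br a \<nu> \<mu> = killing_form br (h_vec br a \<nu>) (h_vec br a \<mu>)"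

text \<open>Group elements are extensional functions on \<open>a\<close>, as required by \<^const>\<open>BijGroup\<close>.\<close>

definition root_reflection ::
    "('g::euclidean_space \<Rightarrow> 'g \<Rightarrow> 'g) \<Rightarrow> 'g set \<Rightarrow> ('g \<Rightarrow> real) \<Rightarrow> 'g \<Rightarrow> 'g" where
  "root_reflection br a \<alpha> =
     (\<lambda>y\<in>a. y - (2 * \<alpha> y / dual_inner br a \<alpha> \<alpha>) *\<^sub>R h_vec br a \<alpha>)"

definition weyl_group :: "('g::euclidean_space \<Rightarrow> 'g \<Rightarrow> 'g) \<Rightarrow> 'g set \<Rightarrow> ('g \<Rightarrow> 'g) set" where
  "weyl_group br a = generate (BijGroup a) (root_reflection br a ` restricted_roots br a)"

definition weyl_polytope :: "('g::euclidean_space \<Rightarrow> 'g \<Rightarrow> 'g) \<Rightarrow> 'g set \<Rightarrow> 'g \<Rightarrow> 'g set" where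
  "weyl_polytope br a x = convex hull ((\<lambda>w. w x) ` weyl_group br a)"

text \<open>Orderings of the real vector space of functionals on \<open>a\<close>: total orders that are
  compatible with addition and with multiplication by nonnegative scalars.\<close>

definition dual_ordering :: "'g::euclidean_space set \<Rightarrow> (('g \<Rightarrow> real) \<times> ('g \<Rightarrow> real)) set \<Rightarrow> bool" where
  "dual_ordering a r \<longleftrightarrow> linear_order_on (dual_of a) r \<and>
     (\<forall>(f, g)\<in>r. \<forall>h\<in>dual_of a. ((\<lambda>y. f y + h y), (\<lambda>y. g y + h y)) \<in> r) \<and>
     (\<forall>(f, g)\<in>r. \<forall>c\<ge>0. ((\<lambda>y. c * f y), (\<lambda>y. c * g y)) \<in> r)"

definition positive_roots ::
    "('g::euclidean_space \<Rightarrow> 'g \<Rightarrow> 'g) \<Rightarrow> 'g set \<Rightarrow> (('g \<Rightarrow> real) \<times> ('g \<Rightarrow> real)) set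
       \<Rightarrow> ('g \<Rightarrow> real) set" where
  "positive_roots br a r = {\<alpha> \<in> restricted_roots br a. ((\<lambda>_. 0), \<alpha>) \<in> r}"

definition simple_roots ::
    "('g::euclidean_space \<Rightarrow> 'g \<Rightarrow> 'g) \<Rightarrow> 'g set \<Rightarrow> (('g \<Rightarrow> real) \<times> ('g \<Rightarrow> real)) set
       \<Rightarrow> ('g \<Rightarrow> real) set" where
  "simple_roots br a r = {\<alpha> \<in> positive_roots br a r.
     \<not> (\<exists>\<beta>\<in>positive_roots br a r. \<exists>\<gamma>\<in>positive_roots br a r. \<alpha> = (\<lambda>y. \<beta> y + \<gamma> y))}"

definition weyl_chamber :: "'g::euclidean_space set \<Rightarrow> ('g \<Rightarrow> real) set \<Rightarrow> 'g set" where
  "weyl_chamber a \<Gamma> = {x \<in> a. \<forall>\<beta>\<in>\<Gamma>. \<beta> x \<ge> 0}"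

section \<open>The Dynkin graph and \<open>x\<close>-connected sets of simple roots\<close>

text \<open>Edges of the subgraph induced on \<open>I\<close>; multiplicities and orientations of the Dynkin
  diagram play no role for connectedness.\<close>

definition dynkin_edges ::
    "('g::euclidean_space \<Rightarrow> 'g \<Rightarrow> 'g) \<Rightarrow> 'g set \<Rightarrow> ('g \<Rightarrow> real) set
       \<Rightarrow> (('g \<Rightarrow> real) \<times> ('g \<Rightarrow> real)) set" where
  "dynkin_edges br a I =
     {(\<alpha>, \<beta>). \<alpha> \<in> I \<and> \<beta> \<in> I \<and> \<alpha> \<noteq> \<beta> \<and> dual_inner br a \<alpha> \<beta> \<noteq> 0}"

definition dynkin_components ::
    "('g::euclidean_space \<Rightarrow> 'g \<Rightarrow> 'g) \<Rightarrow> 'g set \<Rightarrow> ('g \<Rightarrow> real) set \<Rightarrow> ('g \<Rightarrow> real) set set" where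
  "dynkin_components br a I = {(dynkin_edges br a I)\<^sup>* `` {\<alpha>} | \<alpha>. \<alpha> \<in> I}"

definition x_connected ::
    "('g::euclidean_space \<Rightarrow> 'g \<Rightarrow> 'g) \<Rightarrow> 'g set \<Rightarrow> 'g \<Rightarrow> ('g \<Rightarrow> real) set \<Rightarrow> bool" where
  "x_connected br a x I \<longleftrightarrow> (\<forall>D\<in>dynkin_components br a I. \<exists>\<beta>\<in>D. \<beta> x \<noteq> 0)"

text \<open>The simple roots are enumerated as \<open>\<beta> 1, \<dots>, \<beta> n\<close>.\<close>

definition I_set ::
    "('g::euclidean_space \<Rightarrow> 'g \<Rightarrow> 'g) \<Rightarrow> 'g set \<Rightarrow> nat \<Rightarrow> (nat \<Rightarrow> 'g \<Rightarrow> real) \<Rightarrow> 'g \<Rightarrow> nat set" where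
  "I_set br a n \<beta> x = {i \<in> {1..n}. x_connected br a x (\<beta> ` {1..n} - {\<beta> i})}"

end

theory Submission
  imports Defs
begin

text \<open>
  The Killing form \<open>B\<close> turns the claim into a statement about maxima of linear functionals. Three
  facts carry the proof.

  (1) For \<open>x\<close>, \<open>y\<close> in the closed chamber \<open>C\<close>, the functional \<open>B(\<cdot>, y)\<close> attains its maximum over the
  orbit \<open>Kx\<close> at \<open>x\<close> (\<open>orbit_maximum\<close>). In an orthonormal basis of root vectors
  \<open>B(kx, y) = tr(k ad(x) k\<^sup>-\<^sup>1 ad(y))\<close> is a sum of products of eigenvalues of \<open>ad y\<close> and \<open>ad x\<close>, weighted by the
  bistochastic matrix of squared entries of \<open>k\<close>. By Abel summation it suffices to bound the corners of
  this matrix cut out by upper level sets of the eigenvalues. If \<open>U\<close> and \<open>V\<close> are the sums of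
  eigenspaces of \<open>ad x\<close> and \<open>ad y\<close> above two thresholds, such a corner sum is the squared
  Hilbert-Schmidt norm of the compression of \<open>k\<close> from \<open>U\<close> to \<open>V\<close>, so that it is at most the rank of that
  compression, and the bound needed is \<open>dim(U \<inter> V)\<close>. That the rank does not exceed \<open>dim(U \<inter> V)\<close> is where
  connectedness of \<open>K\<close> enters: the rank condition is the vanishing of certain alternating forms on
  \<open>kU\<close>. A Poincare-Birkhoff-Witt argument, moving the part of \<open>g\<close> that preserves \<open>U\<close> to the outside and the
  part that preserves the complement of \<open>V\<close> to the inside, shows that all derivatives of these forms along
  \<open>K\<close> vanish at the identity, and Taylor expansion transports this to products of exponentials.

  (2) Every point of \<open>p\<close> is \<open>K\<close>-conjugate to a point of \<open>C\<close> (\<open>orbit_meets_chamber\<close>): maximize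
  \<open>B(\<cdot>, h)\<close> for a regular \<open>h\<close> in \<open>C\<close> over the orbit. The first derivative puts the maximizer into \<open>a\<close>, the
  second one into \<open>C\<close>. Here the orbit has to be compact (\<open>compact_orb\<close>); closedness comes from a local slice for
  the action and the discreteness of the spectrum of \<open>ad c\<close>.

  (3) If \<open>i\<close> is not in \<open>I(x)\<close>, there is \<open>j\<close> such that \<open>B(z\<^sub>i, y) \<le> B(z\<^sub>j, y)\<close> for all \<open>y\<close> in \<open>C\<close>, and
  \<open>z\<^sub>j\<close> is longer than \<open>z\<^sub>i\<close> (\<open>not_connected_dominated\<close>). Indeed let \<open>D\<close> be a component of
  \<open>\<Gamma> - {\<beta>\<^sub>i}\<close> that vanishes at \<open>x\<close> and \<open>\<beta>\<^sub>j \<in> D\<close>. The projection of \<open>z\<^sub>j\<close> to the orthogonal complement of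
  the span of \<open>D\<close> is \<open>z\<^sub>i\<close>, and the difference is a nonnegative combination of the vectors \<open>h\<^sub>\<beta>\<close>, \<open>\<beta> \<in> D\<close>.
  Hence every \<open>z\<^sub>i\<close> is dominated on \<open>C\<close> by some \<open>z\<^sub>j\<close> with \<open>j \<in> I(x)\<close>.

  Both sides of the theorem are \<open>K\<close>-invariant convex sets. By (1) and \<open>B(x, z\<^sub>i) = 1\<close> the orbits of the
  \<open>z\<^sub>i\<close> lie in the coorbitope. If \<open>y\<close> in the coorbitope were separated from the convex hull by a functional
  \<open>B(w, \<cdot>)\<close>, then by (2) \<open>w = k c\<close> and \<open>y = k' d\<close> with \<open>c, d \<in> C\<close>, and by (1) one may replace \<open>y\<close> by \<open>d\<close>
  and \<open>w\<close> by \<open>c\<close>. The coordinates of \<open>d\<close> with respect to the \<open>z\<^sub>i\<close> are nonnegative with sum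
  \<open>B(x, d) \<le> 1\<close>, so \<open>B(c, d)\<close> is at most the maximum of \<open>B(c, z\<^sub>i)\<close>, which by (3) is attained on
  \<open>I(x)\<close>. That contradicts the separation.
\<close>

section \<open>Linear algebra for a chosen inner product\<close>

lemma quadratic_nonneg_imp_linear_part_zero:
  fixes b c :: real
  assumes "\<And>t. 0 \<le> 2 * t * b + t\<^sup>2 * c"
  shows "b = 0"
proof (cases "c \<le> 0")
  case True
  have "0 \<le> 2 * (- b) * b + (- b)\<^sup>2 * c" by (rule assms)
  moreover have "(- b)\<^sup>2 * c \<le> 0" using True by (simp add: mult_nonneg_nonpos)
  ultimately have "2 * (b * b) \<le> 0" by simp
  then show ?thesis by (auto simp: mult_le_0_iff)
next
  case False
  have "0 \<le> 2 * (- b / c) * b + (- b / c)\<^sup>2 * c" by (rule assms)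
  also have "\<dots> = - (b\<^sup>2 / c)" using False by (simp add: field_simps power2_eq_square)
  finally have "b\<^sup>2 / c \<le> 0" by simp
  then show ?thesis using False by (simp add: divide_le_0_iff)
qed

lemma obtain_max_card:
  fixes P :: "'a set \<Rightarrow> bool"
  assumes "P {}" and "\<And>E. P E \<Longrightarrow> card E \<le> N"
  obtains E where "P E" "\<And>E'. P E' \<Longrightarrow> card E' \<le> card E"
proof -
  have "finite (card ` Collect P)" by (rule finite_subset[of _ "{..N}"]) (use assms in auto)
  moreover have "card ` Collect P \<noteq> {}" using assms(1) by blast
  ultimately have "Max (card ` Collect P) \<in> card ` Collect P" by (rule Max_in)
  then obtain E where "P E" "Max (card ` Collect P) = card E" by blast
  with \<open>finite (card ` Collect P)\<close> show thesis by (metis Max_ge imageI mem_Collect_eq that)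
qed

text \<open>The inner product attached to a Cartan involution differs from the one of the type class, so
  orthonormal bases, Riesz representation and symmetric operators are developed for an arbitrary
  positive definite form.\<close>

locale ip_space =
  fixes ip :: "'g::euclidean_space \<Rightarrow> 'g \<Rightarrow> real"
  assumes ip_bilinear: "bilinear ip"
    and ip_sym: "ip x y = ip y x"
    and ip_pos: "x \<noteq> 0 \<Longrightarrow> 0 < ip x x"
begin

lemmas ip_simps [simp] =
  bilinear_ladd[OF ip_bilinear] bilinear_radd[OF ip_bilinear]
  bilinear_lmul[OF ip_bilinear] bilinear_rmul[OF ip_bilinear]
  bilinear_lneg[OF ip_bilinear] bilinear_rneg[OF ip_bilinear]
  bilinear_lsub[OF ip_bilinear] bilinear_rsub[OF ip_bilinear]
  bilinear_lzero[OF ip_bilinear] bilinear_rzero[OF ip_bilinear]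

lemma linear_ip_left: "linear (\<lambda>x. ip x y)" and linear_ip_right: "linear (ip x)"
  using ip_bilinear by (auto simp: bilinear_def)

lemma ip_sum_left: "ip (\<Sum>i\<in>A. f i) y = (\<Sum>i\<in>A. ip (f i) y)"
  using linear_sum[OF linear_ip_left] .

lemma ip_sum_right: "ip x (\<Sum>i\<in>A. f i) = (\<Sum>i\<in>A. ip x (f i))"
  using linear_sum[OF linear_ip_right] .

lemma ip_nonneg: "0 \<le> ip x x"
  using ip_pos[of x] by (cases "x = 0") auto

lemma ip_eq_0_iff: "ip x x = 0 \<longleftrightarrow> x = 0"
  using ip_pos[of x] by (cases "x = 0") auto

lemma continuous_on_ip [continuous_intros]:
  assumes "continuous_on S f" "continuous_on S g"
  shows "continuous_on S (\<lambda>x. ip (f x) (g x))"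
  using bounded_bilinear.continuous_on[OF bilinear_conv_bounded_bilinear[THEN iffD1, OF ip_bilinear]] assms
  by blast

definition ip_norm :: "'g \<Rightarrow> real" where "ip_norm x = sqrt (ip x x)"

lemma ip_norm_nonneg [simp]: "0 \<le> ip_norm x"
  by (simp add: ip_norm_def ip_nonneg)

lemma ip_norm_square: "ip_norm x ^ 2 = ip x x"
  by (simp add: ip_norm_def ip_nonneg)

lemma ip_norm_pos: "x \<noteq> 0 \<Longrightarrow> 0 < ip_norm x"
  by (simp add: ip_norm_def ip_pos)

definition orthonormal :: "'g set \<Rightarrow> bool" where
  "orthonormal E \<longleftrightarrow> (\<forall>e\<in>E. \<forall>f\<in>E. ip e f = (if e = f then 1 else 0))"

lemma onsetD: "orthonormal E \<Longrightarrow> e \<in> E \<Longrightarrow> f \<in> E \<Longrightarrow> ip e f = (if e = f then 1 else 0)"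
  by (simp add: orthonormal_def)

lemma orthonormal_subset: "orthonormal E \<Longrightarrow> F \<subseteq> E \<Longrightarrow> orthonormal F"
  unfolding orthonormal_def by blast

lemma ip_sum_orthonormal:
  assumes "orthonormal E" "finite F" "F \<subseteq> E" "e \<in> E"
  shows "ip (\<Sum>f\<in>F. c f *\<^sub>R f) e = (if e \<in> F then c e else 0)"
proof -
  have "ip (\<Sum>f\<in>F. c f *\<^sub>R f) e = (\<Sum>f\<in>F. c f * (if f = e then 1 else 0))"
    unfolding ip_sum_left using assms by (intro sum.cong) (auto simp: orthonormal_def)
  also have "\<dots> = (if e \<in> F then c e else 0)"
    using assms(2) by (simp add: if_distrib cong: if_cong)
  finally show ?thesis .
qed

lemma orthonormal_independent: assumes "orthonormal E" shows "independent E"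
proof -
  have "c e = 0" if "finite F" "F \<subseteq> E" "(\<Sum>f\<in>F. c f *\<^sub>R f) = 0" "e \<in> F" for F c e
    using ip_sum_orthonormal[OF assms that(1,2), of e c] that by auto
  then show ?thesis by (auto simp: independent_explicit_module)
qed

lemma orthonormal_finite: "orthonormal E \<Longrightarrow> finite E"
  and orthonormal_card: "orthonormal E \<Longrightarrow> card E \<le> DIM('g)"
  using independent_bound orthonormal_independent by blast+

lemma orthonormal_expand:
  assumes "orthonormal E" "v \<in> span E"
  shows "v = (\<Sum>e\<in>E. ip v e *\<^sub>R e)"
proof -
  obtain c where c: "v = (\<Sum>e\<in>E. c e *\<^sub>R e)"
    using assms(2) span_finite[OF orthonormal_finite[OF assms(1)]] by auto
  have "ip v e = c e" if "e \<in> E" for e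
    using ip_sum_orthonormal[OF assms(1) orthonormal_finite[OF assms(1)] order_refl that] that c by simp
  then show ?thesis using c by simp
qed

lemma parseval:
  assumes "orthonormal E" "v \<in> span E"
  shows "ip v w = (\<Sum>e\<in>E. ip v e * ip w e)"
proof -
  have "ip v w = ip (\<Sum>e\<in>E. ip v e *\<^sub>R e) w" using orthonormal_expand[OF assms] by simp
  then show ?thesis by (simp add: ip_sum_left ip_sym[of w])
qed

lemma projection_orthonormal:
  assumes "orthonormal E"
  shows "(\<Sum>e\<in>E. ip v e *\<^sub>R e) \<in> span E"
    and "w \<in> span E \<Longrightarrow> ip (v - (\<Sum>e\<in>E. ip v e *\<^sub>R e)) w = 0"
proof -
  show "(\<Sum>e\<in>E. ip v e *\<^sub>R e) \<in> span E" by (simp add: span_base span_scale span_sum)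
  assume w: "w \<in> span E"
  have "ip (v - (\<Sum>e\<in>E. ip v e *\<^sub>R e)) w = ip v w - (\<Sum>e\<in>E. ip v e * ip e w)"
    by (simp add: ip_sum_left)
  also have "(\<Sum>e\<in>E. ip v e * ip e w) = ip v w"
    using parseval[OF assms w, of v] by (simp add: mult.commute ip_sym)
  finally show "ip (v - (\<Sum>e\<in>E. ip v e *\<^sub>R e)) w = 0" by simp
qed

lemma bessel:
  assumes "orthonormal E"
  shows "(\<Sum>e\<in>E. (ip v e)\<^sup>2) \<le> ip v v"
proof -
  define p where "p = (\<Sum>e\<in>E. ip v e *\<^sub>R e)"
  have p: "p \<in> span E" "ip (v - p) p = 0"
    unfolding p_def using projection_orthonormal[OF assms] by blast+
  have "(\<Sum>e\<in>E. (ip v e)\<^sup>2) = ip v p"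
    by (simp add: p_def ip_sum_right power2_eq_square)
  moreover have "ip v v - ip v p = ip (v - p) (v - p)"
    using p(2) ip_sym[of p v] by simp
  ultimately show ?thesis using ip_nonneg[of "v - p"] by linarith
qed

lemma orthonormal_singleton: "v \<noteq> 0 \<Longrightarrow> orthonormal {v /\<^sub>R ip_norm v}"
  using ip_norm_square[of v, symmetric] ip_norm_pos[of v] by (simp add: orthonormal_def field_simps power2_eq_square)

lemma cauchy_schwarz: "\<bar>ip v w\<bar> \<le> ip_norm v * ip_norm w"
proof (cases "w = 0")
  case False
  have "(ip v (w /\<^sub>R ip_norm w))\<^sup>2 \<le> ip v v" using bessel[OF orthonormal_singleton[OF False], of v] by simp
  then have "\<bar>ip v (w /\<^sub>R ip_norm w)\<bar> \<le> ip_norm v"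
    by (simp add: ip_norm_def real_le_rsqrt)
  then show ?thesis using ip_norm_pos[OF False] by (simp add: field_simps abs_mult)
qed simp

lemma orthonormal_insert:
  assumes "orthonormal E" "v \<noteq> 0" "\<And>e. e \<in> E \<Longrightarrow> ip v e = 0"
  shows "orthonormal (insert (v /\<^sub>R ip_norm v) E)" "v /\<^sub>R ip_norm v \<notin> E"
proof -
  have 1: "ip (v /\<^sub>R ip_norm v) (v /\<^sub>R ip_norm v) = 1" using orthonormal_singleton[OF assms(2)] by (simp add: orthonormal_def)
  have 2: "ip (v /\<^sub>R ip_norm v) e = 0" "ip e (v /\<^sub>R ip_norm v) = 0" if "e \<in> E" for e
    using assms(3)[OF that] ip_sym[of e v] by simp_all
  show "v /\<^sub>R ip_norm v \<notin> E" using 1 2 by fastforce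
  then show "orthonormal (insert (v /\<^sub>R ip_norm v) E)"
    using 1 2 assms(1) unfolding orthonormal_def by (simp del: ip_simps) metis
qed

text \<open>An orthonormal subset of \<open>X\<close> of maximal cardinality cannot be enlarged by a normalized vector of
  \<open>X\<close>. With \<open>X\<close> a subspace this yields bases, with \<open>X\<close> a set of eigenvectors it yields eigenbases.\<close>

lemma obtain_maximal_orthonormal:
  assumes "\<And>v c. v \<in> X \<Longrightarrow> c *\<^sub>R v \<in> X"
  obtains E where "orthonormal E" "E \<subseteq> X" "\<And>v. v \<in> X \<Longrightarrow> (\<And>e. e \<in> E \<Longrightarrow> ip v e = 0) \<Longrightarrow> v = 0"
proof -
  obtain E where E: "orthonormal E" "E \<subseteq> X" "\<And>F. orthonormal F \<and> F \<subseteq> X \<Longrightarrow> card F \<le> card E"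
    using obtain_max_card[of "\<lambda>E. orthonormal E \<and> E \<subseteq> X" "DIM('g)"]
    by (metis empty_subsetI orthonormal_card orthonormal_def empty_iff)
  moreover have "v = 0" if v: "v \<in> X" "\<And>e. e \<in> E \<Longrightarrow> ip v e = 0" for v
  proof (rule ccontr)
    assume "v \<noteq> 0"
    note ins = orthonormal_insert[OF E(1) this v(2)]
    have "card (insert (v /\<^sub>R ip_norm v) E) \<le> card E" using E(2,3) ins(1) v(1) assms by blast
    then show False using ins(2) orthonormal_finite[OF E(1)] by simp
  qed
  ultimately show thesis using that by blast
qed

lemma obtain_orthonormal_basis:
  assumes "subspace S"
  obtains E where "orthonormal E" "span E = S" "E \<subseteq> S" "card E = dim S"
proof -
  obtain E where E: "orthonormal E" "E \<subseteq> S" "\<And>v. v \<in> S \<Longrightarrow> (\<And>e. e \<in> E \<Longrightarrow> ip v e = 0) \<Longrightarrow> v = 0"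
    using obtain_maximal_orthonormal[of S] assms subspace_scale by blast
  have sub: "span E \<subseteq> S" using E(2) assms by (simp add: span_minimal)
  have "v \<in> span E" if "v \<in> S" for v
  proof -
    let ?p = "\<Sum>e\<in>E. ip v e *\<^sub>R e"
    have "v - ?p = 0"
    proof (rule E(3))
      show "v - ?p \<in> S" using projection_orthonormal(1)[OF E(1)] sub that assms by (meson subsetD subspace_diff)
      show "ip (v - ?p) e = 0" if "e \<in> E" for e
        using projection_orthonormal(2)[OF E(1)] that span_base by blast
    qed
    then show ?thesis using projection_orthonormal(1)[OF E(1), of v] by simp
  qed
  then have "span E = S" using sub by blast
  moreover then have "card E = dim S" using dim_span_eq_card_independent[OF orthonormal_independent[OF E(1)]] by simp
  ultimately show thesis using that E by blast
qed

lemma obtain_orthogonal_projection: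
  assumes "subspace S"
  obtains p where "p \<in> S" "\<And>w. w \<in> S \<Longrightarrow> ip (v - p) w = 0"
proof -
  obtain E where "orthonormal E" "span E = S" using obtain_orthonormal_basis[OF assms] .
  then show thesis using that projection_orthonormal[of E] by blast
qed

lemma riesz:
  assumes "subspace S" "\<And>x y. x \<in> S \<Longrightarrow> y \<in> S \<Longrightarrow> f (x + y) = f x + f y"
    "\<And>c x. x \<in> S \<Longrightarrow> f (c *\<^sub>R x) = c * f x"
  obtains h where "h \<in> S" "\<And>v. v \<in> S \<Longrightarrow> ip h v = (f v :: real)"
proof -
  obtain E where E: "orthonormal E" "span E = S" "E \<subseteq> S" using obtain_orthonormal_basis[OF assms(1)] .
  define h where "h = (\<Sum>e\<in>E. f e *\<^sub>R e)"
  have fsum: "f (\<Sum>e\<in>F. c e *\<^sub>R e) = (\<Sum>e\<in>F. c e * f e)" if "finite F" "F \<subseteq> E" for F c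
    using that
  proof (induction F rule: finite_induct)
    case empty
    have "f (0 *\<^sub>R 0) = 0 * f 0" using assms(1) by (intro assms(3)) (simp add: subspace_0)
    then show ?case by simp
  next
    case (insert x F)
    have "(\<Sum>e\<in>F. c e *\<^sub>R e) \<in> S" "x \<in> S" using insert E(3) assms(1) by (auto intro!: subspace_sum subspace_scale)
    then show ?case using insert assms by (simp add: subspace_scale)
  qed
  have "ip h v = f v" if "v \<in> S" for v
  proof -
    have "v = (\<Sum>e\<in>E. ip v e *\<^sub>R e)" using orthonormal_expand E that by blast
    then have "f v = (\<Sum>e\<in>E. ip v e * f e)" using fsum[OF orthonormal_finite[OF E(1)] order_refl] by metis
    moreover have "ip h v = (\<Sum>e\<in>E. ip v e * f e)"
      unfolding h_def ip_sum_left by (intro sum.cong) (simp_all add: ip_sym[of v])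
    ultimately show ?thesis by simp
  qed
  moreover have "h \<in> S" using E by (auto simp: h_def intro!: subspace_sum subspace_scale assms(1))
  ultimately show thesis using that by blast
qed

text \<open>Traces are computed in the distinguished basis, but root vectors form an orthonormal basis for the
  other form; this is the basis change.\<close>

lemma lin_trace_orthonormal:
  assumes "orthonormal E" "span E = UNIV" "linear f"
  shows "lin_trace f = (\<Sum>e\<in>E. ip (f e) e)"
proof -
  have "lin_trace f = (\<Sum>b\<in>Basis. \<Sum>e\<in>E. ip (f b) e * (e \<bullet> b))"
    unfolding lin_trace_def
  proof (intro sum.cong refl)
    fix b :: 'g
    have "f b = (\<Sum>e\<in>E. ip (f b) e *\<^sub>R e)" using orthonormal_expand assms by blast
    then have "f b \<bullet> b = (\<Sum>e\<in>E. ip (f b) e *\<^sub>R e) \<bullet> b" by (rule arg_cong)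
    then show "f b \<bullet> b = (\<Sum>e\<in>E. ip (f b) e * (e \<bullet> b))" by (simp add: inner_sum_left)
  qed
  also have "\<dots> = (\<Sum>e\<in>E. ip (\<Sum>b\<in>Basis. (e \<bullet> b) *\<^sub>R f b) e)"
    by (subst sum.swap) (simp add: ip_sum_left mult.commute)
  also have "\<dots> = (\<Sum>e\<in>E. ip (f e) e)"
  proof (intro sum.cong refl)
    fix e :: 'g
    have "f e = f (\<Sum>b\<in>Basis. (e \<bullet> b) *\<^sub>R b)" by (simp add: euclidean_representation)
    then show "ip (\<Sum>b\<in>Basis. (e \<bullet> b) *\<^sub>R f b) e = ip (f e) e"
      using assms(3) by (simp add: linear_sum linear_scale)
  qed
  finally show ?thesis .
qed

lemma norm_le_ip_norm: "\<exists>M>0. \<forall>v. norm v \<le> M * ip_norm v"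
proof -
  have "\<exists>w. \<forall>v. ip w v = v \<bullet> b" for b :: 'g
    using riesz[OF subspace_UNIV, of "\<lambda>v. v \<bullet> b"] by (metis UNIV_I inner_add_left inner_scaleR_left)
  then obtain w where w: "\<And>b v. ip (w b) v = v \<bullet> b" by metis
  define M where "M = 1 + (\<Sum>b\<in>Basis. ip_norm (w b))"
  have "norm v \<le> M * ip_norm v" for v
  proof -
    have "norm v \<le> (\<Sum>b\<in>Basis. \<bar>v \<bullet> b\<bar>)" by (rule norm_le_l1)
    also have "\<dots> \<le> (\<Sum>b\<in>Basis. ip_norm (w b) * ip_norm v)"
      by (intro sum_mono) (metis cauchy_schwarz w)
    also have "\<dots> \<le> M * ip_norm v" by (simp add: M_def sum_distrib_left algebra_simps)
    finally show ?thesis .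
  qed
  moreover have "M > 0" unfolding M_def by (intro add_pos_nonneg sum_nonneg) auto
  ultimately show ?thesis by blast
qed

lemma ip_norm_le_norm: "\<exists>M>0. \<forall>v. ip_norm v \<le> M * norm v"
proof -
  obtain B where B: "B > 0" "\<And>x y. norm (ip x y) \<le> B * norm x * norm y"
    using bilinear_bounded_pos[OF ip_bilinear] by blast
  have "ip_norm v \<le> sqrt B * norm v" for v
  proof -
    have "ip v v \<le> B * (norm v)\<^sup>2" using B(2)[of v v] by (simp add: power2_eq_square mult.assoc)
    then have "ip_norm v \<le> sqrt (B * (norm v)\<^sup>2)" unfolding ip_norm_def by simp
    then show ?thesis by (simp add: real_sqrt_mult)
  qed
  moreover have "sqrt B > 0" using B by simp
  ultimately show ?thesis by blast
qed

definition sym_op :: "('g \<Rightarrow> 'g) \<Rightarrow> bool" where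
  "sym_op T \<longleftrightarrow> linear T \<and> (\<forall>x y. ip (T x) y = ip x (T y))"

text \<open>A maximizer of the Rayleigh quotient is an eigenvector.\<close>

lemma sym_op_eigenvector:
  assumes "sym_op T" "subspace S" "S \<noteq> {0}" "\<And>v. v \<in> S \<Longrightarrow> T v \<in> S"
  obtains v c where "v \<in> S" "v \<noteq> 0" "T v = c *\<^sub>R v"
proof -
  have lin: "linear T" and sy: "\<And>x y. ip (T x) y = ip x (T y)" using assms(1) by (auto simp: sym_op_def)
  have contT: "continuous_on A T" for A using lin linear_continuous_on linear_conv_bounded_linear by blast
  define A where "A = {v \<in> S. ip v v = 1}"
  have "closed {v. ip v v = 1}" by (intro closed_Collect_eq continuous_intros)
  then have "closed A" using closed_subspace[OF assms(2)] by (simp add: A_def Collect_conj_eq closed_Int)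
  moreover have "bounded A"
  proof -
    obtain M where M: "\<And>v. norm v \<le> M * ip_norm v" using norm_le_ip_norm by blast
    have "norm v \<le> M" if "v \<in> A" for v
    proof -
      have "ip_norm v = 1" using that by (simp add: A_def ip_norm_def)
      then show ?thesis using M[of v] by simp
    qed
    then show ?thesis by (auto simp: bounded_iff)
  qed
  ultimately have "compact A" by (simp add: compact_eq_bounded_closed)
  moreover have "A \<noteq> {}"
  proof -
    obtain u where "u \<in> S" "u \<noteq> 0" using assms(2,3) subspace_0 by blast
    then have "u /\<^sub>R ip_norm u \<in> A" using orthonormal_singleton[of u] assms(2) by (simp add: A_def orthonormal_def subspace_scale)
    then show ?thesis by blast
  qed
  moreover have "continuous_on A (\<lambda>v. ip (T v) v)" by (intro continuous_intros contT)
  ultimately obtain v where v: "v \<in> A" "\<And>w. w \<in> A \<Longrightarrow> ip (T w) w \<le> ip (T v) v"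
    using continuous_attains_sup[of A "\<lambda>v. ip (T v) v"] by blast
  define c where "c = ip (T v) v"
  have vS: "v \<in> S" and v1: "ip v v = 1" using v(1) by (auto simp: A_def)
  \<comment> \<open>the form below is nonnegative on \<open>S\<close> and vanishes at the maximizer \<open>v\<close>\<close>
  have q: "0 \<le> c * ip w w - ip (T w) w" if "w \<in> S" for w
  proof (cases "w = 0")
    case False
    have "w /\<^sub>R ip_norm w \<in> A"
      using orthonormal_singleton[OF False] that assms(2) by (simp add: A_def orthonormal_def subspace_scale)
    then have "ip (T (w /\<^sub>R ip_norm w)) (w /\<^sub>R ip_norm w) \<le> c" unfolding c_def by (rule v(2))
    then have "ip (T w) w / (ip_norm w)\<^sup>2 \<le> c" by (simp add: linear_scale[OF lin] divide_inverse power2_eq_square mult.commute mult.left_commute)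
    then show ?thesis using ip_pos[OF False] by (simp add: ip_norm_square field_simps)
  qed (simp add: linear_0[OF lin])
  have "ip (c *\<^sub>R v - T v) w = 0" if "w \<in> S" for w
  proof (rule quadratic_nonneg_imp_linear_part_zero)
    fix t :: real
    have "v + t *\<^sub>R w \<in> S" using vS that assms(2) by (simp add: subspace_add subspace_scale)
    from q[OF this] show "0 \<le> 2 * t * ip (c *\<^sub>R v - T v) w + t\<^sup>2 * (c * ip w w - ip (T w) w)"
      using v1 sy[of w v]
      by (simp add: linear_add[OF lin] linear_scale[OF lin] c_def algebra_simps power2_eq_square ip_sym)
  qed
  from this[of "c *\<^sub>R v - T v"] have "c *\<^sub>R v - T v = 0"
    using vS assms(2,4) by (simp add: ip_eq_0_iff subspace_diff subspace_scale del: ip_simps)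
  then show thesis using that[of v c] vS v1 by force
qed

text \<open>In a nonzero invariant subspace of minimal dimension each operator of a commuting family is
  scalar, since its eigenspaces are invariant under the whole family.\<close>

lemma joint_eigenvector:
  assumes sym: "\<And>T. T \<in> \<T> \<Longrightarrow> sym_op T"
    and comm: "\<And>T T' v. T \<in> \<T> \<Longrightarrow> T' \<in> \<T> \<Longrightarrow> T (T' v) = T' (T v)"
    and S: "subspace S" "S \<noteq> {0}" "\<And>T v. T \<in> \<T> \<Longrightarrow> v \<in> S \<Longrightarrow> T v \<in> S"
  obtains v where "v \<in> S" "v \<noteq> 0" "\<And>T. T \<in> \<T> \<Longrightarrow> \<exists>c. T v = c *\<^sub>R v"
proof -
  define P where "P = (\<lambda>R. subspace R \<and> R \<noteq> {0} \<and> R \<subseteq> S \<and> (\<forall>T\<in>\<T>. \<forall>v\<in>R. T v \<in> R))"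
  have "P S" using S by (simp add: P_def)
  then obtain R where R: "P R" "\<And>R'. P R' \<Longrightarrow> dim R \<le> dim R'"
    using ex_has_least_nat[of P S dim] by blast
  have Rs: "subspace R" "R \<noteq> {0}" "R \<subseteq> S" "\<And>T v. T \<in> \<T> \<Longrightarrow> v \<in> R \<Longrightarrow> T v \<in> R"
    using R(1) by (auto simp: P_def)
  have scalar: "\<exists>c. \<forall>v\<in>R. T v = c *\<^sub>R v" if T: "T \<in> \<T>" for T
  proof -
    obtain v c where v: "v \<in> R" "v \<noteq> 0" "T v = c *\<^sub>R v"
      using sym_op_eigenvector[OF sym[OF T] Rs(1,2) Rs(4)[OF T]] .
    have lin: "\<And>T. T \<in> \<T> \<Longrightarrow> linear T" using sym by (simp add: sym_op_def)
    define R' where "R' = {w \<in> R. T w = c *\<^sub>R w}"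
    have "subspace R'"
      unfolding R'_def using Rs(1) lin[OF T]
      by (auto simp: subspace_def linear_0 linear_add linear_scale algebra_simps)
    moreover have "T' w \<in> R'" if "T' \<in> \<T>" "w \<in> R'" for T' w
      using that Rs(4) comm[OF T that(1)] lin[OF that(1)] by (simp add: R'_def linear_scale)
    ultimately have "P R'" using v Rs(3) by (auto simp: P_def R'_def)
    then have "dim R \<le> dim R'" by (rule R(2))
    then have "R' = R" using \<open>subspace R'\<close> Rs(1) by (intro subspace_dim_equal) (auto simp: R'_def)
    then show ?thesis by (auto simp: R'_def)
  qed
  obtain v where "v \<in> R" "v \<noteq> 0" using Rs(1,2) subspace_0 by blast
  then show thesis using that[of v] scalar Rs(3) by blast
qed

lemma joint_eigenbasis:
  assumes sym: "\<And>T. T \<in> \<T> \<Longrightarrow> sym_op T"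
    and comm: "\<And>T T' v. T \<in> \<T> \<Longrightarrow> T' \<in> \<T> \<Longrightarrow> T (T' v) = T' (T v)"
  obtains E where "orthonormal E" "span E = UNIV" "\<And>e T. e \<in> E \<Longrightarrow> T \<in> \<T> \<Longrightarrow> \<exists>c. T e = c *\<^sub>R e"
proof -
  have lin: "\<And>T. T \<in> \<T> \<Longrightarrow> linear T" using sym by (simp add: sym_op_def)
  define X where "X = {v. \<forall>T\<in>\<T>. \<exists>c. T v = c *\<^sub>R v}"
  have scale: "c *\<^sub>R v \<in> X" if "v \<in> X" for c v
    using that lin by (auto simp: X_def linear_scale)
  obtain E where E: "orthonormal E" "E \<subseteq> X" "\<And>v. v \<in> X \<Longrightarrow> (\<And>e. e \<in> E \<Longrightarrow> ip v e = 0) \<Longrightarrow> v = 0"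
    using obtain_maximal_orthonormal[of X] scale by blast
  define S where "S = {v. \<forall>e\<in>E. ip v e = 0}"
  have "subspace S" by (auto simp: S_def subspace_def)
  moreover have "T v \<in> S" if T: "T \<in> \<T>" and "v \<in> S" for T v
  proof -
    have "ip (T v) e = 0" if eE: "e \<in> E" for e
    proof -
      obtain c where "T e = c *\<^sub>R e" using subsetD[OF E(2) eE] T unfolding X_def by blast
      then show ?thesis using sym[OF T] \<open>v \<in> S\<close> eE by (simp add: sym_op_def S_def)
    qed
    then show ?thesis by (simp add: S_def)
  qed
  ultimately have S: "subspace S" "\<And>T v. T \<in> \<T> \<Longrightarrow> v \<in> S \<Longrightarrow> T v \<in> S" by blast+
  have "S = {0}"
  proof (rule ccontr)
    assume "S \<noteq> {0}"
    obtain v where "v \<in> S" "v \<noteq> 0" "\<And>T. T \<in> \<T> \<Longrightarrow> \<exists>c. T v = c *\<^sub>R v"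
      by (rule joint_eigenvector[of \<T> S, OF _ _ S(1) \<open>S \<noteq> {0}\<close>]) (use sym comm S(2) in auto)
    then show False using E(3)[of v] unfolding S_def X_def by blast
  qed
  have "v \<in> span E" for v
  proof -
    have "v - (\<Sum>e\<in>E. ip v e *\<^sub>R e) \<in> S"
      unfolding S_def using projection_orthonormal(2)[OF E(1)] span_base by blast
    then show ?thesis using \<open>S = {0}\<close> projection_orthonormal(1)[OF E(1), of v] by simp
  qed
  then show thesis using that[of E] E(1,2) by (auto simp: X_def)
qed

end

section \<open>Exponentials of linear maps\<close>

lemma linear_funpow: "linear f \<Longrightarrow> linear (f ^^ n)" for f :: "'a::real_vector \<Rightarrow> 'a"
proof (induction n)
  case (Suc n)
  then show ?case using linear_compose[of "f ^^ n" f] by (simp add: o_def)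
qed (use linear_id in \<open>simp add: id_def\<close>)

lemma funpow_scaled:
  fixes f :: "'a::real_vector \<Rightarrow> 'a"
  assumes "linear f"
  shows "((\<lambda>v. t *\<^sub>R f v) ^^ n) u = t ^ n *\<^sub>R (f ^^ n) u"
  by (induction n) (simp_all add: linear_scale[OF assms])

lemma norm_funpow_le:
  fixes f :: "'a::real_normed_vector \<Rightarrow> 'a"
  assumes "\<And>v. norm (f v) \<le> M * norm v" "0 \<le> M"
  shows "norm ((f ^^ n) v) \<le> M ^ n * norm v"
proof (induction n)
  case (Suc n)
  have "norm ((f ^^ Suc n) v) \<le> M * norm ((f ^^ n) v)" using assms(1) by simp
  also have "\<dots> \<le> M * (M ^ n * norm v)" using Suc assms(2) by (rule mult_left_mono)
  finally show ?case by (simp add: mult.assoc)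
qed simp

lemma linear_bound: "linear f \<Longrightarrow> \<exists>M>0. \<forall>v. norm (f v) \<le> M * norm v"
  for f :: "'g::euclidean_space \<Rightarrow> 'g"
  using linear_bounded_pos by blast

lemma lin_exp_term_bound:
  fixes f :: "'a::real_normed_vector \<Rightarrow> 'a"
  assumes "\<And>v. norm (f v) \<le> M * norm v" "0 \<le> M"
  shows "norm ((1 / fact n) *\<^sub>R (f ^^ n) v) \<le> inverse (fact n) * M ^ n * norm v"
proof -
  have "norm ((1 / fact n) *\<^sub>R (f ^^ n) v) = inverse (fact n) * norm ((f ^^ n) v)"
    by (simp add: divide_inverse)
  also have "\<dots> \<le> inverse (fact n) * (M ^ n * norm v)"
    using norm_funpow_le[OF assms] by (intro mult_left_mono) auto
  finally show ?thesis by (simp add: mult.assoc)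
qed

lemma lin_exp_summable_norm:
  fixes f :: "'g::euclidean_space \<Rightarrow> 'g"
  assumes "linear f"
  shows "summable (\<lambda>n. norm ((1 / fact n) *\<^sub>R (f ^^ n) v))"
proof -
  obtain M where "0 < M" "\<And>v. norm (f v) \<le> M * norm v" using linear_bound[OF assms] by blast
  then have "norm (norm ((1 / fact n) *\<^sub>R (f ^^ n) v)) \<le> inverse (fact n) * M ^ n * norm v" for n
    using lin_exp_term_bound[of f M n v] by simp
  then show ?thesis
    by (intro summable_comparison_test'[OF summable_mult2[OF summable_exp[of M], of "norm v"], of 0]) blast
qed

lemma lin_exp_summable:
  fixes f :: "'g::euclidean_space \<Rightarrow> 'g"
  shows "linear f \<Longrightarrow> summable (\<lambda>n. (1 / fact n) *\<^sub>R (f ^^ n) v)"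
  by (rule summable_norm_cancel[OF lin_exp_summable_norm])

lemma lin_exp_linear_image:
  fixes f :: "'g::euclidean_space \<Rightarrow> 'g" and g :: "'g \<Rightarrow> 'g"
  assumes "linear f" "linear g" "\<And>v. g (f v) = f (g v)"
  shows "g (lin_exp f v) = lin_exp f (g v)"
proof -
  have "g ((f ^^ n) v) = (f ^^ n) (g v)" for n
    by (induction n arbitrary: v) (simp_all add: assms(3))
  moreover have "g (lin_exp f v) = (\<Sum>n. g ((1 / fact n) *\<^sub>R (f ^^ n) v))"
    unfolding lin_exp_def
    using bounded_linear.suminf[OF linear_conv_bounded_linear[THEN iffD1, OF assms(2)] lin_exp_summable[OF assms(1)]] by simp
  ultimately show ?thesis by (simp add: lin_exp_def linear_scale[OF assms(2)])
qed

lemma linear_lin_exp: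
  fixes f :: "'g::euclidean_space \<Rightarrow> 'g"
  assumes "linear f"
  shows "linear (lin_exp f)"
proof
  note s = lin_exp_summable[OF assms] and l = linear_funpow[OF assms]
  show "lin_exp f (u + v) = lin_exp f u + lin_exp f v" for u v
    unfolding lin_exp_def
    by (simp add: linear_add[OF l] scaleR_add_right suminf_add[OF s s])
  show "lin_exp f (c *\<^sub>R v) = c *\<^sub>R lin_exp f v" for c v
    unfolding lin_exp_def
    using suminf_scaleR_right[OF s, of c v] by (simp add: linear_scale[OF l] mult.commute)
qed

lemma lin_exp_zero: "lin_exp (\<lambda>v. 0) u = (u :: 'g::euclidean_space)"
proof -
  have z: "(1 / fact n) *\<^sub>R ((\<lambda>v::'g. 0) ^^ n) u = (if n = 0 then u else 0)" for n
    by (cases n) simp_all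
  show ?thesis unfolding lin_exp_def z using sums_If_finite_set[of "{0::nat}" "\<lambda>_. u"]
    by (simp add: sums_iff)
qed

lemma has_vector_derivative_componentwiseI:
  fixes f :: "real \<Rightarrow> 'g::euclidean_space"
  assumes "\<And>b. b \<in> Basis \<Longrightarrow> ((\<lambda>t. f t \<bullet> b) has_real_derivative (f' \<bullet> b)) (at t)"
  shows "(f has_vector_derivative f') (at t)"
  unfolding has_vector_derivative_def
  by (subst has_derivative_componentwise_within)
    (use assms in \<open>auto simp: has_field_derivative_def mult_commute_abs\<close>)

lemma lin_exp_has_vector_derivative:
  fixes f :: "'g::euclidean_space \<Rightarrow> 'g"
  assumes "linear f"
  shows "((\<lambda>t. lin_exp (\<lambda>v. t *\<^sub>R f v) u) has_vector_derivative f (lin_exp (\<lambda>v. t *\<^sub>R f v) u)) (at t)"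
proof (rule has_vector_derivative_componentwiseI)
  fix b :: 'g
  have lin: "linear (\<lambda>v. s *\<^sub>R f v)" for s using assms by (simp add: linear_compose_scale_right)
  have comp: "(\<lambda>n. ((f ^^ n) w \<bullet> b / fact n) * s ^ n) sums (lin_exp (\<lambda>v. s *\<^sub>R f v) w \<bullet> b)" for w s
  proof -
    have "(\<lambda>n. ((1 / fact n) *\<^sub>R ((\<lambda>v. s *\<^sub>R f v) ^^ n) w) \<bullet> b) sums (lin_exp (\<lambda>v. s *\<^sub>R f v) w \<bullet> b)"
      unfolding lin_exp_def
      using bounded_linear.sums[OF bounded_linear_inner_left summable_sums[OF lin_exp_summable[OF lin]]] .
    then show ?thesis by (simp add: funpow_scaled[OF assms] mult.commute)
  qed
  define c where "c = (\<lambda>n. (f ^^ n) u \<bullet> b / fact n)"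
  have "((\<lambda>s. \<Sum>n. c n * s ^ n) has_field_derivative (\<Sum>n. diffs c n * t ^ n)) (at t)"
    by (rule termdiffs_strong_converges_everywhere) (use comp[of u] in \<open>auto simp: c_def sums_iff\<close>)
  moreover have "(\<lambda>s. \<Sum>n. c n * s ^ n) = (\<lambda>s. lin_exp (\<lambda>v. s *\<^sub>R f v) u \<bullet> b)"
    using comp[of u] by (simp add: c_def sums_iff)
  moreover have "diffs c n = (f ^^ n) (f u) \<bullet> b / fact n" for n
    using nonzero_mult_divide_mult_cancel_left[of "real (Suc n)" "(f ^^ n) (f u) \<bullet> b" "fact n"]
    by (simp add: diffs_def c_def funpow_swap1 fact_Suc del: of_nat_Suc)
  then have "(\<Sum>n. diffs c n * t ^ n) = f (lin_exp (\<lambda>v. t *\<^sub>R f v) u) \<bullet> b"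
    using comp[of "f u" t] lin_exp_linear_image[OF lin assms, of t] linear_scale[OF assms] by (simp add: sums_iff)
  ultimately show "((\<lambda>t. lin_exp (\<lambda>v. t *\<^sub>R f v) u \<bullet> b) has_real_derivative
      f (lin_exp (\<lambda>v. t *\<^sub>R f v) u) \<bullet> b) (at t)" by simp
qed

text \<open>
  The algebraic properties of the exponential are obtained from uniqueness of solutions of linear
  differential equations. For the difference \<open>D\<close> of two solutions, \<open>exp(- 2 M t) |D|\<^sup>2\<close> is
  nonincreasing and zero at \<open>0\<close>.\<close>

lemma linear_ode_unique:
  fixes E G :: "real \<Rightarrow> 'g::euclidean_space"
  assumes "linear f"
    and E: "\<And>t. (E has_vector_derivative f (E t)) (at t)"
    and G: "\<And>t. (G has_vector_derivative f (G t)) (at t)"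
    and "E 0 = G 0" "0 \<le> t"
  shows "E t = G t"
proof -
  define D where "D = (\<lambda>t. E t - G t)"
  have D: "(D has_vector_derivative f (D t)) (at t)" for t
    using has_vector_derivative_diff[OF E G] by (simp add: D_def linear_diff[OF assms(1)])
  obtain M where M: "0 < M" "\<And>v. norm (f v) \<le> M * norm v" using linear_bound[OF assms(1)] by blast
  define s where "s = (\<lambda>t. exp (- 2 * M * t) * (D t \<bullet> D t))"
  have "\<exists>y. (s has_real_derivative y) (at x) \<and> y \<le> 0" for x
  proof (intro exI conjI)
    have "((\<lambda>t. D t \<bullet> D t) has_real_derivative D x \<bullet> f (D x) + f (D x) \<bullet> D x) (at x)"
      using bounded_bilinear.has_vector_derivative[OF bounded_bilinear_inner D D]
      by (simp add: has_real_derivative_iff_has_vector_derivative)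
    note d = this
    have "((\<lambda>t. exp (- 2 * M * t)) has_real_derivative exp (- 2 * M * x) * (- 2 * M)) (at x)"
      by (auto intro!: derivative_eq_intros)
    from DERIV_mult[OF this d] show "(s has_real_derivative exp (- 2 * M * x) * (2 * (D x \<bullet> f (D x)) - 2 * M * (D x \<bullet> D x))) (at x)"
      unfolding s_def by (rule DERIV_cong) (simp add: inner_commute algebra_simps)
    have "D x \<bullet> f (D x) \<le> norm (D x) * (M * norm (D x))"
      using norm_cauchy_schwarz[of "D x" "f (D x)"] mult_left_mono[OF M(2)[of "D x"], of "norm (D x)"] by simp
    also have "\<dots> = M * (D x \<bullet> D x)" by (simp add: dot_square_norm power2_eq_square)
    finally show "exp (- 2 * M * x) * (2 * (D x \<bullet> f (D x)) - 2 * M * (D x \<bullet> D x)) \<le> 0"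
      by (simp add: mult_le_0_iff)
  qed
  then have "s t \<le> s 0" using DERIV_nonpos_imp_nonincreasing[OF assms(5), of s] by blast
  then have "D t \<bullet> D t \<le> 0" using assms(4) by (simp add: s_def D_def mult_le_0_iff)
  then have "D t \<bullet> D t = 0" using inner_ge_zero[of "D t"] by linarith
  then show ?thesis by (simp add: D_def)
qed

lemma lin_exp_ode_value:
  fixes E :: "real \<Rightarrow> 'g::euclidean_space"
  assumes "linear f" "\<And>t. (E has_vector_derivative f (E t)) (at t)"
  shows "E 1 = lin_exp f (E 0)"
  using linear_ode_unique[OF assms(1,2) lin_exp_has_vector_derivative[OF assms(1), of "E 0"], of 1]
  by (simp add: lin_exp_zero)

text \<open>Both \<open>exp((1 - t) f) u\<close> and \<open>exp(- t f) (exp(f) u)\<close> solve the equation of \<open>- f\<close> with the same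
  initial value.\<close>

lemma lin_exp_minus:
  fixes f :: "'g::euclidean_space \<Rightarrow> 'g"
  assumes "linear f"
  shows "lin_exp (\<lambda>v. - f v) (lin_exp f u) = u"
proof -
  define E where "E = (\<lambda>t. lin_exp (\<lambda>v. (1 - t) *\<^sub>R f v) u)"
  have "(E has_vector_derivative - f (E t)) (at t)" for t
  proof -
    have "((\<lambda>t. 1 - t) has_real_derivative -1) (at t)" by (auto intro!: derivative_eq_intros)
    from vector_diff_chain_at[OF this[unfolded has_real_derivative_iff_has_vector_derivative]
        lin_exp_has_vector_derivative[OF assms, of u "1 - t"]]
    show ?thesis by (simp add: E_def o_def)
  qed
  then have "E 1 = lin_exp (\<lambda>v. - f v) (E 0)"
    by (intro lin_exp_ode_value) (use assms linear_compose_neg in auto)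
  then show ?thesis by (simp add: E_def lin_exp_zero)
qed

lemma lin_exp_derivation:
  fixes br :: "'g::euclidean_space \<Rightarrow> 'g \<Rightarrow> 'g"
  assumes "linear f" "bilinear br" "\<And>u v. f (br u v) = br (f u) v + br u (f v)"
  shows "lin_exp f (br u v) = br (lin_exp f u) (lin_exp f v)"
proof -
  let ?e = "\<lambda>w t. lin_exp (\<lambda>v. t *\<^sub>R f v) w"
  have "((\<lambda>t. br (?e u t) (?e v t)) has_vector_derivative f (br (?e u t) (?e v t))) (at t)" for t
    using bounded_bilinear.has_vector_derivative[OF bilinear_conv_bounded_bilinear[THEN iffD1, OF assms(2)]
        lin_exp_has_vector_derivative[OF assms(1), of u] lin_exp_has_vector_derivative[OF assms(1), of v]]
    by (simp add: assms(3) add.commute)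
  from lin_exp_ode_value[OF assms(1) this] show ?thesis by (simp add: lin_exp_zero)
qed

section \<open>The Killing form and Cartan involutions\<close>

lemma lin_trace_comm:
  fixes f g :: "'g::euclidean_space \<Rightarrow> 'g"
  assumes "linear f" "linear g"
  shows "lin_trace (f \<circ> g) = lin_trace (g \<circ> f)"
proof -
  have expand: "lin_trace (f \<circ> g) = (\<Sum>b\<in>Basis. \<Sum>c\<in>Basis. (g b \<bullet> c) * (f c \<bullet> b))"
    if f: "linear f" for f g :: "'g \<Rightarrow> 'g"
    unfolding lin_trace_def
  proof (intro sum.cong refl)
    fix b :: 'g
    have "f (g b) = f (\<Sum>c\<in>Basis. (g b \<bullet> c) *\<^sub>R c)" by (simp add: euclidean_representation)
    also have "\<dots> = (\<Sum>c\<in>Basis. (g b \<bullet> c) *\<^sub>R f c)" by (simp add: linear_sum[OF f] linear_scale[OF f])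
    finally show "(f \<circ> g) b \<bullet> b = (\<Sum>c\<in>Basis. (g b \<bullet> c) * (f c \<bullet> b))" by (simp add: inner_sum_left)
  qed
  show ?thesis unfolding expand[OF assms(1)] expand[OF assms(2)] by (subst sum.swap) (simp add: mult.commute)
qed

lemma lin_trace_add: "lin_trace (\<lambda>x. f x + g x) = lin_trace f + lin_trace g"
  by (simp add: lin_trace_def inner_add_left sum.distrib)

lemma lin_trace_diff: "lin_trace (\<lambda>x. f x - g x) = lin_trace f - lin_trace g"
  by (simp add: lin_trace_def inner_diff_left sum_subtractf)

lemma lin_trace_scale: "lin_trace (\<lambda>x. c *\<^sub>R f x) = c * lin_trace f"
  by (simp add: lin_trace_def sum_distrib_left)

locale lie =
  fixes br :: "'g::euclidean_space \<Rightarrow> 'g \<Rightarrow> 'g"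
  assumes lie: "lie_algebra br"
begin

lemma br_bilinear: "bilinear br" using lie by (simp add: lie_algebra_def)

lemmas br_simps [simp] =
  bilinear_ladd[OF br_bilinear] bilinear_radd[OF br_bilinear]
  bilinear_lmul[OF br_bilinear] bilinear_rmul[OF br_bilinear]
  bilinear_lneg[OF br_bilinear] bilinear_rneg[OF br_bilinear]
  bilinear_lsub[OF br_bilinear] bilinear_rsub[OF br_bilinear]
  bilinear_lzero[OF br_bilinear] bilinear_rzero[OF br_bilinear]

lemma br_self [simp]: "br x x = 0" using lie by (simp add: lie_algebra_def)

lemma br_anti: "br x y = - br y x"
proof -
  have "br (x + y) (x + y) = 0" by (rule br_self)
  then show ?thesis by (simp add: eq_neg_iff_add_eq_0 del: br_self) (simp add: add.commute)
qed

lemma jacobi: "br x (br y z) = br (br x y) z + br y (br x z)"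
proof -
  have "br x (br y z) + br y (br z x) + br z (br x y) = 0" using lie by (simp add: lie_algebra_def)
  then show ?thesis using br_anti[of z "br x y"] br_anti[of z x] by (simp add: algebra_simps)
qed

lemma linear_br: "linear (br x)" and linear_br_left: "linear (\<lambda>x. br x y)"
  using br_bilinear by (auto simp: bilinear_def)

lemma linear_br_br: "linear (br x \<circ> br y)" using linear_br linear_compose by blast

lemma killing_bilinear: "bilinear (killing_form br)"
  unfolding bilinear_def
proof (intro conjI allI linearI)
  fix x y z :: 'g and c :: real
  show "killing_form br x (y + z) = killing_form br x y + killing_form br x z"
    "killing_form br (y + z) x = killing_form br y x + killing_form br z x"
    "killing_form br x (c *\<^sub>R y) = c *\<^sub>R killing_form br x y"
    "killing_form br (c *\<^sub>R y) x = c *\<^sub>R killing_form br y x"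
    by (simp_all add: killing_form_def o_def lin_trace_add lin_trace_scale)
qed

lemma killing_sym: "killing_form br x y = killing_form br y x"
  unfolding killing_form_def by (rule lin_trace_comm[OF linear_br linear_br])

lemma killing_invariant: "killing_form br (br x y) z = killing_form br x (br y z)"
proof -
  have e: "br (br u v) w = br u (br v w) - br v (br u w)" for u v w
    by (simp add: jacobi[of u v w])
  have "killing_form br (br x y) z = lin_trace (\<lambda>w. br x (br y (br z w)) - br y (br x (br z w)))"
    unfolding killing_form_def by (rule arg_cong[where f = lin_trace]) (auto simp: e)
  moreover have "killing_form br x (br y z) = lin_trace (\<lambda>w. br x (br y (br z w)) - br x (br z (br y w)))"
    unfolding killing_form_def by (rule arg_cong[where f = lin_trace]) (auto simp: e)
  moreover have "lin_trace (\<lambda>w. br y (br x (br z w))) = lin_trace (\<lambda>w. br x (br z (br y w)))"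
    using lin_trace_comm[OF linear_br[of y] linear_br_br[of x z]] by (simp add: o_def)
  ultimately show ?thesis by (simp add: lin_trace_diff)
qed

text \<open>\<open>ad (\<phi> x) = \<phi> \<circ> ad x \<circ> \<phi>\<^sup>-\<^sup>1\<close>, and traces are invariant under conjugation.\<close>

lemma killing_automorphism:
  assumes "linear \<phi>" "bij \<phi>" "\<And>u v. \<phi> (br u v) = br (\<phi> u) (\<phi> v)"
  shows "killing_form br (\<phi> x) (\<phi> y) = killing_form br x y"
proof -
  define \<psi> where "\<psi> = inv_into UNIV \<phi>"
  have inv: "\<phi> (\<psi> v) = v" "\<psi> (\<phi> v) = v" for v
    using assms(2) by (auto simp: \<psi>_def bij_is_inj bij_is_surj surj_f_inv_f)
  have "linear \<psi>"
    by (rule linearI) (metis inv linear_add[OF assms(1)], metis inv linear_scale[OF assms(1)])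
  have "killing_form br (\<phi> x) (\<phi> y) = lin_trace (\<phi> \<circ> (br x \<circ> br y \<circ> \<psi>))"
    unfolding killing_form_def by (rule arg_cong[where f = lin_trace]) (auto simp: assms(3) inv)
  also have "\<dots> = lin_trace ((br x \<circ> br y \<circ> \<psi>) \<circ> \<phi>)"
    using linear_compose[OF \<open>linear \<psi>\<close> linear_br_br[of x y]] by (intro lin_trace_comm assms(1)) (simp add: o_assoc)
  also have "\<dots> = killing_form br x y" by (simp add: killing_form_def o_def inv)
  finally show ?thesis .
qed

end

locale cartan = lie br for br :: "'g::euclidean_space \<Rightarrow> 'g \<Rightarrow> 'g" +
  fixes \<theta> :: "'g \<Rightarrow> 'g"
  assumes theta: "cartan_involution br \<theta>"
begin

abbreviation B where "B \<equiv> killing_form br"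

definition kk where "kk = {x. \<theta> x = x}"
definition pp where "pp = {x. \<theta> x = - x}"
definition ip where "ip x y = - B x (\<theta> y)"

lemmas B_simps [simp] =
  bilinear_ladd[OF killing_bilinear] bilinear_radd[OF killing_bilinear]
  bilinear_lmul[OF killing_bilinear] bilinear_rmul[OF killing_bilinear]
  bilinear_lneg[OF killing_bilinear] bilinear_rneg[OF killing_bilinear]
  bilinear_lsub[OF killing_bilinear] bilinear_rsub[OF killing_bilinear]
  bilinear_lzero[OF killing_bilinear] bilinear_rzero[OF killing_bilinear]

lemma linear_theta: "linear \<theta>" and theta_theta [simp]: "\<theta> (\<theta> x) = x"
  and theta_br: "\<theta> (br x y) = br (\<theta> x) (\<theta> y)"
  using theta by (auto simp: cartan_involution_def)

lemmas theta_simps [simp] = linear_add[OF linear_theta] linear_diff[OF linear_theta]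
  linear_scale[OF linear_theta] linear_neg[OF linear_theta] linear_0[OF linear_theta]

lemma B_theta: "B (\<theta> x) (\<theta> y) = B x y"
  by (rule killing_automorphism[OF linear_theta _ theta_br]) (metis theta_theta involuntory_imp_bij)

sublocale ip_space ip
proof
  show "bilinear ip" unfolding bilinear_def ip_def by (intro conjI allI linearI) simp_all
  show "ip x y = ip y x" for x y
    unfolding ip_def using B_theta[of x "\<theta> y"] killing_sym[of "\<theta> x" y] by simp
  show "0 < ip x x" if "x \<noteq> 0" for x
    using theta that by (simp add: cartan_involution_def ip_def)
qed

lemma subspace_kk: "subspace kk" and subspace_pp: "subspace pp"
  by (auto simp: kk_def pp_def subspace_def)

lemma ip_pp: "y \<in> pp \<Longrightarrow> ip x y = B x y"
  by (simp add: ip_def pp_def)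

lemma ip_kk: "y \<in> kk \<Longrightarrow> ip x y = - B x y"
  by (simp add: ip_def kk_def)

text \<open>Hence \<open>ad x\<close> is symmetric for \<open>x\<close> in \<open>p\<close> and skew for \<open>x\<close> in \<open>k\<close>.\<close>

lemma ad_adjoint: "ip (br x u) v = - ip u (br (\<theta> x) v)"
proof -
  have "B (br x u) (\<theta> v) = - B (br u x) (\<theta> v)" using br_anti[of x u] by simp
  also have "\<dots> = - B u (br x (\<theta> v))" by (simp add: killing_invariant)
  also have "br x (\<theta> v) = \<theta> (br (\<theta> x) v)" by (simp add: theta_br)
  finally show ?thesis by (simp add: ip_def)
qed

lemma sym_op_ad: "x \<in> pp \<Longrightarrow> sym_op (br x)"
  by (simp add: sym_op_def linear_br ad_adjoint pp_def)

lemma br_kp: "x \<in> kk \<Longrightarrow> y \<in> pp \<Longrightarrow> br x y \<in> pp" and br_pk: "y \<in> pp \<Longrightarrow> x \<in> kk \<Longrightarrow> br y x \<in> pp"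
  and br_pp: "y \<in> pp \<Longrightarrow> z \<in> pp \<Longrightarrow> br y z \<in> kk" and br_kk: "x \<in> kk \<Longrightarrow> w \<in> kk \<Longrightarrow> br x w \<in> kk"
  by (simp_all add: kk_def pp_def theta_br)

lemma kp_decomp:
  obtains x y where "v = x + y" "x \<in> kk" "y \<in> pp"
proof
  show "v = (1/2) *\<^sub>R (v + \<theta> v) + (1/2) *\<^sub>R (v - \<theta> v)"
    by (simp add: scaleR_add_right[symmetric] scaleR_2[symmetric])
  show "(1/2) *\<^sub>R (v + \<theta> v) \<in> kk" "(1/2) *\<^sub>R (v - \<theta> v) \<in> pp"
    by (simp_all add: kk_def pp_def add.commute scaleR_diff_right)
qed

lemma ad_faithful:
  assumes "\<And>y. br x y = 0"
  shows "x = 0"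
proof -
  have "B x (\<theta> x) = lin_trace (\<lambda>v::'g. 0::'g)"
    unfolding killing_form_def by (rule arg_cong[where f = lin_trace]) (auto simp: assms)
  then have "ip x x = 0" by (simp add: ip_def lin_trace_def)
  then show ?thesis by (simp add: ip_eq_0_iff)
qed

lemma B_sum_left: "B (\<Sum>j\<in>A. s j *\<^sub>R f j) v = (\<Sum>j\<in>A. s j * B (f j) v)"
  using linear_sum[of "\<lambda>u. B u v" "\<lambda>j. s j *\<^sub>R f j" A] killing_bilinear by (simp add: bilinear_def)

lemma B_sum_right: "B v (\<Sum>j\<in>A. s j *\<^sub>R f j) = (\<Sum>j\<in>A. s j * B v (f j))"
  by (simp add: killing_sym[of v] B_sum_left)

lemma B_pos: "x \<in> pp \<Longrightarrow> x \<noteq> 0 \<Longrightarrow> 0 < B x x"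
  using ip_pos[of x] by (simp add: ip_pp)

section \<open>The group K\<close>

text \<open>The properties shared by all elements of \<open>K\<close>; since they are stable under composition, they pass from
  exponentials to the generated group.\<close>

definition kauto :: "('g \<Rightarrow> 'g) \<Rightarrow> bool" where
  "kauto \<phi> \<longleftrightarrow> linear \<phi> \<and> bij \<phi> \<and> (\<forall>u v. \<phi> (br u v) = br (\<phi> u) (\<phi> v)) \<and> (\<forall>u. \<theta> (\<phi> u) = \<phi> (\<theta> u))"

lemma lin_exp_ad_inverse: "lin_exp (br (- x)) (lin_exp (br x) u) = u"
proof -
  have "br (- x) = (\<lambda>v. - br x v)" by (rule ext) simp
  then show ?thesis using lin_exp_minus[OF linear_br, of x u] by simp
qed

lemma lin_exp_ad_inverse': "lin_exp (br x) (lin_exp (br (- x)) u) = u"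
  using lin_exp_ad_inverse[of "- x" u] by simp

lemma bij_lin_exp_ad: "bij (lin_exp (br x))"
proof (rule o_bij)
  show "lin_exp (br (- x)) \<circ> lin_exp (br x) = id"
    by (rule ext) (simp only: o_apply id_apply lin_exp_ad_inverse)
  show "lin_exp (br x) \<circ> lin_exp (br (- x)) = id"
    by (rule ext) (simp only: o_apply id_apply lin_exp_ad_inverse')
qed

lemma kauto_lin_exp: assumes "x \<in> kk" shows "kauto (lin_exp (br x))"
  unfolding kauto_def
proof (intro conjI allI)
  show "linear (lin_exp (br x))" by (rule linear_lin_exp[OF linear_br])
  show "bij (lin_exp (br x))" by (rule bij_lin_exp_ad)
  show "lin_exp (br x) (br u v) = br (lin_exp (br x) u) (lin_exp (br x) v)" for u v
    by (rule lin_exp_derivation[where f = "br x" and br = br]) (rule linear_br br_bilinear jacobi)+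
  show "\<theta> (lin_exp (br x) u) = lin_exp (br x) (\<theta> u)" for u
    by (rule lin_exp_linear_image[where f = "br x" and g = \<theta>, OF linear_br linear_theta]) (use assms in \<open>simp add: theta_br kk_def\<close>)
qed

abbreviation K where "K \<equiv> K_group br kk"

lemma carrier_BijGroup_UNIV: "f \<in> carrier (BijGroup (UNIV :: 'g set)) \<longleftrightarrow> bij f"
  by (simp add: BijGroup_def Bij_def)

lemma mult_BijGroup_UNIV: "bij f \<Longrightarrow> bij g \<Longrightarrow> f \<otimes>\<^bsub>BijGroup (UNIV :: 'g set)\<^esub> g = f \<circ> g"
  by (simp add: BijGroup_def Bij_def compose_def o_def restrict_UNIV)

lemma inv_lin_exp: "inv\<^bsub>BijGroup (UNIV :: 'g set)\<^esub> (lin_exp (br x)) = lin_exp (br (- x))"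
proof (rule group.inv_equality[OF group_BijGroup])
  show "lin_exp (br (- x)) \<otimes>\<^bsub>BijGroup UNIV\<^esub> lin_exp (br x) = \<one>\<^bsub>BijGroup UNIV\<^esub>"
    by (subst mult_BijGroup_UNIV[OF bij_lin_exp_ad bij_lin_exp_ad])
      (simp add: BijGroup_def fun_eq_iff lin_exp_ad_inverse del: br_simps)
qed (simp_all only: carrier_BijGroup_UNIV bij_lin_exp_ad)

lemma K_induct [consumes 1, case_names id exp comp]:
  assumes "\<phi> \<in> K" and id: "P (\<lambda>x. x)" and exp: "\<And>x. x \<in> kk \<Longrightarrow> P (lin_exp (br x))"
    and comp: "\<And>f g. kauto f \<Longrightarrow> kauto g \<Longrightarrow> P f \<Longrightarrow> P g \<Longrightarrow> P (f \<circ> g)"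
  shows "P \<phi>" "kauto \<phi>"
proof -
  have neg: "- x \<in> kk" if "x \<in> kk" for x using that by (simp add: kk_def)
  have "\<phi> \<in> generate (BijGroup UNIV) (lin_exp ` br ` kk)"
    using assms(1) by (simp add: K_group_def analytic_subgroup_def)
  then have "P \<phi> \<and> kauto \<phi>"
  proof induction
    case one
    show ?case using id by (simp add: BijGroup_def restrict_UNIV kauto_def linear_ident bij_id[unfolded id_def])
  next
    case (incl h)
    then show ?case using exp kauto_lin_exp by blast
  next
    case (inv h)
    then show ?case using exp kauto_lin_exp inv_lin_exp neg by auto
  next
    case (eng h1 h2)
    then have "h1 \<otimes>\<^bsub>BijGroup UNIV\<^esub> h2 = h1 \<circ> h2" by (intro mult_BijGroup_UNIV) (auto simp: kauto_def)
    moreover have "kauto (h1 \<circ> h2)" using eng by (simp add: kauto_def linear_compose bij_comp)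
    ultimately show ?case using comp eng by metis
  qed
  then show "P \<phi>" "kauto \<phi>" by auto
qed

lemma K_kauto: "\<phi> \<in> K \<Longrightarrow> kauto \<phi>"
  by (rule K_induct(2)[where P = "\<lambda>_. True"]) auto

lemma K_id: "(\<lambda>x. x) \<in> K"
  using generate.one[of "BijGroup (UNIV :: 'g set)" "lin_exp ` br ` kk"]
  by (simp add: K_group_def analytic_subgroup_def BijGroup_def restrict_UNIV)

lemma K_exp: "x \<in> kk \<Longrightarrow> lin_exp (br x) \<in> K"
  by (simp add: K_group_def analytic_subgroup_def generate.incl)

lemma K_comp: "f \<in> K \<Longrightarrow> g \<in> K \<Longrightarrow> f \<circ> g \<in> K"
  using generate.eng[of f "BijGroup (UNIV :: 'g set)" "lin_exp ` br ` kk" g] K_kauto[of f] K_kauto[of g]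
  by (simp add: K_group_def analytic_subgroup_def mult_BijGroup_UNIV kauto_def)

lemma K_inverse:
  assumes "\<phi> \<in> K"
  obtains \<psi> where "\<psi> \<in> K" "\<And>v. \<psi> (\<phi> v) = v" "\<And>v. \<phi> (\<psi> v) = v"
proof -
  have "\<exists>\<psi>\<in>K. (\<forall>v. \<psi> (\<phi> v) = v) \<and> (\<forall>v. \<phi> (\<psi> v) = v)"
    using assms
  proof (induction rule: K_induct(1))
    case id
    show ?case using K_id by (intro bexI[of _ "\<lambda>x. x"]) simp_all
  next
    case (exp x)
    then have "lin_exp (br (- x)) \<in> K" by (intro K_exp) (simp add: kk_def)
    then show ?case using lin_exp_ad_inverse lin_exp_ad_inverse' by blast
  next
    case (comp f g)
    then obtain f' g' where "f' \<in> K" "g' \<in> K" "\<forall>v. f' (f v) = v" "\<forall>v. f (f' v) = v"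
      "\<forall>v. g' (g v) = v" "\<forall>v. g (g' v) = v" by blast
    then show ?case using K_comp[of g' f'] by (intro bexI[of _ "g' \<circ> f'"]) simp_all
  qed
  then show thesis using that by blast
qed

lemma K_linear: "\<phi> \<in> K \<Longrightarrow> linear \<phi>" and K_br: "\<phi> \<in> K \<Longrightarrow> \<phi> (br u v) = br (\<phi> u) (\<phi> v)"
  and K_theta: "\<phi> \<in> K \<Longrightarrow> \<theta> (\<phi> u) = \<phi> (\<theta> u)"
  using K_kauto by (auto simp: kauto_def)

lemma K_B: "\<phi> \<in> K \<Longrightarrow> B (\<phi> u) (\<phi> v) = B u v"
  using K_kauto killing_automorphism unfolding kauto_def by blast

lemma K_ip: "\<phi> \<in> K \<Longrightarrow> ip (\<phi> u) (\<phi> v) = ip u v"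
  by (simp add: ip_def K_theta K_B)

lemma K_ip_norm: "\<phi> \<in> K \<Longrightarrow> ip_norm (\<phi> u) = ip_norm u"
  by (simp add: ip_norm_def K_ip)

lemma K_pp: "\<phi> \<in> K \<Longrightarrow> y \<in> pp \<Longrightarrow> \<phi> y \<in> pp"
  using K_linear[of \<phi>] by (simp add: pp_def K_theta linear_neg)

abbreviation orb where "orb \<equiv> K_orbit br kk"

lemma orbI: "\<phi> \<in> K \<Longrightarrow> \<phi> c \<in> orb c" and orb_self: "c \<in> orb c"
  using K_id by (auto simp: K_orbit_def)

lemma orbE: assumes "y \<in> orb c" obtains \<phi> where "\<phi> \<in> K" "y = \<phi> c"
  using assms by (auto simp: K_orbit_def)

lemma orb_K: assumes "\<phi> \<in> K" "y \<in> orb c" shows "\<phi> y \<in> orb c"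
  using assms K_comp[OF assms(1)] by (metis comp_apply orbE orbI)

lemma orb_K_iff: assumes "\<phi> \<in> K" shows "\<phi> y \<in> orb c \<longleftrightarrow> y \<in> orb c"
  using orb_K K_inverse[OF assms] assms by metis

lemma orb_sub_pp: "c \<in> pp \<Longrightarrow> orb c \<subseteq> pp"
  using K_pp by (auto elim: orbE)

lemma bounded_orb: "bounded (orb c)"
proof -
  obtain M where "\<And>v. norm v \<le> M * ip_norm v" using norm_le_ip_norm by blast
  then have "norm v \<le> M * ip_norm c" if "v \<in> orb c" for v using that K_ip_norm by (metis orbE)
  then show ?thesis by (auto simp: bounded_iff)
qed

lemma exp_curve: "((\<lambda>t. lin_exp (br (t *\<^sub>R x)) u) has_vector_derivative br x (lin_exp (br (t *\<^sub>R x)) u)) (at t)"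
proof -
  have "br (t *\<^sub>R x) = (\<lambda>v. t *\<^sub>R br x v)" for t by (rule ext) simp
  then show ?thesis using lin_exp_has_vector_derivative[OF linear_br[of x], of u t] by simp
qed

end

section \<open>Alternating forms as a representation\<close>

text \<open>Exterior powers of \<open>g\<close> are represented dually, by alternating forms in \<open>d\<close> arguments. A tuple is a
  sequence of which only the first \<open>d\<close> entries count.\<close>

definition multilinear :: "nat \<Rightarrow> ((nat \<Rightarrow> 'g::real_vector) \<Rightarrow> real) \<Rightarrow> bool" where
  "multilinear d F \<longleftrightarrow> (\<forall>w j. j < d \<longrightarrow> linear (\<lambda>u. F (w(j := u)))) \<and>
     (\<forall>w w'. (\<forall>j<d. w j = w' j) \<longrightarrow> F w = F w')"

definition alternating :: "nat \<Rightarrow> ((nat \<Rightarrow> 'g::real_vector) \<Rightarrow> real) \<Rightarrow> bool" where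
  "alternating d F \<longleftrightarrow> (\<forall>w i j. i < d \<longrightarrow> j < d \<longrightarrow> i \<noteq> j \<longrightarrow> w i = w j \<longrightarrow> F w = 0)"

lemma multilinear_linear: "multilinear d F \<Longrightarrow> j < d \<Longrightarrow> linear (\<lambda>u. F (w(j := u)))"
  by (simp add: multilinear_def)

lemma multilinear_add: "multilinear d F \<Longrightarrow> j < d \<Longrightarrow> F (w(j := u + v)) = F (w(j := u)) + F (w(j := v))"
  and multilinear_scale: "multilinear d F \<Longrightarrow> j < d \<Longrightarrow> F (w(j := c *\<^sub>R u)) = c * F (w(j := u))"
  and multilinear_diff: "multilinear d F \<Longrightarrow> j < d \<Longrightarrow> F (w(j := u - v)) = F (w(j := u)) - F (w(j := v))"
  using linear_add[OF multilinear_linear[of d F j w], of u v] linear_scale[OF multilinear_linear[of d F j w], of c u]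
    linear_diff[OF multilinear_linear[of d F j w], of u v]
  by simp_all

lemma multilinear_cong: "multilinear d F \<Longrightarrow> (\<And>j. j < d \<Longrightarrow> w j = w' j) \<Longrightarrow> F w = F w'"
  by (simp add: multilinear_def)

lemma multilinear_sum:
  "multilinear d F \<Longrightarrow> j < d \<Longrightarrow> F (w(j := \<Sum>i\<in>A. c i *\<^sub>R f i)) = (\<Sum>i\<in>A. c i * F (w(j := f i)))"
  using linear_sum[OF multilinear_linear[of d F j w], of "\<lambda>i. c i *\<^sub>R f i" A] multilinear_scale[of d F j w]
  by simp

lemma multilinear_expand:
  fixes F :: "(nat \<Rightarrow> 'g::euclidean_space) \<Rightarrow> real"
  assumes "multilinear d F" "j < d"
  shows "F (w(j := v)) = (\<Sum>b\<in>Basis. (v \<bullet> b) * F (w(j := b)))"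
  using multilinear_sum[OF assms, of w "\<lambda>b. v \<bullet> b" "\<lambda>b. b" Basis] by (simp add: euclidean_representation)

text \<open>The product rule, by releasing the slots one after another: a slot is expanded in the
  distinguished basis, so that the rule for products of real functions applies.\<close>

lemma multilinear_has_derivative:
  fixes F :: "(nat \<Rightarrow> 'g::euclidean_space) \<Rightarrow> real"
  assumes F: "multilinear d F" and c: "\<And>j. j < d \<Longrightarrow> (c j has_vector_derivative c' j) (at t)"
  shows "((\<lambda>s. F (\<lambda>j. c j s)) has_real_derivative (\<Sum>j<d. F ((\<lambda>j. c j t)(j := c' j)))) (at t)"
proof -
  \<comment> \<open>the first \<open>m\<close> slots move, the others are frozen at \<open>w\<close>\<close>
  define X where "X = (\<lambda>m w s j. if j < m then c j s else (w j :: 'g))"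
  have XSuc: "X (Suc m) w s = (X m w s)(m := c m s)" for m w s
    by (auto simp: X_def fun_eq_iff less_Suc_eq)
  have Xupd: "X m (w(m := b)) s = (X m w s)(m := b)" for m w s b
    by (auto simp: X_def fun_eq_iff)
  have "((\<lambda>s. F (X m w s)) has_real_derivative (\<Sum>j<m. F ((X m w t)(j := c' j)))) (at t)" if "m \<le> d" for m w
    using that
  proof (induction m arbitrary: w)
    case 0
    then show ?case by (simp add: X_def)
  next
    case (Suc m)
    then have m: "m < d" "m \<le> d" by auto
    have "((\<lambda>s. \<Sum>b\<in>Basis. (c m s \<bullet> b) * F (X m (w(m := b)) s)) has_real_derivative
        (\<Sum>b\<in>Basis. (c' m \<bullet> b) * F (X m (w(m := b)) t)
           + (\<Sum>j<m. F ((X m (w(m := b)) t)(j := c' j))) * (c m t \<bullet> b))) (at t)"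
    proof (rule DERIV_sum)
      fix b :: 'g
      have "((\<lambda>s. c m s \<bullet> b) has_real_derivative c' m \<bullet> b) (at t)"
        using bounded_linear.has_vector_derivative[OF bounded_linear_inner_left c[OF m(1)]]
        by (simp add: has_real_derivative_iff_has_vector_derivative)
      from DERIV_mult[OF this Suc.IH[OF m(2)]]
      show "((\<lambda>s. (c m s \<bullet> b) * F (X m (w(m := b)) s)) has_real_derivative
        (c' m \<bullet> b) * F (X m (w(m := b)) t)
           + (\<Sum>j<m. F ((X m (w(m := b)) t)(j := c' j))) * (c m t \<bullet> b)) (at t)" .
    qed
    moreover have "(\<Sum>b\<in>Basis. (c m s \<bullet> b) * F (X m (w(m := b)) s)) = F (X (Suc m) w s)" for s
      by (simp add: XSuc Xupd multilinear_expand[OF F m(1), of _ "c m s"])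
    moreover have "(\<Sum>b\<in>Basis. (c' m \<bullet> b) * F (X m (w(m := b)) t)
           + (\<Sum>j<m. F ((X m (w(m := b)) t)(j := c' j))) * (c m t \<bullet> b))
        = (\<Sum>j<Suc m. F ((X (Suc m) w t)(j := c' j)))"
    proof -
      have 1: "(\<Sum>b\<in>Basis. (c' m \<bullet> b) * F (X m (w(m := b)) t)) = F ((X (Suc m) w t)(m := c' m))"
        by (simp add: XSuc Xupd multilinear_expand[OF F m(1), of _ "c' m"])
      have 2: "(\<Sum>b\<in>Basis. F ((X m (w(m := b)) t)(j := c' j)) * (c m t \<bullet> b)) = F ((X (Suc m) w t)(j := c' j))"
        if "j < m" for j
      proof -
        have "(X (Suc m) w t)(j := c' j) = ((X m w t)(j := c' j))(m := c m t)"
          using that by (simp add: XSuc fun_upd_twist)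
        moreover have "(X m (w(m := b)) t)(j := c' j) = ((X m w t)(j := c' j))(m := b)" for b
          using that by (simp add: Xupd fun_upd_twist)
        ultimately show ?thesis using multilinear_expand[OF F m(1), of "(X m w t)(j := c' j)" "c m t"]
          by (simp add: mult.commute)
      qed
      show ?thesis
        by (simp add: sum.distrib 1 sum_distrib_right) (subst sum.swap, simp add: 2)
    qed
    ultimately show ?case by (simp only:)
  qed
  from this[of d "\<lambda>j. c j t"]
  have "((\<lambda>s. F (X d (\<lambda>j. c j t) s)) has_real_derivative (\<Sum>j<d. F ((X d (\<lambda>j. c j t) t)(j := c' j)))) (at t)"
    by simp
  moreover have "F (X d (\<lambda>j. c j t) s) = F (\<lambda>j. c j s)" for s
    by (rule multilinear_cong[OF F]) (simp add: X_def)
  moreover have "X d (\<lambda>j. c j t) t = (\<lambda>j. c j t)" by (simp add: X_def fun_eq_iff)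
  ultimately show ?thesis by simp
qed

lemma alternating_antisym:
  assumes "multilinear d F" "alternating d F" "i < d" "j < d" "i \<noteq> j"
  shows "F (w(i := u, j := v)) + F (w(i := v, j := u)) = 0"
proof -
  have z: "F (w(i := y, j := y)) = 0" for y
    using assms(2-5) unfolding alternating_def by (metis fun_upd_same fun_upd_other)
  have "F (w(i := u + v, j := u + v)) = F (w(i := u, j := u + v)) + F (w(i := v, j := u + v))"
    using multilinear_add[OF assms(1,3), of "w(j := u + v)"] assms(5) by (simp add: fun_upd_twist)
  also have "\<dots> = F (w(i := u, j := u)) + F (w(i := u, j := v)) + (F (w(i := v, j := u)) + F (w(i := v, j := v)))"
    by (simp add: multilinear_add[OF assms(1,4)])
  finally show ?thesis using z by simp
qed

lemma obtain_dependent_member: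
  fixes x :: "nat \<Rightarrow> 'g::euclidean_space"
  assumes "\<And>j. j < d \<Longrightarrow> x j \<in> S" "dim S < d"
  obtains j c where "j < d" "x j = (\<Sum>i\<in>{..<d} - {j}. c i *\<^sub>R x i)"
proof -
  have "\<exists>j<d. x j \<in> span (x ` ({..<d} - {j}))"
  proof (rule ccontr)
    assume "\<not> ?thesis"
    then have n: "\<And>j. j < d \<Longrightarrow> x j \<notin> span (x ` ({..<d} - {j}))" by blast
    have inj: "inj_on x {..<d}"
    proof (rule inj_onI, rule ccontr)
      fix i j assume "i \<in> {..<d}" "j \<in> {..<d}" "x i = x j" "i \<noteq> j"
      then have "x j \<in> x ` ({..<d} - {j})" by (metis DiffI imageI singletonD)
      then have "x j \<in> span (x ` ({..<d} - {j}))" by (rule span_base)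
      then show False using n[of j] \<open>j \<in> {..<d}\<close> by simp
    qed
    have "independent (x ` {..<d})"
      unfolding dependent_def
    proof clarify
      fix j assume j: "j < d" "x j \<in> span (x ` {..<d} - {x j})"
      have "x ` {..<d} - {x j} \<subseteq> x ` ({..<d} - {j})" by blast
      then show False using n[OF j(1)] j(2) span_mono by blast
    qed
    moreover have "x ` {..<d} \<subseteq> S" using assms(1) by blast
    ultimately have "card (x ` {..<d}) \<le> dim S" by (rule independent_card_le_dim[rotated])
    then show False using card_image[OF inj] assms(2) by simp
  qed
  then obtain j where j: "j < d" "x j \<in> span (x ` ({..<d} - {j}))" by blast
  let ?I = "{..<d} - {j}"
  define T where "T = range (\<lambda>c. \<Sum>i\<in>?I. c i *\<^sub>R x i)"
  have "subspace T"
    unfolding T_def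
  proof (rule subspaceI)
    show "0 \<in> range (\<lambda>c. \<Sum>i\<in>?I. c i *\<^sub>R x i)" by (rule range_eqI[of _ _ "\<lambda>_. 0"]) simp
    show "u + v \<in> range (\<lambda>c. \<Sum>i\<in>?I. c i *\<^sub>R x i)"
      if uv: "u \<in> range (\<lambda>c. \<Sum>i\<in>?I. c i *\<^sub>R x i)" "v \<in> range (\<lambda>c. \<Sum>i\<in>?I. c i *\<^sub>R x i)" for u v
    proof -
      obtain c c' where "u = (\<Sum>i\<in>?I. c i *\<^sub>R x i)" "v = (\<Sum>i\<in>?I. c' i *\<^sub>R x i)" using uv by auto
      then show ?thesis by (intro range_eqI[of _ _ "\<lambda>i. c i + c' i"]) (simp add: scaleR_add_left sum.distrib)
    qed
    show "s *\<^sub>R u \<in> range (\<lambda>c. \<Sum>i\<in>?I. c i *\<^sub>R x i)" if u: "u \<in> range (\<lambda>c. \<Sum>i\<in>?I. c i *\<^sub>R x i)" for s u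
    proof -
      obtain c where "u = (\<Sum>i\<in>?I. c i *\<^sub>R x i)" using u by auto
      then show ?thesis by (intro range_eqI[of _ _ "\<lambda>i. s * c i"]) (simp add: scaleR_sum_right)
    qed
  qed
  moreover have "x i \<in> T" if "i \<in> ?I" for i
  proof -
    have "x i = (\<Sum>l\<in>?I. (if l = i then 1 else 0) *\<^sub>R x l)"
      using that by (simp add: if_distrib[of "\<lambda>s. s *\<^sub>R _"] cong: if_cong)
    then show ?thesis
      unfolding T_def by (rule range_eqI[where x = "\<lambda>l. if l = i then 1 else 0"])
  qed
  ultimately have "x j \<in> T" using j(2) span_minimal[of "x ` ?I" T] by blast
  then show thesis using that j(1) unfolding T_def by blast
qed

text \<open>The rank condition in terms of forms: if modulo \<open>W\<close> the arguments lie in a space of dimension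
  less than \<open>d\<close>, then one of them is a combination of the others modulo \<open>W\<close>.\<close>

lemma alternating_pigeonhole:
  fixes F :: "(nat \<Rightarrow> 'g::euclidean_space) \<Rightarrow> real"
  assumes "multilinear d F" "alternating d F"
    and W: "\<And>w j. j < d \<Longrightarrow> w j \<in> W \<Longrightarrow> F w = 0"
    and P: "subspace W" "linear P" "\<And>j. j < d \<Longrightarrow> a j - P (a j) \<in> W" "\<And>j. j < d \<Longrightarrow> P (a j) \<in> S" "dim S < d"
  shows "F a = 0"
proof -
  obtain j c where j: "j < d" and c: "P (a j) = (\<Sum>i\<in>{..<d} - {j}. c i *\<^sub>R P (a i))"
    using obtain_dependent_member[of d "\<lambda>j. P (a j)" S] P(4,5) by blast
  let ?I = "{..<d} - {j}"
  define s where "s = (\<Sum>i\<in>?I. c i *\<^sub>R a i)"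
  have "a j - s = (a j - P (a j)) - (\<Sum>i\<in>?I. c i *\<^sub>R (a i - P (a i)))"
    unfolding c s_def by (simp add: scaleR_diff_right sum_subtractf)
  also have "\<dots> \<in> W"
    by (intro subspace_diff[OF P(1)] P(3) subspace_sum[OF P(1)] subspace_scale[OF P(1)] j) auto
  finally have r: "F (a(j := a j - s)) = 0" using W[OF j, of "a(j := a j - s)"] by simp
  have "F (a(j := s)) = (\<Sum>i\<in>?I. c i * F (a(j := a i)))" unfolding s_def by (rule multilinear_sum[OF assms(1) j])
  also have "\<dots> = 0"
  proof (intro sum.neutral ballI)
    fix i assume "i \<in> ?I"
    then have "F (a(j := a i)) = 0"
      using assms(2) j unfolding alternating_def by (metis DiffE fun_upd_other fun_upd_same insertI1 lessThan_iff)
    then show "c i * F (a(j := a i)) = 0" by simp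
  qed
  finally have "F (a(j := s)) = 0" .
  then have "F (a(j := (a j - s) + s)) = 0" using r by (simp only: multilinear_add[OF assms(1) j])
  then show ?thesis by simp
qed

context lie
begin

text \<open>Up to sign, the action of the Lie algebra on the space of \<open>d\<close>-forms.\<close>

definition act :: "nat \<Rightarrow> 'g \<Rightarrow> ((nat \<Rightarrow> 'g) \<Rightarrow> real) \<Rightarrow> (nat \<Rightarrow> 'g) \<Rightarrow> real" where
  "act d x F w = (\<Sum>j<d. F (w(j := br x (w j))))"

lemma act_multilinear: assumes "multilinear d F" shows "multilinear d (act d x F)"
  unfolding multilinear_def
proof (intro conjI allI impI)
  fix w :: "nat \<Rightarrow> 'g" and j assume j: "j < d"
  have "linear (\<lambda>u. F ((w(j := u))(i := br x ((w(j := u)) i))))" if "i < d" for i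
  proof (cases "i = j")
    case True
    have "linear (\<lambda>u. F (w(j := br x u)))"
      using linear_compose[OF linear_br[of x] multilinear_linear[OF assms j, of w]] by (simp add: o_def)
    then show ?thesis using True by simp
  next
    case False
    then have "(\<lambda>u. F ((w(j := u))(i := br x ((w(j := u)) i)))) = (\<lambda>u. F ((w(i := br x (w i)))(j := u)))"
      by (simp add: fun_upd_twist)
    then show ?thesis using multilinear_linear[OF assms j] by simp
  qed
  then show "linear (\<lambda>u. act d x F (w(j := u)))" unfolding act_def by (intro linear_compose_sum) auto
next
  fix w w' :: "nat \<Rightarrow> 'g" assume w: "\<forall>j<d. w j = w' j"
  then have "F (w(j := br x (w j))) = F (w'(j := br x (w' j)))" if "j < d" for j
    using that by (intro multilinear_cong[OF assms]) simp
  then show "act d x F w = act d x F w'" by (simp add: act_def)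
qed

lemma act_alternating: assumes "multilinear d F" "alternating d F" shows "alternating d (act d x F)"
  unfolding alternating_def
proof (intro allI impI)
  fix w :: "nat \<Rightarrow> 'g" and i j assume ij: "i < d" "j < d" "i \<noteq> j" "w i = w j"
  let ?t = "\<lambda>l. F (w(l := br x (w l)))"
  have "act d x F w = ?t i + (?t j + (\<Sum>l\<in>{..<d} - {i} - {j}. ?t l))"
    unfolding act_def using ij sum.remove[of "{..<d}" i ?t] sum.remove[of "{..<d} - {i}" j ?t] by simp
  moreover have "?t l = 0" if "l \<in> {..<d} - {i} - {j}" for l
    using assms(2) ij that unfolding alternating_def
    by (metis Diff_iff fun_upd_other insertI1)
  moreover have "?t i + ?t j = 0"
  proof -
    have "w(i := u, j := w i) = w(i := u)" "w(i := w i, j := u) = w(j := u)" for u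
      using ij by (auto simp: fun_eq_iff)
    then show ?thesis
      using alternating_antisym[OF assms ij(1-3), of w "br x (w i)" "w i"] ij(4) by simp
  qed
  ultimately show "act d x F w = 0" by simp
qed

text \<open>Contributions of two different slots cancel; the remaining ones combine by the Jacobi identity.\<close>

lemma act_commutator:
  assumes "multilinear d F"
  shows "act d x (act d y F) w = act d y (act d x F) w + act d (br y x) F w"
proof -
  define T where "T = (\<lambda>x y i j. F ((w(i := br x (w i)))(j := br y ((w(i := br x (w i))) j))))"
  have DD: "act d x (act d y F) w = (\<Sum>i<d. \<Sum>j<d. T x y i j)" for x y by (simp add: act_def T_def)
  have swap: "T y x j i = T x y i j" if "i \<noteq> j" for i j
    using that by (simp add: T_def fun_upd_twist)
  have "act d x (act d y F) w - act d y (act d x F) w = (\<Sum>i<d. \<Sum>j<d. T x y i j - T y x j i)"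
    unfolding DD sum_subtractf by (simp add: sum.swap[of "\<lambda>i j. T y x i j"])
  also have "\<dots> = (\<Sum>i<d. \<Sum>j<d. if j = i then T x y i i - T y x i i else 0)"
    using swap by (intro sum.cong refl) auto
  also have "\<dots> = (\<Sum>i<d. T x y i i - T y x i i)" by (simp cong: if_cong)
  also have "\<dots> = act d (br y x) F w"
    unfolding act_def
  proof (intro sum.cong refl)
    fix i assume "i \<in> {..<d}"
    then have i: "i < d" by simp
    have "br (br y x) (w i) = br y (br x (w i)) - br x (br y (w i))" by (simp add: jacobi[of y x])
    then show "T x y i i - T y x i i = F (w(i := br (br y x) (w i)))"
      by (simp add: T_def multilinear_diff[OF assms i])
  qed
  finally show ?thesis by simp
qed

lemma act_split: "multilinear d F \<Longrightarrow> act d (x + y) F w = act d x F w + act d y F w"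
  by (simp add: act_def multilinear_add sum.distrib)

abbreviation act_word where "act_word d \<equiv> foldr (act d)"

lemma act_word_add: "act_word d ws (\<lambda>w. F w + G w) = (\<lambda>w. act_word d ws F w + act_word d ws G w)"
  by (induction ws) (simp_all add: act_def sum.distrib fun_eq_iff)

lemma act_word_multilinear: "multilinear d F \<Longrightarrow> multilinear d (act_word d ws F)"
  by (induction ws) (simp_all add: act_multilinear)

definition vanishing :: "nat \<Rightarrow> 'g set \<Rightarrow> ((nat \<Rightarrow> 'g) \<Rightarrow> real) \<Rightarrow> bool" where
  "vanishing d U F \<longleftrightarrow> (\<forall>a. (\<forall>j<d. a j \<in> U) \<longrightarrow> F a = 0)"

lemma vanishing_act:
  assumes "vanishing d U F" "\<And>u. u \<in> U \<Longrightarrow> br e u \<in> U"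
  shows "vanishing d U (act d e F)"
  using assms by (auto simp: vanishing_def act_def intro!: sum.neutral)

text \<open>The Poincare-Birkhoff-Witt argument. Elements of \<open>N\<close> can be absorbed into the form at the inner end of
  a word, elements of \<open>Q\<close> are harmless at the outer end, and exchanging neighbours costs only
  shorter words.\<close>

lemma vanishing_words:
  assumes Q: "\<And>e u. e \<in> Q \<Longrightarrow> u \<in> U \<Longrightarrow> br e u \<in> U"
    and N: "\<And>F f. F \<in> \<F> \<Longrightarrow> f \<in> N \<Longrightarrow> act d f F \<in> \<F>"
    and NQ: "\<And>x. \<exists>f\<in>N. \<exists>e\<in>Q. x = f + e"
    and \<F>: "\<And>F. F \<in> \<F> \<Longrightarrow> multilinear d F" "\<And>F. F \<in> \<F> \<Longrightarrow> vanishing d U F"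
  shows "F \<in> \<F> \<Longrightarrow> vanishing d U (act_word d ws F)"
proof (induction "length ws" arbitrary: ws F rule: less_induct)
  case less
  have add: "vanishing d U (\<lambda>w. G w + H w)" if "vanishing d U G" "vanishing d U H" for G H
    using that by (auto simp: vanishing_def)
  show ?case
  proof (cases ws rule: rev_cases)
    case Nil
    then show ?thesis using \<F>(2) less.prems by simp
  next
    case (snoc us x)
    obtain f e where fe: "f \<in> N" "e \<in> Q" "x = f + e" using NQ by blast
    \<comment> \<open>\<open>e\<close> is moved past the factors of \<open>us\<^sub>1\<close>, each commutator being a shorter word\<close>
    have move: "vanishing d U (act_word d us\<^sub>1 (act d e (act_word d us\<^sub>2 F)))" if "us = us\<^sub>1 @ us\<^sub>2" for us\<^sub>1 us\<^sub>2
      using that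
    proof (induction us\<^sub>1 arbitrary: us\<^sub>2 rule: rev_induct)
      case Nil
      have "vanishing d U (act_word d us F)" using less.hyps[of us] less.prems snoc by simp
      then show ?case using Nil vanishing_act Q fe(2) by simp
    next
      case (snoc y us\<^sub>1)
      let ?G = "act_word d us\<^sub>2 F"
      have "act d y (act d e ?G) = (\<lambda>w. act d e (act d y ?G) w + act d (br e y) ?G w)"
        by (rule ext) (rule act_commutator[OF act_word_multilinear[OF \<F>(1)[OF less.prems]]])
      then have "act_word d (us\<^sub>1 @ [y]) (act d e ?G) = (\<lambda>w. act_word d us\<^sub>1 (act d e (act_word d (y # us\<^sub>2) F)) w
          + act_word d (us\<^sub>1 @ br e y # us\<^sub>2) F w)"
        by (simp add: act_word_add)
      moreover have "vanishing d U (act_word d us\<^sub>1 (act d e (act_word d (y # us\<^sub>2) F)))"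
        by (rule snoc.IH) (use snoc.prems in simp)
      moreover have "vanishing d U (act_word d (us\<^sub>1 @ br e y # us\<^sub>2) F)"
        by (rule less.hyps) (use less.prems \<open>ws = us @ [x]\<close> snoc.prems in auto)
      ultimately show ?case using add by simp
    qed
    have "act d x F = (\<lambda>w. act d f F w + act d e F w)"
      unfolding fe(3) by (rule ext) (rule act_split[OF \<F>(1)[OF less.prems]])
    then have "act_word d ws F = (\<lambda>w. act_word d us (act d f F) w + act_word d us (act d e F) w)"
      using snoc by (simp add: act_word_add)
    moreover have "vanishing d U (act_word d us (act d f F))"
      by (rule less.hyps) (use snoc N less.prems fe(1) in auto)
    moreover have "vanishing d U (act_word d us (act d e F))" using move[of us "[]"] by simp
    ultimately show ?thesis using add by simp
  qed
qed

end

context cartan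
begin

text \<open>A bound in the \<open>K\<close>-invariant norm, which controls the remainder in Taylor's formula along a
  one-parameter subgroup of \<open>K\<close>.\<close>

definition form_bound :: "nat \<Rightarrow> real \<Rightarrow> ((nat \<Rightarrow> 'g) \<Rightarrow> real) \<Rightarrow> bool" where
  "form_bound d C F \<longleftrightarrow> (\<forall>w. \<bar>F w\<bar> \<le> C * (\<Prod>j<d. ip_norm (w j)))"

lemma ip_norm_br_bound: "\<exists>M\<ge>0. \<forall>v. ip_norm (br x v) \<le> M * ip_norm v"
proof -
  obtain M1 where M1: "M1 > 0" "\<And>v. norm v \<le> M1 * ip_norm v" using norm_le_ip_norm by blast
  obtain M2 where M2: "M2 > 0" "\<And>v. ip_norm v \<le> M2 * norm v" using ip_norm_le_norm by blast
  obtain M3 where M3: "M3 > 0" "\<And>v. norm (br x v) \<le> M3 * norm v" using linear_bound[OF linear_br] by blast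
  have "ip_norm (br x v) \<le> (M2 * M3 * M1) * ip_norm v" for v
  proof -
    have "ip_norm (br x v) \<le> M2 * norm (br x v)" by (rule M2)
    also have "\<dots> \<le> M2 * (M3 * norm v)" using M2(1) M3(2) by (intro mult_left_mono) auto
    also have "\<dots> \<le> M2 * (M3 * (M1 * ip_norm v))" using M2(1) M3(1) M1(2) by (intro mult_left_mono) auto
    finally show ?thesis by (simp add: mult.assoc)
  qed
  then show ?thesis using M1(1) M2(1) M3(1) by (intro exI[of _ "M2 * M3 * M1"]) auto
qed

lemma form_bound_act:
  assumes "form_bound d C F" "0 \<le> C" "0 \<le> M" "\<And>v. ip_norm (br x v) \<le> M * ip_norm v"
  shows "form_bound d (C * (real d * M)) (act d x F)"
  unfolding form_bound_def
proof
  fix w :: "nat \<Rightarrow> 'g"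
  have "\<bar>F (w(j := br x (w j)))\<bar> \<le> C * M * (\<Prod>j<d. ip_norm (w j))" if j: "j < d" for j
  proof -
    have "\<bar>F (w(j := br x (w j)))\<bar> \<le> C * (\<Prod>i<d. ip_norm ((w(j := br x (w j))) i))"
      using assms(1) unfolding form_bound_def by blast
    also have "(\<Prod>i<d. ip_norm ((w(j := br x (w j))) i)) = ip_norm (br x (w j)) * (\<Prod>i\<in>{..<d} - {j}. ip_norm (w i))"
      using j by (simp add: prod.remove)
    also have "C * \<dots> \<le> C * (M * ip_norm (w j) * (\<Prod>i\<in>{..<d} - {j}. ip_norm (w i)))"
      using assms(2,4) by (intro mult_left_mono mult_right_mono prod_nonneg) auto
    also have "\<dots> = C * M * (\<Prod>j<d. ip_norm (w j))" using j by (simp add: prod.remove)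
    finally show ?thesis .
  qed
  then have "(\<Sum>j<d. \<bar>F (w(j := br x (w j)))\<bar>) \<le> (\<Sum>j<d. C * M * (\<Prod>j<d. ip_norm (w j)))"
    by (intro sum_mono) auto
  moreover have "\<bar>act d x F w\<bar> \<le> (\<Sum>j<d. \<bar>F (w(j := br x (w j)))\<bar>)" unfolding act_def by (rule sum_abs)
  ultimately show "\<bar>act d x F w\<bar> \<le> C * (real d * M) * (\<Prod>j<d. ip_norm (w j))" by (simp add: algebra_simps)
qed

text \<open>The \<open>m\<close>-th derivative of \<open>t \<mapsto> F(exp(t x) a)\<close> grows at most like \<open>R\<^sup>m\<close>, so the function equals its
  Taylor series at \<open>0\<close>, which vanishes.\<close>

lemma form_exp_zero:
  assumes F: "multilinear d F" "form_bound d C F" "0 \<le> C" and x: "x \<in> kk"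
    and zero: "\<And>m. ((act d x) ^^ m) F a = 0"
  shows "F (\<lambda>j. lin_exp (br x) (a j)) = 0"
proof -
  obtain M where M: "0 \<le> M" "\<And>v. ip_norm (br x v) \<le> M * ip_norm v" using ip_norm_br_bound by blast
  define R where "R = real d * M"
  define G where "G = (\<lambda>m. ((act d x) ^^ m) F)"
  have G: "multilinear d (G m)" "form_bound d (C * R ^ m) (G m)" for m
  proof (induction m)
    case (Suc m)
    { case 1 then show ?case using act_multilinear Suc(1) by (simp add: G_def) }
    { case 2 show ?case using form_bound_act[OF Suc(2) _ M] M(1) F(3) by (simp add: G_def R_def mult.assoc mult.commute mult.left_commute) }
  qed (use F in \<open>simp_all add: G_def\<close>)
  define g where "g = (\<lambda>m t. G m (\<lambda>j. lin_exp (br (t *\<^sub>R x)) (a j)))"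
  have der: "(g m has_real_derivative g (Suc m) t) (at t)" for m t
    using multilinear_has_derivative[OF G(1)[of m] exp_curve[of x _ t], of a]
    unfolding g_def G_def by (simp add: act_def)
  have id: "lin_exp (br (0 *\<^sub>R x)) v = v" for v using lin_exp_zero by (simp add: bilinear_lzero[OF br_bilinear, abs_def])
  have g0: "g m 0 = 0" for m using zero id by (simp add: g_def G_def)
  define P where "P = (\<Prod>j<d. ip_norm (a j))"
  have bound: "\<bar>g m t\<bar> \<le> C * R ^ m * P" for m t
  proof -
    have "t *\<^sub>R x \<in> kk" using x by (simp add: kk_def)
    then have "ip_norm (lin_exp (br (t *\<^sub>R x)) v) = ip_norm v" for v using K_ip_norm K_exp by blast
    moreover have "\<bar>g m t\<bar> \<le> C * R ^ m * (\<Prod>j<d. ip_norm (lin_exp (br (t *\<^sub>R x)) (a j)))"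
      using G(2)[of m] unfolding form_bound_def g_def by blast
    ultimately show ?thesis by (simp add: P_def)
  qed
  have "\<bar>g 0 1\<bar> \<le> C * P * (inverse (fact n) * R ^ n)" for n
  proof -
    obtain t where "g 0 1 = (\<Sum>m<n. (g m 0 / fact m) * 1 ^ m) + (g n t / fact n) * 1 ^ n"
      using Maclaurin_all_le[of g "g 0" 1 n] der by auto
    then have "\<bar>g 0 1\<bar> = \<bar>g n t\<bar> * inverse (fact n)" using g0 by (simp add: divide_inverse abs_mult)
    also have "\<dots> \<le> C * R ^ n * P * inverse (fact n)" using bound by (intro mult_right_mono) auto
    finally show ?thesis by (simp add: mult_ac)
  qed
  moreover have "(\<lambda>n. C * P * (inverse (fact n) * R ^ n)) \<longlonglongrightarrow> C * P * 0"
    by (intro tendsto_mult_left summable_LIMSEQ_zero summable_exp)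
  ultimately have "\<bar>g 0 1\<bar> \<le> C * P * 0" by (intro LIMSEQ_le_const) auto
  then show ?thesis by (simp add: g_def G_def)
qed

lemma act_transport:
  assumes "\<phi> \<in> K"
  shows "act_word d ws (\<lambda>w. F (\<lambda>j. \<phi> (w j))) = (\<lambda>w. act_word d (map \<phi> ws) F (\<lambda>j. \<phi> (w j)))"
proof (induction ws)
  case (Cons x ws)
  have "(\<lambda>j. \<phi> ((w(i := v)) j)) = (\<lambda>j. \<phi> (w j))(i := \<phi> v)" for w :: "nat \<Rightarrow> 'g" and i v by (auto simp: fun_eq_iff)
  then show ?case using Cons by (simp add: act_def[abs_def] K_br[OF assms])
qed simp

text \<open>The forms that annihilate the submodule of the exterior power generated by \<open>d\<close>-tuples from \<open>U\<close>.
  By \<open>form_exp_zero\<close> this space is invariant under \<open>K\<close>.\<close>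

definition annihilator :: "nat \<Rightarrow> 'g set \<Rightarrow> ((nat \<Rightarrow> 'g) \<Rightarrow> real) set" where
  "annihilator d U = {F. multilinear d F \<and> (\<exists>C\<ge>0. form_bound d C F) \<and> (\<forall>ws. vanishing d U (act_word d ws F))}"

lemma annihilator_K:
  assumes "\<phi> \<in> K" "F \<in> annihilator d U"
  shows "(\<lambda>w. F (\<lambda>j. \<phi> (w j))) \<in> annihilator d U"
proof -
  have base: "multilinear d (\<lambda>w. F (\<lambda>j. \<phi> (w j))) \<and> (\<exists>C\<ge>0. form_bound d C (\<lambda>w. F (\<lambda>j. \<phi> (w j))))"
    if "\<phi> \<in> K" "F \<in> annihilator d U" for \<phi> F
  proof -
    have m: "multilinear d F" and "\<exists>C\<ge>0. form_bound d C F" using that(2) by (auto simp: annihilator_def)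
    have upd: "(\<lambda>j. \<phi> ((w(i := v)) j)) = (\<lambda>j. \<phi> (w j))(i := \<phi> v)" for w :: "nat \<Rightarrow> 'g" and i v by (auto simp: fun_eq_iff)
    have "linear (\<lambda>u. F ((\<lambda>j. \<phi> (w j))(i := \<phi> u)))" if "i < d" for w i
      using linear_compose[OF K_linear[OF \<open>\<phi> \<in> K\<close>] multilinear_linear[OF m that]] by (simp add: o_def)
    moreover have "F (\<lambda>j. \<phi> (w j)) = F (\<lambda>j. \<phi> (w' j))" if "\<forall>j<d. w j = w' j" for w w'
      by (rule multilinear_cong[OF m]) (use that in simp)
    ultimately have "multilinear d (\<lambda>w. F (\<lambda>j. \<phi> (w j)))"
      unfolding multilinear_def upd by blast
    moreover obtain C where "0 \<le> C" "form_bound d C F" using \<open>\<exists>C\<ge>0. form_bound d C F\<close> by blast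
    moreover have "form_bound d C (\<lambda>w. F (\<lambda>j. \<phi> (w j)))"
      unfolding form_bound_def
    proof
      fix w :: "nat \<Rightarrow> 'g"
      have "\<bar>F (\<lambda>j. \<phi> (w j))\<bar> \<le> C * (\<Prod>j<d. ip_norm (\<phi> (w j)))"
        using \<open>form_bound d C F\<close> unfolding form_bound_def by blast
      then show "\<bar>F (\<lambda>j. \<phi> (w j))\<bar> \<le> C * (\<Prod>j<d. ip_norm (w j))" by (simp add: K_ip_norm[OF that(1)])
    qed
    ultimately show ?thesis by blast
  qed
  have "\<phi> \<in> K \<and> (\<forall>F\<in>annihilator d U. (\<lambda>w. F (\<lambda>j. \<phi> (w j))) \<in> annihilator d U)"
    using assms(1)
  proof (induction rule: K_induct(1))
    case id
    show ?case using K_id by simp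
  next
    case (exp x)
    let ?\<phi> = "lin_exp (br x)"
    have k: "?\<phi> \<in> K" using exp by (rule K_exp)
    have "vanishing d U (act_word d ws (\<lambda>w. F (\<lambda>j. ?\<phi> (w j))))" if F: "F \<in> annihilator d U" for F ws
      unfolding act_transport[OF k] vanishing_def
    proof (intro allI impI)
      fix a assume a: "\<forall>j<d. a j \<in> U"
      let ?G = "act_word d (map ?\<phi> ws) F"
      obtain C where C: "0 \<le> C" "form_bound d C F" and m: "multilinear d F"
        using F by (auto simp: annihilator_def)
      have "\<exists>C\<ge>0. form_bound d C (act_word d ws F)" for ws
      proof (induction ws)
        case (Cons y ws)
        then obtain C' where C': "0 \<le> C'" "form_bound d C' (act_word d ws F)" by blast
        obtain M where M: "0 \<le> M" "\<And>v. ip_norm (br y v) \<le> M * ip_norm v" using ip_norm_br_bound by blast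
        show ?case using form_bound_act[OF C'(2,1) M] C'(1) M(1) by (intro exI[of _ "C' * (real d * M)"]) simp
      qed (use C in auto)
      then obtain C' where C': "0 \<le> C'" "form_bound d C' ?G" by blast
      have pow: "(act d x ^^ n) ?G = act_word d (replicate n x @ map ?\<phi> ws) F" for n by (induction n) simp_all
      have "(act d x ^^ n) ?G a = 0" for n
        using F a unfolding pow annihilator_def vanishing_def by blast
      then show "?G (\<lambda>j. ?\<phi> (a j)) = 0"
        using form_exp_zero[OF act_word_multilinear[OF m] C'(2,1) exp] by blast
    qed
    then show ?case using base[OF k] k by (simp add: annihilator_def)
  next
    case (comp f g)
    then show ?case using K_comp[of f g] by (auto simp: o_def)
  qed
  then show ?thesis using assms(2) by blast
qed

text \<open>\<open>N\<close> and \<open>Q\<close> play the roles of the opposite nilpotent part and of a parabolic subalgebra, \<open>W\<close> that of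
  the complement of \<open>V\<close>, and \<open>P\<close> projects \<open>U\<close> to \<open>U \<inter> V\<close>.\<close>

lemma vanishing_K:
  assumes Q: "\<And>e u. e \<in> Q \<Longrightarrow> u \<in> U \<Longrightarrow> br e u \<in> U"
    and N: "\<And>f v. f \<in> N \<Longrightarrow> v \<in> W \<Longrightarrow> br f v \<in> W"
    and NQ: "\<And>x. \<exists>f\<in>N. \<exists>e\<in>Q. x = f + e"
    and P: "subspace W" "linear P" "\<And>u. u \<in> U \<Longrightarrow> u - P u \<in> W" "\<And>u. u \<in> U \<Longrightarrow> P u \<in> S" "dim S < d"
    and F: "multilinear d F" "alternating d F" "0 \<le> C" "form_bound d C F" "\<And>w j. j < d \<Longrightarrow> w j \<in> W \<Longrightarrow> F w = 0"
    and "\<phi> \<in> K" "\<And>j. j < d \<Longrightarrow> a j \<in> U"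
  shows "F (\<lambda>j. \<phi> (a j)) = 0"
proof -
  \<comment> \<open>the forms that factor through the quotient by \<open>W\<close>; they vanish on \<open>U\<close> for dimension reasons\<close>
  define \<F> where "\<F> = {F. multilinear d F \<and> alternating d F \<and> (\<forall>w j. j < d \<longrightarrow> w j \<in> W \<longrightarrow> F w = 0)}"
  have "vanishing d U (act_word d ws F)" for ws
  proof (rule vanishing_words[of Q U \<F> N])
    show "F \<in> \<F>" using F by (simp add: \<F>_def)
    show "act d f G \<in> \<F>" if G: "G \<in> \<F>" and "f \<in> N" for G f
    proof -
      have "act d f G w = 0" if "j < d" "w j \<in> W" for w j
        unfolding act_def
      proof (intro sum.neutral ballI)
        fix i
        have "(w(i := br f (w i))) j \<in> W" using N[OF \<open>f \<in> N\<close>] that by (cases "i = j") auto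
        then show "G (w(i := br f (w i))) = 0" using G \<open>j < d\<close> unfolding \<F>_def by blast
      qed
      then show ?thesis using G act_multilinear act_alternating by (auto simp: \<F>_def)
    qed
    show "vanishing d U G" if G: "G \<in> \<F>" for G
      unfolding vanishing_def
    proof (intro allI impI)
      fix b assume "\<forall>j<d. b j \<in> U"
      then show "G b = 0" using G P by (intro alternating_pigeonhole[of d G W P b S]) (auto simp: \<F>_def)
    qed
  qed (use Q NQ in \<open>auto simp: \<F>_def\<close>)
  then have "F \<in> annihilator d U" using F by (auto simp: annihilator_def)
  from annihilator_K[OF assms(14) this] have "vanishing d U (act_word d [] (\<lambda>w. F (\<lambda>j. \<phi> (w j))))"
    unfolding annihilator_def by blast
  then show ?thesis using assms(15) by (auto simp: vanishing_def)
qed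

end

section \<open>Determinants and the overlap of two flags\<close>

context ip_space
begin

text \<open>The determinant of the matrix of inner products, by the Leibniz formula; it detects whether the
  components of \<open>w\<close> in the span of the \<open>z i\<close> are independent.\<close>

definition det_form :: "nat \<Rightarrow> (nat \<Rightarrow> 'g) \<Rightarrow> (nat \<Rightarrow> 'g) \<Rightarrow> real" where
  "det_form d z w = (\<Sum>p | p permutes {..<d}. of_int (sign p) * (\<Prod>i<d. ip (z i) (w (p i))))"

lemma det_form_multilinear: "multilinear d (det_form d z)"
  unfolding multilinear_def
proof (intro conjI allI impI)
  fix w :: "nat \<Rightarrow> 'g" and j assume j: "j < d"
  have "linear (\<lambda>u. \<Prod>i<d. ip (z i) ((w(j := u)) (p i)))" if p: "p permutes {..<d}" for p
  proof -
    obtain i0 where i0: "i0 < d" "p i0 = j"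
      using permutes_image[OF p] j by (metis imageE lessThan_iff)
    have inj: "p i = j \<longleftrightarrow> i = i0" for i using i0 permutes_inj[OF p] by (auto dest: injD)
    have "(\<Prod>i<d. ip (z i) ((w(j := u)) (p i))) = ip (z i0) u * (\<Prod>i\<in>{..<d} - {i0}. ip (z i) (w (p i)))" for u
      using i0 by (subst prod.remove[of _ i0]) (auto simp: inj intro!: prod.cong)
    then show ?thesis
      by (intro linearI) (simp_all add: algebra_simps)
  qed
  then show "linear (\<lambda>u. det_form d z (w(j := u)))"
    unfolding det_form_def
    by (intro linear_compose_sum ballI)
      (simp only: mem_Collect_eq real_scaleR_def[symmetric] linear_compose_scale_right)
next
  fix w w' :: "nat \<Rightarrow> 'g" assume "\<forall>j<d. w j = w' j"
  then have "(\<Prod>i<d. ip (z i) (w (p i))) = (\<Prod>i<d. ip (z i) (w' (p i)))" if "p permutes {..<d}" for p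
    using permutes_in_image[OF that] by (intro prod.cong) auto
  then show "det_form d z w = det_form d z w'" unfolding det_form_def by (intro sum.cong) auto
qed

lemma det_form_alternating: "alternating d (det_form d z)"
  unfolding alternating_def
proof (intro allI impI)
  fix w :: "nat \<Rightarrow> 'g" and i j assume ij: "i < d" "j < d" "i \<noteq> j" "w i = w j"
  define \<tau> where "\<tau> = Transposition.transpose i j"
  have \<tau>: "\<tau> permutes {..<d}" unfolding \<tau>_def using ij by (intro permutes_swap_id) auto
  have w\<tau>: "w (\<tau> l) = w l" for l using ij by (simp add: \<tau>_def Transposition.transpose_def)
  have sg: "sign (\<tau> \<circ> p) = - sign p" if "p permutes {..<d}" for p
    using sign_compose[OF permutation_swap_id permutes_imp_permutation[OF _ that], of i j] ij
    by (simp add: \<tau>_def sign_swap_id)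
  have "det_form d z w = (\<Sum>p | p permutes {..<d}. of_int (sign (\<tau> \<circ> p)) * (\<Prod>l<d. ip (z l) (w ((\<tau> \<circ> p) l))))"
    unfolding det_form_def by (rule setum_permutations_compose_left[OF \<tau>])
  also have "\<dots> = - det_form d z w"
    unfolding det_form_def sum_negf[symmetric] by (intro sum.cong) (auto simp: sg w\<tau>)
  finally show "det_form d z w = 0" by simp
qed

lemma det_form_orthogonal_slot:
  assumes "j < d" "\<And>i. i < d \<Longrightarrow> ip (z i) (w j) = 0"
  shows "det_form d z w = 0"
  unfolding det_form_def
proof (intro sum.neutral ballI)
  fix p assume "p \<in> {p. p permutes {..<d}}"
  then obtain i where "i < d" "p i = j" using permutes_image[of p "{..<d}"] assms(1) by (metis imageE lessThan_iff mem_Collect_eq)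
  then have "(\<Prod>i<d. ip (z i) (w (p i))) = 0" using assms(2) by (intro prod_zero) auto
  then show "of_int (sign p) * (\<Prod>i<d. ip (z i) (w (p i))) = 0" by simp
qed

lemma det_form_dual:
  assumes "\<And>i j. i < d \<Longrightarrow> j < d \<Longrightarrow> ip (z i) (w j) = (if i = j then 1 else 0)"
  shows "det_form d z w = 1"
proof -
  have "(\<Prod>i<d. ip (z i) (w (p i))) = (if p = id then 1 else 0)" if p: "p permutes {..<d}" for p
  proof (cases "p = id")
    case False
    then obtain i where i: "p i \<noteq> i" by (auto simp: fun_eq_iff)
    then have "i < d" using p by (auto simp: permutes_def)
    moreover have "p i < d" using permutes_in_image[OF p] \<open>i < d\<close> by auto
    ultimately have "ip (z i) (w (p i)) = 0" using i assms by simp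
    then have "(\<Prod>i<d. ip (z i) (w (p i))) = 0" using \<open>i < d\<close> by (intro prod_zero) auto
    then show ?thesis using False by simp
  qed (simp add: assms)
  then have "det_form d z w = (\<Sum>p | p permutes {..<d}. if p = id then of_int (sign p) else 0)"
    unfolding det_form_def by (intro sum.cong) auto
  also have "\<dots> = 1" using finite_permutations[of "{..<d}"] permutes_id[of "{..<d}"] by (simp add: sign_id)
  finally show ?thesis .
qed

lemma det_form_bound: "\<exists>C\<ge>0. \<forall>w. \<bar>det_form d z w\<bar> \<le> C * (\<Prod>j<d. ip_norm (w j))"
proof (intro exI conjI allI)
  let ?P = "{p. p permutes {..<d}}"
  define Z where "Z = (\<Prod>i<d. ip_norm (z i))"
  show "0 \<le> real (card ?P) * Z" by (simp add: Z_def prod_nonneg)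
  fix w :: "nat \<Rightarrow> 'g"
  have "\<bar>of_int (sign p) * (\<Prod>i<d. ip (z i) (w (p i)))\<bar> \<le> Z * (\<Prod>j<d. ip_norm (w j))" if p: "p \<in> ?P" for p
  proof -
    have "\<bar>of_int (sign p) * (\<Prod>i<d. ip (z i) (w (p i)))\<bar> = (\<Prod>i<d. \<bar>ip (z i) (w (p i))\<bar>)"
      by (simp add: abs_mult abs_prod sign_def)
    also have "\<dots> \<le> (\<Prod>i<d. ip_norm (z i) * ip_norm (w (p i)))" by (intro prod_mono) (simp add: cauchy_schwarz)
    also have "\<dots> = Z * (\<Prod>i<d. ip_norm (w (p i)))" by (simp add: Z_def prod.distrib)
    also have "(\<Prod>i<d. ip_norm (w (p i))) = (\<Prod>j<d. ip_norm (w j))"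
      using prod.permute[of p "{..<d}" "\<lambda>j. ip_norm (w j)"] p by (simp add: o_def)
    finally show ?thesis .
  qed
  then have "(\<Sum>p\<in>?P. \<bar>of_int (sign p) * (\<Prod>i<d. ip (z i) (w (p i)))\<bar>) \<le> (\<Sum>p\<in>?P. Z * (\<Prod>j<d. ip_norm (w j)))"
    by (intro sum_mono) auto
  moreover have "\<bar>det_form d z w\<bar> \<le> (\<Sum>p\<in>?P. \<bar>of_int (sign p) * (\<Prod>i<d. ip (z i) (w (p i)))\<bar>)"
    unfolding det_form_def by (rule sum_abs)
  ultimately show "\<bar>det_form d z w\<bar> \<le> real (card ?P) * Z * (\<Prod>j<d. ip_norm (w j))" by simp
qed

end

context cartan
begin

text \<open>The compression \<open>T\<close> of \<open>\<phi>\<close> from \<open>span L\<close> to \<open>span M\<close> has rank at most \<open>card (M \<inter> L)\<close>: otherwise a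
  determinant form built from its range would take the value \<open>1\<close> at a tuple on which it vanishes by
  \<open>vanishing_K\<close>. Since \<open>\<phi>\<close> is orthogonal, Bessel's inequality bounds the squared Hilbert-Schmidt norm of
  \<open>T\<close>, which is the double sum, by its rank.\<close>

lemma flag_overlap_bound:
  assumes E: "orthonormal E" and LM: "L \<subseteq> E" "M \<subseteq> E"
    and Q: "\<And>e u. e \<in> Q \<Longrightarrow> u \<in> span L \<Longrightarrow> br e u \<in> span L"
    and N: "\<And>f v. f \<in> N \<Longrightarrow> (\<And>m. m \<in> M \<Longrightarrow> ip v m = 0) \<Longrightarrow> (\<And>m. m \<in> M \<Longrightarrow> ip (br f v) m = 0)"
    and NQ: "\<And>x. \<exists>f\<in>N. \<exists>e\<in>Q. x = f + e"
    and k: "\<phi> \<in> K"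
  shows "(\<Sum>m\<in>M. \<Sum>l\<in>L. (ip m (\<phi> l))\<^sup>2) \<le> real (card (M \<inter> L))"
proof -
  have fin: "finite E" "finite L" "finite M" using orthonormal_finite[OF E] LM finite_subset by blast+
  have oL: "orthonormal L" and oM: "orthonormal M" and oML: "orthonormal (M \<inter> L)"
    using orthonormal_subset[OF E] LM by blast+
  define W where "W = {v. \<forall>m\<in>M. ip v m = 0}"
  have W: "subspace W" by (auto simp: W_def subspace_def)
  define P where "P = (\<lambda>v. \<Sum>e\<in>M \<inter> L. ip v e *\<^sub>R e)"
  have linP: "linear P"
    unfolding P_def by (intro linearI) (simp_all add: scaleR_add_left sum.distrib scaleR_sum_right)
  have uP: "u - P u \<in> W" if "u \<in> span L" for u
  proof -
    have "ip (u - P u) m = 0" if m: "m \<in> M" for m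
    proof (cases "m \<in> L")
      case True
      then show ?thesis using projection_orthonormal(2)[OF oML, of m u] m by (simp add: P_def span_base)
    next
      case False
      have "ip u m = 0" using ip_sum_orthonormal[OF E fin(2) LM(1), of m "\<lambda>e. ip u e"] orthonormal_expand[OF oL \<open>u \<in> span L\<close>] m LM False by auto
      moreover have "ip (P u) m = 0" unfolding P_def
        using ip_sum_orthonormal[OF E, of "M \<inter> L" m "\<lambda>e. ip u e"] fin m LM False by auto
      ultimately show ?thesis by simp
    qed
    then show ?thesis by (simp add: W_def)
  qed
  have PS: "P u \<in> span (M \<inter> L)" for u unfolding P_def by (rule projection_orthonormal(1)[OF oML])
  have dimS: "dim (span (M \<inter> L)) = card (M \<inter> L)"
    using dim_span_eq_card_independent[OF orthonormal_independent[OF oML]] by simp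
  define T where "T = (\<lambda>u. \<Sum>m\<in>M. ip (\<phi> u) m *\<^sub>R m)"
  note lk = K_linear[OF k]
  have linT: "linear T"
    unfolding T_def by (intro linearI)
      (simp_all add: linear_add[OF lk] linear_scale[OF lk] scaleR_add_left sum.distrib scaleR_sum_right)
  have Torth: "ip z (\<phi> u) = ip z (T u)" if "z \<in> span M" for z u
    using projection_orthonormal(2)[OF oM that, of "\<phi> u"] ip_sym[of z "\<phi> u"] ip_sym[of z "T u"] by (simp add: T_def)
  define Z where "Z = T ` span L"
  have "subspace Z" unfolding Z_def by (intro linear_subspace_image linT subspace_span)
  then obtain A where A: "orthonormal A" "span A = Z" "A \<subseteq> Z" using obtain_orthonormal_basis by blast
  have ZM: "Z \<subseteq> span M" unfolding Z_def T_def using projection_orthonormal(1)[OF oM] by auto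
  have cardA: "card A \<le> card (M \<inter> L)"
  proof (rule ccontr)
    define d where "d = Suc (card (M \<inter> L))"
    assume "\<not> ?thesis"
    then obtain A' where A': "A' \<subseteq> A" "card A' = d" "finite A'"
      using obtain_subset_with_card_n[of d A] orthonormal_finite[OF A(1)] finite_subset by (metis d_def not_less_eq_eq)
    then obtain z where z: "bij_betw z {..<d} A'" using ex_bij_betw_nat_finite[of A'] by (auto simp: atLeast0LessThan)
    have zA: "z i \<in> A" if "i < d" for i using z that A'(1) by (auto simp: bij_betw_def)
    have "\<exists>u\<in>span L. T u = z i" if "i < d" for i using subsetD[OF A(3) zA[OF that]] unfolding Z_def by force
    then obtain a where a: "\<And>i. i < d \<Longrightarrow> a i \<in> span L" "\<And>i. i < d \<Longrightarrow> T (a i) = z i" by metis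
    have zM: "z i \<in> span M" if "i < d" for i using zA[OF that] A(3) ZM by blast
    obtain C where C: "0 \<le> C" "form_bound d C (det_form d z)"
      using det_form_bound[of d z] unfolding form_bound_def by blast
    have "det_form d z (\<lambda>j. \<phi> (a j)) = 0"
    proof (rule vanishing_K[OF Q _ NQ W linP uP PS _ det_form_multilinear det_form_alternating C _ k a(1)])
      show "br f v \<in> W" if "f \<in> N" "v \<in> W" for f v using N[OF that(1), of v] that(2) by (simp add: W_def)
      show "dim (span (M \<inter> L)) < d" by (simp only: dimS d_def)
      show "det_form d z w = 0" if "j < d" "w j \<in> W" for w j
      proof (rule det_form_orthogonal_slot[OF that(1)])
        fix i assume "i < d"
        have "z i = (\<Sum>m\<in>M. ip (z i) m *\<^sub>R m)" using orthonormal_expand[OF oM zM[OF \<open>i < d\<close>]] .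
        then have "ip (z i) (w j) = ip (\<Sum>m\<in>M. ip (z i) m *\<^sub>R m) (w j)" by simp
        also have "\<dots> = 0" using that(2) ip_sym[of "w j"] by (simp add: ip_sum_left W_def)
        finally show "ip (z i) (w j) = 0" .
      qed
    qed
    moreover have "det_form d z (\<lambda>j. \<phi> (a j)) = 1"
    proof (rule det_form_dual)
      fix i j assume ij: "i < d" "j < d"
      have "ip (z i) (\<phi> (a j)) = ip (z i) (z j)" using Torth[OF zM[OF ij(1)]] a(2)[OF ij(2)] by simp
      also have "\<dots> = (if i = j then 1 else 0)"
        using onsetD[OF A(1) zA[OF ij(1)] zA[OF ij(2)]] z ij by (auto simp: bij_betw_def dest: inj_onD)
      finally show "ip (z i) (\<phi> (a j)) = (if i = j then 1 else 0)" .
    qed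
    ultimately show False by simp
  qed
  obtain \<psi> where \<psi>: "\<psi> \<in> K" "\<And>v. \<psi> (\<phi> v) = v" "\<And>v. \<phi> (\<psi> v) = v" using K_inverse[OF k] by blast
  have row: "(\<Sum>m\<in>M. (ip m (\<phi> l))\<^sup>2) = (\<Sum>z\<in>A. (ip (\<psi> z) l)\<^sup>2)" if l: "l \<in> L" for l
  proof -
    have Tl: "T l \<in> span A" using l A(2) by (simp add: Z_def span_base)
    have "(\<Sum>m\<in>M. (ip m (\<phi> l))\<^sup>2) = ip (T l) (\<phi> l)"
      unfolding T_def ip_sum_left by (intro sum.cong) (simp_all add: power2_eq_square ip_sym[of "\<phi> l"])
    also have "\<dots> = ip (T l) (T l)" using Torth Tl A(2) ZM by blast
    also have "\<dots> = (\<Sum>z\<in>A. ip (T l) z * ip (T l) z)" by (rule parseval[OF A(1) Tl])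
    also have "\<dots> = (\<Sum>z\<in>A. (ip (\<psi> z) l)\<^sup>2)"
    proof (intro sum.cong refl)
      fix z assume z: "z \<in> A"
      have "ip (T l) z = ip z (\<phi> l)" using Torth[of z l] z A(3) ZM ip_sym[of "T l" z] by auto
      also have "\<dots> = ip (\<psi> z) l" using K_ip[OF \<psi>(1), of z "\<phi> l"] \<psi>(2) by simp
      finally show "ip (T l) z * ip (T l) z = (ip (\<psi> z) l)\<^sup>2" by (simp add: power2_eq_square)
    qed
    finally show ?thesis .
  qed
  have "(\<Sum>m\<in>M. \<Sum>l\<in>L. (ip m (\<phi> l))\<^sup>2) = (\<Sum>l\<in>L. \<Sum>z\<in>A. (ip (\<psi> z) l)\<^sup>2)"
    by (subst sum.swap) (simp add: row)
  also have "\<dots> = (\<Sum>z\<in>A. \<Sum>l\<in>L. (ip (\<psi> z) l)\<^sup>2)" by (rule sum.swap)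
  also have "\<dots> \<le> (\<Sum>z\<in>A. ip (\<psi> z) (\<psi> z))" by (intro sum_mono bessel[OF oL])
  also have "\<dots> = real (card A)" using A(1) K_ip[OF \<psi>(1)] by (simp add: orthonormal_def)
  finally show ?thesis using cardA by simp
qed

end

section \<open>A rearrangement inequality\<close>

text \<open>
  A function on a finite set is a constant plus a nonnegative combination of indicators of its upper
  level sets. The induction lowers the maximal value to the next smaller one.\<close>

lemma upper_sets_functional_nonpos:
  fixes f c :: "'a \<Rightarrow> real"
  assumes "finite I" "(\<Sum>i\<in>I. c i) = 0" "\<And>t. (\<Sum>i | i \<in> I \<and> t \<le> f i. c i) \<le> 0"
  shows "(\<Sum>i\<in>I. f i * c i) \<le> 0"
  using assms(3)
proof (induction "card (f ` I)" arbitrary: f rule: less_induct)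
  case less
  show ?case
  proof (cases "\<exists>t. \<forall>i\<in>I. f i = t")
    case True
    then obtain t where "\<And>i. i \<in> I \<Longrightarrow> f i = t" by blast
    then have "(\<Sum>i\<in>I. f i * c i) = t * (\<Sum>i\<in>I. c i)" by (simp add: sum_distrib_left)
    then show ?thesis using assms(2) by simp
  next
    case False
    then obtain i0 where i0: "i0 \<in> I" by auto
    define t where "t = Max (f ` I)"
    have fin: "finite (f ` I)" using assms(1) by simp
    have t: "t \<in> f ` I" "\<And>i. i \<in> I \<Longrightarrow> f i \<le> t" using fin i0 by (auto simp: t_def intro: Max_in)
    define R where "R = f ` I - {t}"
    have "R \<noteq> {}" using False unfolding R_def by blast
    define s where "s = Max R"
    have "finite R" using fin by (simp add: R_def)
    then have s: "s \<in> R" "\<And>i. i \<in> I \<Longrightarrow> f i \<noteq> t \<Longrightarrow> f i \<le> s"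
      using Max_in[of R] Max_ge[of R] \<open>R \<noteq> {}\<close> by (auto simp: s_def R_def)
    have st: "s < t" using s(1) t(2) by (force simp: R_def)
    define g where "g = (\<lambda>i. min (f i) s)"
    have fg: "f i = g i + (t - s) * (if t \<le> f i then 1 else 0)" if "i \<in> I" for i
      using that s(2)[OF that] t(2)[OF that] st by (auto simp: g_def)
    have "g ` I \<subseteq> R" using s t(2) st by (fastforce simp: g_def R_def min_def)
    then have "card (g ` I) < card (f ` I)"
      using fin t(1) by (intro psubset_card_mono) (auto simp: R_def)
    moreover have "(\<Sum>i | i \<in> I \<and> u \<le> g i. c i) \<le> 0" for u
    proof (cases "u \<le> s")
      case True
      then have "{i. i \<in> I \<and> u \<le> g i} = {i. i \<in> I \<and> u \<le> f i}" by (auto simp: g_def)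
      then show ?thesis using less.prems by simp
    next
      case False
      then have "{i. i \<in> I \<and> u \<le> g i} = {}" by (auto simp: g_def)
      then show ?thesis by (simp only: sum.empty)
    qed
    ultimately have "(\<Sum>i\<in>I. g i * c i) \<le> 0" using less.hyps by blast
    moreover have "(\<Sum>i\<in>I. f i * c i) = (\<Sum>i\<in>I. g i * c i) + (t - s) * (\<Sum>i | i \<in> I \<and> t \<le> f i. c i)"
    proof -
      have "(\<Sum>i\<in>I. f i * c i) = (\<Sum>i\<in>I. g i * c i + (t - s) * (if t \<le> f i then c i else 0))"
        by (intro sum.cong refl) (subst fg, simp_all add: algebra_simps)
      then show ?thesis using assms(1) by (simp add: sum.distrib sum_distrib_left[symmetric] sum.inter_filter)
    qed
    moreover have "(t - s) * (\<Sum>i | i \<in> I \<and> t \<le> f i. c i) \<le> 0"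
      using st less.prems by (intro mult_nonneg_nonpos) auto
    ultimately show ?thesis by linarith
  qed
qed

text \<open>The preceding lemma is applied in both variables to \<open>S\<close> minus the identity matrix, whose row and
  column sums vanish.\<close>

lemma rearrangement_bistochastic:
  fixes f g :: "'a \<Rightarrow> real" and S :: "'a \<Rightarrow> 'a \<Rightarrow> real"
  assumes "finite I"
    and rows: "\<And>m. m \<in> I \<Longrightarrow> (\<Sum>l\<in>I. S m l) = 1" and cols: "\<And>l. l \<in> I \<Longrightarrow> (\<Sum>m\<in>I. S m l) = 1"
    and corner: "\<And>s t. (\<Sum>m | m \<in> I \<and> s \<le> f m. \<Sum>l | l \<in> I \<and> t \<le> g l. S m l)
        \<le> card ({m \<in> I. s \<le> f m} \<inter> {l \<in> I. t \<le> g l})"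
  shows "(\<Sum>m\<in>I. \<Sum>l\<in>I. f m * g l * S m l) \<le> (\<Sum>m\<in>I. f m * g m)"
proof -
  define X where "X = (\<lambda>m l. S m l - (if m = l then 1 else 0))"
  have delta: "(\<Sum>l\<in>A. if m = l then 1 else 0) = (if m \<in> A then 1 else (0::real))" if "finite A" for A and m :: 'a
    using that by simp
  have rowX: "(\<Sum>l\<in>I. X m l) = 0" if "m \<in> I" for m
    using that assms(1) rows by (simp add: X_def sum_subtractf)
  have colX: "(\<Sum>m\<in>I. X m l) = 0" if "l \<in> I" for l
    using that assms(1) cols by (simp add: X_def sum_subtractf)
  have cornerX: "(\<Sum>l | l \<in> I \<and> t \<le> g l. \<Sum>m | m \<in> I \<and> s \<le> f m. X m l) \<le> 0" for s t
  proof -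
    let ?F = "{m. m \<in> I \<and> s \<le> f m}" and ?G = "{l. l \<in> I \<and> t \<le> g l}"
    have fin: "finite ?F" "finite ?G" using assms(1) by auto
    have "(\<Sum>m\<in>?F. \<Sum>l\<in>?G. if m = l then 1 else 0) = (\<Sum>m\<in>?F. if m \<in> ?G then 1 else (0::real))"
      by (simp only: delta[OF fin(2)])
    also have "\<dots> = real (card (?F \<inter> ?G))"
      using fin(1) by (simp only: sum.If_cases[OF fin(1)]) (simp add: Int_def)
    finally have "(\<Sum>m\<in>?F. \<Sum>l\<in>?G. X m l) \<le> 0" using corner[where s = s and t = t] by (simp add: X_def sum_subtractf)
    then show ?thesis by (subst sum.swap) simp
  qed
  have "(\<Sum>l\<in>I. g l * (\<Sum>m | m \<in> I \<and> s \<le> f m. X m l)) \<le> 0" for s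
  proof (rule upper_sets_functional_nonpos[OF assms(1)])
    show "(\<Sum>l\<in>I. \<Sum>m | m \<in> I \<and> s \<le> f m. X m l) = 0"
      by (subst sum.swap) (simp add: rowX)
  qed (rule cornerX)
  then have half: "(\<Sum>m | m \<in> I \<and> s \<le> f m. \<Sum>l\<in>I. g l * X m l) \<le> 0" for s
    by (subst sum.swap) (simp add: sum_distrib_left)
  have "(\<Sum>m\<in>I. f m * (\<Sum>l\<in>I. g l * X m l)) \<le> 0"
  proof (rule upper_sets_functional_nonpos[OF assms(1) _ half])
    show "(\<Sum>m\<in>I. \<Sum>l\<in>I. g l * X m l) = 0"
      by (subst sum.swap) (simp add: sum_distrib_left[symmetric] colX)
  qed
  moreover have "(\<Sum>m\<in>I. f m * (\<Sum>l\<in>I. g l * X m l)) = (\<Sum>m\<in>I. \<Sum>l\<in>I. f m * g l * S m l) - (\<Sum>m\<in>I. f m * g m)"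
  proof -
    have "f m * (\<Sum>l\<in>I. g l * X m l) = (\<Sum>l\<in>I. f m * g l * S m l) - f m * g m" if "m \<in> I" for m
    proof -
      have "(\<Sum>l\<in>I. g l * X m l) = (\<Sum>l\<in>I. g l * S m l) - (\<Sum>l\<in>I. if m = l then g l else 0)"
        unfolding X_def sum_subtractf[symmetric] by (intro sum.cong) (auto simp: algebra_simps)
      also have "\<dots> = (\<Sum>l\<in>I. g l * S m l) - g m" using that assms(1) by simp
      finally show ?thesis by (simp add: right_diff_distrib sum_distrib_left mult.assoc)
    qed
    then show ?thesis by (simp add: sum_subtractf)
  qed
  ultimately show ?thesis by simp
qed

section \<open>Orbits in \<open>p\<close> are compact\<close>

lemma lin_exp_remainder:
  fixes f :: "'g::euclidean_space \<Rightarrow> 'g"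
  assumes f: "linear f" "\<And>v. norm (f v) \<le> M * norm v" "0 \<le> M"
  shows "norm (lin_exp f v - v - f v) \<le> M\<^sup>2 * exp M * norm v"
proof -
  let ?r = "\<lambda>n. (1 / fact n) *\<^sub>R (f ^^ n) v"
  note s = lin_exp_summable[OF f(1), of v]
  have "lin_exp f v = (\<Sum>n. ?r (n + 2)) + (\<Sum>i<2. ?r i)"
    unfolding lin_exp_def by (rule suminf_split_initial_segment[OF s])
  moreover have "(\<Sum>i<2. ?r i) = v + f v" by (simp add: numeral_2_eq_2)
  ultimately have eq: "lin_exp f v - v - f v = (\<Sum>n. ?r (n + 2))" by simp
  have major: "norm (?r (n + 2)) \<le> M\<^sup>2 * norm v * (inverse (fact n) * M ^ n)" for n
  proof -
    have "norm (?r (n + 2)) \<le> inverse (fact (n + 2)) * M ^ (n + 2) * norm v"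
      by (rule lin_exp_term_bound[OF f(2,3)])
    also have "\<dots> \<le> inverse (fact n) * M ^ (n + 2) * norm v"
      using f(3) by (intro mult_right_mono le_imp_inverse_le fact_mono) auto
    finally show ?thesis by (simp only: power_add mult_ac)
  qed
  have sm: "summable (\<lambda>n. M\<^sup>2 * norm v * (inverse (fact n) * M ^ n))"
    by (intro summable_mult summable_exp)
  have "norm (\<Sum>n. ?r (n + 2)) \<le> (\<Sum>n. M\<^sup>2 * norm v * (inverse (fact n) * M ^ n))"
    by (rule norm_suminf_le[OF _ sm]) (rule major)
  also have "\<dots> = M\<^sup>2 * norm v * exp M"
    by (subst suminf_mult[OF summable_exp]) (simp add: exp_def divide_inverse mult.commute)
  finally show ?thesis unfolding eq by (simp add: mult_ac)
qed

context cartan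
begin

lemma br_bound: "\<exists>C>0. \<forall>x y. norm (br x y) \<le> C * norm x * norm y"
  using bilinear_bounded_pos[OF br_bilinear] by blast

text \<open>The orthogonal complement of the tangent space \<open>[k, c]\<close> of the orbit in \<open>p\<close> is the centralizer of
  \<open>c\<close>.\<close>

lemma slice_decomposition:
  assumes c: "c \<in> pp" and w: "w \<in> pp"
  obtains \<xi> u where "\<xi> \<in> kk" "u \<in> pp" "br c u = 0" "w = u + br \<xi> c"
proof -
  define S where "S = (\<lambda>\<xi>. br \<xi> c) ` kk"
  have "subspace S" unfolding S_def by (intro linear_subspace_image linear_br_left subspace_kk)
  then obtain s where s: "s \<in> S" "\<And>v. v \<in> S \<Longrightarrow> ip (w - s) v = 0"
    using obtain_orthogonal_projection[of S w] by blast
  obtain \<xi> where \<xi>: "\<xi> \<in> kk" "s = br \<xi> c" using s(1) by (auto simp: S_def)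
  have u: "w - s \<in> pp" using w br_kp[OF \<xi>(1) c] \<xi>(2) subspace_diff[OF subspace_pp] by blast
  have k: "br c (w - s) \<in> kk" using br_pp[OF c u] .
  have "ip (br c (w - s)) (br c (w - s)) = ip (w - s) (br c (br c (w - s)))"
    using sym_op_ad[OF c] unfolding sym_op_def by blast
  also have "\<dots> = - ip (w - s) (br (br c (w - s)) c)"
    unfolding br_anti[of c "br c (w - s)"] by (rule bilinear_rneg[OF ip_bilinear])
  also have "\<dots> = 0"
  proof -
    have "br (br c (w - s)) c \<in> S" unfolding S_def by (rule imageI[OF k])
    then show ?thesis using s(2) by (simp only: minus_zero)
  qed
  finally have "br c (w - s) = 0" unfolding ip_eq_0_iff .
  then show thesis using that[OF \<xi>(1) u] \<xi>(2) by simp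
qed

definition spectrum where "spectrum x = {l. \<exists>v. v \<noteq> 0 \<and> br x v = l *\<^sub>R v}"

lemma finite_spectrum:
  assumes "x \<in> pp"
  shows "finite (spectrum x)"
proof -
  obtain E where E: "orthonormal E" "span E = UNIV" and "\<And>e T. e \<in> E \<Longrightarrow> T \<in> {br x} \<Longrightarrow> \<exists>l. T e = l *\<^sub>R e"
    by (rule joint_eigenbasis[of "{br x}"]) (use sym_op_ad[OF assms] in auto)
  then have "\<forall>e\<in>E. \<exists>r. br x e = r *\<^sub>R e" by blast
  then obtain l where l: "\<And>e. e \<in> E \<Longrightarrow> br x e = l e *\<^sub>R e"
    using bchoice[of E "\<lambda>e r. br x e = r *\<^sub>R e"] by blast
  have "spectrum x \<subseteq> l ` E"
  proof
    fix m assume "m \<in> spectrum x"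
    then obtain v where v: "v \<noteq> 0" "br x v = m *\<^sub>R v" by (auto simp: spectrum_def)
    have "v = (\<Sum>e\<in>E. ip v e *\<^sub>R e)" using orthonormal_expand[OF E(1)] E(2) by blast
    then obtain e where e: "e \<in> E" "ip v e \<noteq> 0" using v(1) by (metis (no_types, lifting) scaleR_eq_0_iff sum.neutral)
    have "ip (br x v) e = ip v (br x e)" using sym_op_ad[OF assms] by (simp add: sym_op_def)
    then show "m \<in> l ` E" using v(2) l[OF e(1)] e by simp
  qed
  then show ?thesis using orthonormal_finite[OF E(1)] finite_subset by blast
qed

text \<open>The spectrum of \<open>ad\<close> is constant on the orbit. For limit points: an operator \<open>ad c - l\<close> without
  kernel is bounded below, and after transport by \<open>K\<close> this persists near the orbit.\<close>

lemma spectrum_closure_orb: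
  assumes z: "z \<in> closure (orb c)" and v: "v \<noteq> 0" "br z v = l *\<^sub>R v"
  shows "l \<in> spectrum c"
proof (rule ccontr)
  assume "l \<notin> spectrum c"
  define T where "T = (\<lambda>w. br c w - l *\<^sub>R w)"
  have linT: "linear T" unfolding T_def by (intro linear_compose_sub linear_br linear_compose_scale_right linear_ident)
  have "inj T"
    using \<open>l \<notin> spectrum c\<close> unfolding linear_injective_0[OF linT] by (auto simp: T_def spectrum_def)
  then obtain m where m: "m > 0" "\<And>w. m * norm w \<le> norm (T w)"
    using linear_inj_bounded_below_pos[OF linT] by (metis mult.commute)
  obtain M1 where M1: "M1 > 0" "\<And>v. norm v \<le> M1 * ip_norm v" using norm_le_ip_norm by blast
  obtain M2 where M2: "M2 > 0" "\<And>v. ip_norm v \<le> M2 * norm v" using ip_norm_le_norm by blast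
  obtain C where C: "C > 0" "\<And>x y. norm (br x y) \<le> C * norm x * norm y" using br_bound by blast
  define b where "b = m * ip_norm v"
  have b: "b > 0" using m(1) ip_norm_pos[OF v(1)] by (simp add: b_def)
  \<comment> \<open>\<open>y\<close> is chosen so close to \<open>z\<close> that the lower bound \<open>b\<close> for \<open>|(ad c - l) (\<phi>\<^sup>-\<^sup>1 v)|\<close> is violated\<close>
  define A where "A = M2 * M1 * (M2 * (C * norm v))"
  have A: "A > 0" using M1(1) M2(1) C(1) v(1) by (simp add: A_def)
  obtain y where y: "y \<in> orb c" "dist y z < b / A"
    using z b A by (metis closure_approachable divide_pos_pos)
  obtain \<phi> where \<phi>: "\<phi> \<in> K" "y = \<phi> c" using y(1) by (rule orbE)
  obtain \<psi> where \<psi>: "\<psi> \<in> K" "\<And>v. \<psi> (\<phi> v) = v" "\<And>v. \<phi> (\<psi> v) = v" using K_inverse[OF \<phi>(1)] by blast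
  have "\<phi> (T (\<psi> v)) = br (y - z) v"
    using K_linear[OF \<phi>(1)] by (simp add: T_def linear_diff linear_scale K_br[OF \<phi>(1)] \<psi>(3) \<phi>(2) v(2))
  then have "ip_norm (T (\<psi> v)) = ip_norm (br (y - z) v)" using K_ip_norm[OF \<phi>(1)] by metis
  also have "\<dots> \<le> M2 * (C * norm v * norm (y - z))"
    using M2(2)[of "br (y - z) v"] C(2)[of "y - z" v] M2(1) by (smt (verit) mult.assoc mult.commute mult_left_mono)
  finally have 1: "ip_norm (T (\<psi> v)) \<le> M2 * (C * norm v * norm (y - z))" .
  have "b = m * ip_norm (\<psi> v)" by (simp add: b_def K_ip_norm[OF \<psi>(1)])
  also have "\<dots> \<le> m * (M2 * norm (\<psi> v))" using M2(2) m(1) by (intro mult_left_mono) auto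
  also have "\<dots> = M2 * (m * norm (\<psi> v))" by simp
  also have "\<dots> \<le> M2 * norm (T (\<psi> v))" using m(2) M2(1) by (intro mult_left_mono) auto
  also have "\<dots> \<le> M2 * (M1 * ip_norm (T (\<psi> v)))" using M1(2) M2(1) by (intro mult_left_mono) auto
  also have "\<dots> \<le> M2 * (M1 * (M2 * (C * norm v * norm (y - z))))"
    using 1 M1(1) M2(1) by (intro mult_left_mono) auto
  also have "\<dots> = A * norm (y - z)" by (simp add: A_def mult_ac)
  also have "\<dots> < b" using y(2) A by (simp add: dist_norm field_simps)
  finally show False by simp
qed

text \<open>The spectra of \<open>ad c\<close> and \<open>ad (c + u)\<close> coincide, while a joint eigenvector of the commuting
  operators \<open>ad c\<close>, \<open>ad u\<close> shifts an eigenvalue by a small amount. Since the spectrum is finite, the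
  shift is zero.\<close>

lemma closure_orb_transversal:
  assumes c: "c \<in> pp"
  obtains \<delta> where "\<delta> > 0"
    "\<And>u. u \<in> pp \<Longrightarrow> br c u = 0 \<Longrightarrow> norm u < \<delta> \<Longrightarrow> c + u \<in> closure (orb c) \<Longrightarrow> u = 0"
proof -
  have "finite ((\<lambda>(s, t). s - t) ` (spectrum c \<times> spectrum c))" using finite_spectrum[OF c] by simp
  from finite_set_avoid[OF this, of 0] obtain g where
    g: "g > 0" "\<And>s t. s \<in> spectrum c \<Longrightarrow> t \<in> spectrum c \<Longrightarrow> s \<noteq> t \<Longrightarrow> g \<le> \<bar>s - t\<bar>"
    by (force simp: dist_norm)
  obtain C where C: "C > 0" "\<And>x y. norm (br x y) \<le> C * norm x * norm y" using br_bound by blast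
  have "u = 0" if u: "u \<in> pp" "br c u = 0" "norm u < g / C" "c + u \<in> closure (orb c)" for u
  proof (rule ccontr)
    assume "u \<noteq> 0"
    have comm: "br c (br u v) = br u (br c v)" for v using jacobi[of c u v] u(2) by simp
    obtain E where E: "orthonormal E" "span E = UNIV" and "\<And>e T. e \<in> E \<Longrightarrow> T \<in> {br c, br u} \<Longrightarrow> \<exists>l. T e = l *\<^sub>R e"
      by (rule joint_eigenbasis[of "{br c, br u}"]) (use sym_op_ad c u(1) comm in auto)
    then have eig: "\<And>e. e \<in> E \<Longrightarrow> \<exists>l. br c e = l *\<^sub>R e" "\<And>e. e \<in> E \<Longrightarrow> \<exists>l. br u e = l *\<^sub>R e" by blast+
    have "\<exists>e\<in>E. br u e \<noteq> 0"
    proof (rule ccontr)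
      assume "\<not> ?thesis"
      then have "br u y = 0" for y
        using linear_eq_0_on_span[OF linear_br[of u], of E y] E(2) by blast
      then show False using ad_faithful \<open>u \<noteq> 0\<close> by blast
    qed
    then obtain e l \<epsilon> where e: "e \<in> E" "br c e = l *\<^sub>R e" "br u e = \<epsilon> *\<^sub>R e" "br u e \<noteq> 0"
      using eig by metis
    have "e \<noteq> 0" "\<epsilon> \<noteq> 0" using e(3,4) by auto
    have "l \<in> spectrum c" using e(2) \<open>e \<noteq> 0\<close> by (auto simp: spectrum_def)
    moreover have "l + \<epsilon> \<in> spectrum c"
      by (rule spectrum_closure_orb[OF u(4) \<open>e \<noteq> 0\<close>]) (simp add: e scaleR_add_left)
    ultimately have "g \<le> \<bar>\<epsilon>\<bar>" using g(2)[of "l + \<epsilon>" l] \<open>\<epsilon> \<noteq> 0\<close> by simp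
    moreover have "\<bar>\<epsilon>\<bar> * norm e \<le> (C * norm u) * norm e" using C(2)[of u e] e(3) by simp
    then have "\<bar>\<epsilon>\<bar> \<le> C * norm u" using \<open>e \<noteq> 0\<close> by simp
    moreover have "C * norm u < g" using u(3) C(1) by (simp add: field_simps)
    ultimately show False by linarith
  qed
  then show thesis using that[of "g / C"] g(1) C(1) by simp
qed

lemma continuous_on_ad_power:
  fixes a b :: "'b::topological_space \<Rightarrow> 'g"
  assumes "continuous_on S a" "continuous_on S b"
  shows "continuous_on S (\<lambda>h. (br (a h) ^^ n) (b h))"
proof (induction n)
  case (Suc n)
  from bounded_bilinear.continuous_on[OF bilinear_conv_bounded_bilinear[THEN iffD1, OF br_bilinear] assms(1) Suc]
  show ?case by simp
qed (use assms in simp)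

text \<open>The map \<open>(s, w) \<mapsto> exp(ad s\<^sub>k) (c + q w) + w\<^sub>k\<close>, with \<open>q\<close> projecting to the centralizer of \<open>c\<close> in \<open>p\<close>
  and the index denoting \<open>k\<close>-parts, has surjective derivative at the origin, so it is open there. The last
  summand only serves to have all of \<open>g\<close> as target; it vanishes when the value lies in \<open>p\<close>.\<close>

lemma slice_map_open:
  assumes c: "c \<in> pp" and "\<delta> > 0"
  obtains \<epsilon> where "\<epsilon> > 0"
    "\<And>y. y \<in> pp \<Longrightarrow> dist y c < \<epsilon> \<Longrightarrow> \<exists>\<phi>\<in>K. \<exists>u\<in>pp. br c u = 0 \<and> norm u < \<delta> \<and> y = \<phi> (c + u)"
proof -
  define Z where "Z = {u \<in> pp. br c u = 0}"
  have Z: "subspace Z" unfolding Z_def using subspace_pp by (auto simp: subspace_def)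
  define Pk where "Pk = (\<lambda>v. (1/2) *\<^sub>R (v + \<theta> v))"
  define Pp where "Pp = (\<lambda>v. (1/2) *\<^sub>R (v - \<theta> v))"
  have linPk: "linear Pk" and linPp: "linear Pp"
    unfolding Pk_def Pp_def
    by (intro linear_compose_scale_right linear_compose_add linear_compose_sub linear_ident linear_theta)+
  have Pk: "Pk v \<in> kk" "v \<in> kk \<Longrightarrow> Pk v = v" "v \<in> pp \<Longrightarrow> Pk v = 0" for v
    by (simp_all add: Pk_def kk_def pp_def add.commute scaleR_2[symmetric])
  have Pp: "Pp v \<in> pp" "v \<in> pp \<Longrightarrow> Pp v = v" "v \<in> kk \<Longrightarrow> Pp v = 0" for v
    by (simp_all add: Pp_def kk_def pp_def scaleR_diff_right scaleR_2[symmetric])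
  obtain PZ where PZ: "linear PZ" "\<And>v. PZ v \<in> Z" "\<And>v. v \<in> Z \<Longrightarrow> PZ v = v"
  proof -
    obtain g where "range g \<subseteq> Z" "linear g" "\<forall>v\<in>Z. g v = v"
      using linear_exists_left_inverse_on[of "\<lambda>v::'g. v" Z, OF linear_ident Z] by (auto simp: inj_on_def)
    then show thesis using that[of g] by blast
  qed
  define q where "q = (\<lambda>v. PZ (Pp v))"
  have linq: "linear q" unfolding q_def using linear_compose[OF linPp PZ(1)] by (simp add: o_def)
  define G where "G = (\<lambda>h::'g \<times> 'g. lin_exp (br (Pk (fst h))) (c + q (snd h)))"
  define F where "F = (\<lambda>h. G h + Pk (snd h))"
  define F' where "F' = (\<lambda>h::'g \<times> 'g. br (Pk (fst h)) c + q (snd h) + Pk (snd h))"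
  have linF': "linear F'"
  proof (rule linearI)
    show "F' (x + y) = F' x + F' y" for x y
      by (simp add: F'_def linear_add[OF linPk] linear_add[OF linq])
    show "F' (r *\<^sub>R x) = r *\<^sub>R F' x" for r x
      by (simp add: F'_def linear_scale[OF linPk] linear_scale[OF linq] scaleR_add_right)
  qed
  obtain C where C: "C > 0" "\<And>x y. norm (br x y) \<le> C * norm x * norm y" using br_bound by blast
  obtain B1 where B1: "B1 > 0" "\<And>v. norm (Pk v) \<le> B1 * norm v" using linear_bound[OF linPk] by blast
  obtain B2 where B2: "B2 > 0" "\<And>v. norm (q v) \<le> B2 * norm v" using linear_bound[OF linq] by blast
  define C1 where "C1 = C * B1"
  have C1: "C1 > 0" using C B1 by (simp add: C1_def)
  have adb: "norm (br (Pk s) v) \<le> (C1 * norm s) * norm v" for s v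
  proof -
    have "norm (br (Pk s) v) \<le> (C * norm (Pk s)) * norm v" using C(2) by simp
    also have "\<dots> \<le> (C * (B1 * norm s)) * norm v" using B1(2) C(1) by (intro mult_right_mono mult_left_mono) auto
    finally show ?thesis by (simp add: C1_def mult_ac)
  qed
  have cont_lin: "continuous_on S f" if "linear f" for S and f :: "'g \<Rightarrow> 'g"
    using that linear_continuous_on linear_conv_bounded_linear by blast
  have contPk: "continuous_on S (\<lambda>h::'g \<times> 'g. Pk (fst h))" "continuous_on S (\<lambda>h::'g \<times> 'g. Pk (snd h))"
    "continuous_on S (\<lambda>h::'g \<times> 'g. c + q (snd h))" for S
    by (intro continuous_on_compose2[OF cont_lin[OF linPk, of UNIV]] continuous_on_add
        continuous_on_compose2[OF cont_lin[OF linq, of UNIV]] continuous_intros; simp)+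
  have contG: "continuous_on (ball 0 1) G"
  proof -
    let ?t = "\<lambda>n h. (1 / fact n) *\<^sub>R ((br (Pk (fst h)) ^^ n) (c + q (snd h)))"
    have "norm (?t n h) \<le> inverse (fact n) * C1 ^ n * (norm c + B2)" if "h \<in> ball 0 1" for n h
    proof -
      have h: "norm (fst h) \<le> 1" "norm (snd h) \<le> 1"
        using that norm_fst_le[of "fst h" "snd h"] norm_snd_le[of "snd h" "fst h"] by auto
      have 1: "norm (br (Pk (fst h)) v) \<le> C1 * norm v" for v
        
        by (rule order_trans[OF adb]) (use h(1) C1 in \<open>auto intro!: mult_right_mono mult_left_le_one_le\<close>)
      have "norm (?t n h) \<le> inverse (fact n) * C1 ^ n * norm (c + q (snd h))"
        using C1 by (intro lin_exp_term_bound 1) simp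
      also have "norm (c + q (snd h)) \<le> norm c + B2"
      proof -
        have "B2 * norm (snd h) \<le> B2" using h(2) B2(1) by simp
        then show ?thesis using norm_triangle_ineq[of c "q (snd h)"] B2(2)[of "snd h"] by linarith
      qed
      finally show ?thesis using C1 by (simp add: mult_left_mono)
    qed
    from Weierstrass_m_test[OF this summable_mult2[OF summable_exp]]
    have "uniform_limit (ball 0 1) (\<lambda>n h. \<Sum>i<n. ?t i h) (\<lambda>h. \<Sum>i. ?t i h) sequentially" .
    then have "continuous_on (ball 0 1) (\<lambda>h. \<Sum>i. ?t i h)"
      by (rule uniform_limit_theorem[rotated])
        (auto intro!: always_eventually continuous_on_sum continuous_on_scaleR continuous_on_const continuous_on_ad_power contPk)
    then show ?thesis by (simp add: G_def lin_exp_def)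
  qed
  have contF: "continuous_on (ball 0 1) F" unfolding F_def by (intro continuous_on_add contG contPk)
  have F0: "F 0 = c"
    using lin_exp_zero[of c] by (simp add: F_def G_def linear_0[OF linPk] linear_0[OF linq] bilinear_lzero[OF br_bilinear, abs_def])
  define H where "H = C1\<^sup>2 * exp C1 * (norm c + B2) + C1 * B2"
  have der: "(F has_derivative F') (at 0)"
  proof (rule has_derivativeI_sandwich[of 1])
    show "bounded_linear F'" using linF' linear_conv_bounded_linear by blast
    show "((\<lambda>h. H * norm h) \<longlongrightarrow> 0) (at 0)"
      by (intro tendsto_eq_intros) auto
    fix h :: "'g \<times> 'g" assume h: "h \<noteq> 0" "dist h 0 < 1"
    define s where "s = fst h" define w where "w = snd h"
    define n where "n = norm h"
    have n: "norm s \<le> n" "norm w \<le> n" "n \<le> 1" "n > 0"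
      using h norm_fst_le[of s w] norm_snd_le[of w s] by (auto simp: s_def w_def n_def)
    have qw: "norm (q w) \<le> B2 * n" using B2 n(2) by (meson mult_left_mono order_trans less_imp_le)
    have "B2 * n \<le> B2" using n(3) B2(1) by simp
    then have cq: "norm (c + q w) \<le> norm c + B2" using norm_triangle_ineq[of c "q w"] qw by linarith
    have "F h - F 0 - F' (h - 0) = (lin_exp (br (Pk s)) (c + q w) - (c + q w) - br (Pk s) (c + q w)) + br (Pk s) (q w)"
      unfolding F0 by (simp add: F_def G_def F'_def s_def w_def)
    then have "norm (F h - F 0 - F' (h - 0)) \<le> norm (lin_exp (br (Pk s)) (c + q w) - (c + q w) - br (Pk s) (c + q w)) + norm (br (Pk s) (q w))"
      by (simp only: norm_triangle_ineq)
    also have "\<dots> \<le> (C1 * norm s)\<^sup>2 * exp (C1 * norm s) * norm (c + q w) + C1 * norm s * norm (q w)"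
      using C1 by (intro add_mono lin_exp_remainder linear_br adb) auto
    also have "\<dots> \<le> (C1 * n)\<^sup>2 * exp C1 * (norm c + B2) + C1 * n * (B2 * n)"
    proof (intro add_mono mult_mono)
      show "exp (C1 * norm s) \<le> exp C1" using n C1 mult_left_mono[of "norm s" 1 C1] by simp
    qed (use n C1 qw cq B2(1) in \<open>auto intro!: power_mono mult_left_mono mult_nonneg_nonneg add_nonneg_nonneg\<close>)
    also have "\<dots> = H * n * n" by (simp add: H_def power2_eq_square algebra_simps)
    finally show "norm ((F h - F 0) - F' (h - 0)) / norm (h - 0) \<le> H * norm h"
      using n(4) by (simp add: n_def field_simps)
  qed auto
  have "surj F'"
    unfolding surj_def
  proof
    fix v
    obtain a b where ab: "v = a + b" "a \<in> kk" "b \<in> pp" by (rule kp_decomp)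
    obtain \<xi> u where \<xi>: "\<xi> \<in> kk" "u \<in> pp" "br c u = 0" "b = u + br \<xi> c" using slice_decomposition[OF c ab(3)] .
    have "q (u + a) = u" using \<xi> ab PZ(3)[of u] by (simp add: q_def linear_add[OF linPp] Pp Z_def)
    moreover have "Pk (u + a) = a" "Pk \<xi> = \<xi>" using \<xi> ab by (simp_all add: linear_add[OF linPk] Pk)
    ultimately have "F' (\<xi>, u + a) = v" by (simp add: F'_def ab(1) \<xi>(4))
    then show "\<exists>h. v = F' h" by metis
  qed
  then obtain g' where g': "linear g'" "F' \<circ> g' = id" using linear_surjective_right_inverse[OF linF'] by blast
  define e where "e = min 1 (\<delta> / B2)"
  have e: "e > 0" "e \<le> 1" "B2 * e \<le> \<delta>" using assms(2) B2(1) by (auto simp: e_def min_def field_simps)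
  have "F 0 \<in> interior (F ` ball 0 e)"
  proof (rule sussmann_open_mapping[OF open_ball contF _ der _ g'(2)])
    show "bounded_linear g'" using g'(1) linear_conv_bounded_linear by blast
    show "ball 0 e \<subseteq> ball (0::'g \<times> 'g) 1" using e(2) by (rule subset_ball)
  qed (use e(1) in auto)
  then obtain \<epsilon> where \<epsilon>: "\<epsilon> > 0" "ball c \<epsilon> \<subseteq> F ` ball 0 e" unfolding F0 mem_interior by blast
  have "\<exists>\<phi>\<in>K. \<exists>u\<in>pp. br c u = 0 \<and> norm u < \<delta> \<and> y = \<phi> (c + u)" if y: "y \<in> pp" "dist y c < \<epsilon>" for y
  proof -
    obtain h where h: "h \<in> ball 0 e" "y = F h" using \<epsilon>(2) y(2) by (auto simp: dist_commute)
    let ?\<phi> = "lin_exp (br (Pk (fst h)))" and ?u = "q (snd h)"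
    have \<phi>: "?\<phi> \<in> K" using Pk K_exp by blast
    have u: "?u \<in> pp" "br c ?u = 0" using PZ(2)[of "Pp (snd h)"] by (auto simp: q_def Z_def)
    have "?\<phi> (c + ?u) \<in> pp" using K_pp[OF \<phi>] c u(1) subspace_add[OF subspace_pp] by blast
    moreover have yh: "y = ?\<phi> (c + ?u) + Pk (snd h)" using h(2) by (simp add: F_def G_def)
    ultimately have "Pk (snd h) \<in> pp" using y(1) subspace_diff[OF subspace_pp, of y "?\<phi> (c + ?u)"] by simp
    then have "Pk (snd h) = 0" using Pk(1,2,3) by metis
    moreover have "norm ?u < \<delta>"
    proof -
      have "norm (snd h) < e" using h(1) norm_snd_le[of "snd h" "fst h"] by simp
      then have "B2 * norm (snd h) < B2 * e" using B2(1) by simp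
      then show ?thesis using B2(2)[of "snd h"] e(3) by linarith
    qed
    ultimately show ?thesis using \<phi> u yh by auto
  qed
  then show thesis using that \<epsilon>(1) by blast
qed

lemma closure_orb_K:
  assumes "\<phi> \<in> K" "y \<in> closure (orb c)"
  shows "\<phi> y \<in> closure (orb c)"
proof -
  have "continuous_on (closure (orb c)) \<phi>"
    using K_linear[OF assms(1)] linear_continuous_on linear_conv_bounded_linear by blast
  moreover have "\<phi> ` orb c \<subseteq> closure (orb c)" using orb_K[OF assms(1)] closure_subset by blast
  ultimately have "\<phi> ` closure (orb c) \<subseteq> closure (orb c)" by (intro image_closure_subset) auto
  then show ?thesis using assms(2) by blast
qed

text \<open>A limit point near \<open>c\<close> is \<open>\<phi> (c + u)\<close> by \<open>slice_map_open\<close>, and then \<open>u = 0\<close> by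
  \<open>closure_orb_transversal\<close>. Any other limit point is moved close to \<open>c\<close> by an element of \<open>K\<close>.\<close>

theorem compact_orb:
  assumes c: "c \<in> pp"
  shows "compact (orb c)"
proof -
  obtain \<delta> where \<delta>: "\<delta> > 0"
    "\<And>u. u \<in> pp \<Longrightarrow> br c u = 0 \<Longrightarrow> norm u < \<delta> \<Longrightarrow> c + u \<in> closure (orb c) \<Longrightarrow> u = 0"
    using closure_orb_transversal[OF c] by blast
  obtain \<epsilon> where \<epsilon>: "\<epsilon> > 0"
    "\<And>y. y \<in> pp \<Longrightarrow> dist y c < \<epsilon> \<Longrightarrow> \<exists>\<phi>\<in>K. \<exists>u\<in>pp. br c u = 0 \<and> norm u < \<delta> \<and> y = \<phi> (c + u)"
    using slice_map_open[OF c \<delta>(1)] by blast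
  have cl_pp: "closure (orb c) \<subseteq> pp"
    using closure_minimal[OF orb_sub_pp[OF c] closed_subspace[OF subspace_pp]] .
  have near: "y \<in> orb c" if y: "y \<in> closure (orb c)" "dist y c < \<epsilon>" for y
  proof -
    from \<epsilon>(2)[OF subsetD[OF cl_pp y(1)] y(2)]
    obtain \<phi> u where \<phi>: "\<phi> \<in> K" "u \<in> pp" "br c u = 0" "norm u < \<delta>" "y = \<phi> (c + u)"
      by (elim bexE conjE) (rule that)
    obtain \<psi> where \<psi>: "\<psi> \<in> K" "\<And>v. \<psi> (\<phi> v) = v" "\<And>v. \<phi> (\<psi> v) = v"
      using K_inverse[OF \<phi>(1)] by blast
    have "c + u \<in> closure (orb c)" using closure_orb_K[OF \<psi>(1) y(1)] \<psi>(2) \<phi>(5) by simp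
    then have "u = 0" using \<delta>(2) \<phi> by blast
    then show ?thesis using \<phi>(1,5) orbI by simp
  qed
  obtain M1 where M1: "M1 > 0" "\<And>v. norm v \<le> M1 * ip_norm v" using norm_le_ip_norm by blast
  obtain M2 where M2: "M2 > 0" "\<And>v. ip_norm v \<le> M2 * norm v" using ip_norm_le_norm by blast
  have "y \<in> orb c" if y: "y \<in> closure (orb c)" for y
  proof -
    have "\<epsilon> / (M1 * M2) > 0" using \<epsilon>(1) M1(1) M2(1) by simp
    then obtain z where z: "z \<in> orb c" "dist z y < \<epsilon> / (M1 * M2)" using y closure_approachable by blast
    obtain \<phi> where \<phi>: "\<phi> \<in> K" "z = \<phi> c" using z(1) by (rule orbE)
    obtain \<psi> where \<psi>: "\<psi> \<in> K" "\<And>v. \<psi> (\<phi> v) = v" "\<And>v. \<phi> (\<psi> v) = v"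
      using K_inverse[OF \<phi>(1)] by blast
    have "norm (\<psi> y - c) = norm (\<psi> (y - z))" using \<psi>(2) \<phi>(2) by (simp add: linear_diff[OF K_linear[OF \<psi>(1)]])
    also have "\<dots> \<le> M1 * ip_norm (y - z)" using M1(2)[of "\<psi> (y - z)"] by (simp add: K_ip_norm[OF \<psi>(1)])
    also have "\<dots> \<le> M1 * (M2 * norm (y - z))" using M2(2) M1(1) by (intro mult_left_mono) auto
    also have "\<dots> < \<epsilon>" using z(2) M1(1) M2(1) by (simp add: dist_norm norm_minus_commute field_simps)
    finally have "\<psi> y \<in> orb c" using near closure_orb_K[OF \<psi>(1) y] by (simp add: dist_norm)
    then show ?thesis using orb_K_iff[OF \<psi>(1)] by simp
  qed
  then have "closed (orb c)" using closure_subset_eq by blast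
  then show ?thesis using bounded_orb by (simp add: compact_eq_bounded_closed)
qed

end

section \<open>Restricted roots\<close>

lemma second_derivative_test_max:
  fixes g g1 :: "real \<Rightarrow> real"
  assumes g: "\<And>t. (g has_real_derivative g1 t) (at t)" and g1: "(g1 has_real_derivative d) (at 0)"
    and max: "\<And>t. g t \<le> g 0"
  shows "g1 0 = 0" "d \<le> 0"
proof -
  show 0: "g1 0 = 0" using DERIV_local_max[OF g[of 0], of 1] max by simp
  show "d \<le> 0"
  proof (rule ccontr)
    assume "\<not> d \<le> 0"
    then obtain e where e: "e > 0" "\<And>h. 0 < h \<Longrightarrow> h < e \<Longrightarrow> g1 0 < g1 (0 + h)"
      using DERIV_pos_inc_right[OF g1] by auto
    have "g 0 < g (e / 2)"
    proof (rule DERIV_pos_imp_increasing_open[of 0 "e / 2" g])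
      show "\<exists>y. (g has_real_derivative y) (at x) \<and> y > 0" if "0 < x" "x < e / 2" for x
        using g[of x] e(2)[of x] that 0 by auto
      show "continuous_on {0..e / 2} g"
        using g by (meson DERIV_continuous_on has_field_derivative_at_within)
    qed (use e(1) in simp)
    then show False using max[of "e / 2"] by simp
  qed
qed

context lie
begin

lemma br_span:
  assumes "\<And>x y. x \<in> X \<Longrightarrow> y \<in> Y \<Longrightarrow> br x y \<in> S" "subspace S" "x \<in> span X" "y \<in> span Y"
  shows "br x y \<in> S"
proof -
  have 1: "br x y \<in> S" if x: "x \<in> X" for x
    using assms(4)
  proof (rule span_induct)
    show "subspace {y. br x y \<in> S}" by (rule subspaceI) (use assms(2) in \<open>auto intro: subspace_add subspace_scale subspace_0\<close>)
  qed (use assms(1) x in auto)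
  show ?thesis
    using assms(3)
  proof (rule span_induct)
    show "subspace {x. br x y \<in> S}" by (rule subspaceI) (use assms(2) in \<open>auto intro: subspace_add subspace_scale subspace_0\<close>)
  qed (use 1 in auto)
qed

end

locale restricted = cartan br \<theta> for br :: "'g::euclidean_space \<Rightarrow> 'g \<Rightarrow> 'g" and \<theta> +
  fixes a :: "'g set"
  assumes a_max: "maximal_commutative br pp a"
begin

lemma a_subspace: "subspace a" and a_pp: "a \<subseteq> pp"
  and a_comm: "x \<in> a \<Longrightarrow> y \<in> a \<Longrightarrow> br x y = 0"
  using a_max by (auto simp: maximal_commutative_def commutative_subspace_def)

lemma a_combination: "(\<And>i. i \<in> A \<Longrightarrow> f i \<in> a) \<Longrightarrow> (\<Sum>i\<in>A. c i *\<^sub>R f i) \<in> a"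
  by (intro subspace_sum[OF a_subspace] subspace_scale[OF a_subspace])

lemma a_self_centralizing:
  assumes u: "u \<in> pp" "\<And>h. h \<in> a \<Longrightarrow> br h u = 0"
  shows "u \<in> a"
proof -
  define b where "b = span (insert u a)"
  have ins: "br x y = 0" if "x \<in> insert u a" "y \<in> insert u a" for x y
    using that u(2) a_comm br_anti[of u] by auto
  have "br x y \<in> {0}" if "x \<in> b" "y \<in> b" for x y
    by (rule br_span[of "insert u a" "insert u a"]) (use that ins in \<open>auto simp: b_def\<close>)
  then have "commutative_subspace br b" by (simp add: commutative_subspace_def b_def)
  moreover have "a \<subseteq> b" by (auto simp: b_def intro: span_base)
  moreover have "b \<subseteq> pp" unfolding b_def using u(1) a_pp subspace_pp by (intro span_minimal) auto
  ultimately have "b = a" using a_max by (simp add: maximal_commutative_def)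
  then show ?thesis unfolding b_def using span_base[of u "insert u a"] by simp
qed

lemma eigenbasis_exists: "\<exists>E. orthonormal E \<and> span E = UNIV \<and> (\<forall>e\<in>E. \<forall>h\<in>a. \<exists>c. br h e = c *\<^sub>R e)"
proof -
  have comm: "br h (br h' v) = br h' (br h v)" if "h \<in> a" "h' \<in> a" for h h' v
    using jacobi[of h h' v] a_comm[OF that] by simp
  obtain E where "orthonormal E" "span E = UNIV" "\<And>e T. e \<in> E \<Longrightarrow> T \<in> br ` a \<Longrightarrow> \<exists>c. T e = c *\<^sub>R e"
    by (rule joint_eigenbasis[of "br ` a"]) (use sym_op_ad a_pp comm in auto)
  then show ?thesis by blast
qed

text \<open>A fixed orthonormal basis of joint eigenvectors of \<open>ad a\<close>. It refines the restricted root space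
  decomposition, so sums over this basis are sums over roots and zero, with multiplicity.\<close>

definition EB where
  "EB = (SOME E. orthonormal E \<and> span E = UNIV \<and> (\<forall>e\<in>E. \<forall>h\<in>a. \<exists>c. br h e = c *\<^sub>R e))"

definition wt where "wt e h = ip (br h e) e"

lemma EB: "orthonormal EB" "span EB = UNIV" and EB_eig: "e \<in> EB \<Longrightarrow> h \<in> a \<Longrightarrow> br h e = wt e h *\<^sub>R e"
proof -
  have E: "orthonormal EB \<and> span EB = UNIV \<and> (\<forall>e\<in>EB. \<forall>h\<in>a. \<exists>c. br h e = c *\<^sub>R e)"
    unfolding EB_def by (rule someI_ex[OF eigenbasis_exists])
  then show "orthonormal EB" "span EB = UNIV" by blast+
  assume e: "e \<in> EB" "h \<in> a"
  then obtain c where "br h e = c *\<^sub>R e" using E by blast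
  moreover have "ip e e = 1" using E e(1) by (simp add: orthonormal_def)
  ultimately show "br h e = wt e h *\<^sub>R e" by (simp add: wt_def)
qed

lemma finite_EB: "finite EB" using orthonormal_finite EB(1) .

lemma EB_ne: "e \<in> EB \<Longrightarrow> e \<noteq> 0" using EB(1) by (force simp: orthonormal_def)

lemma EB_expand: "v = (\<Sum>e\<in>EB. ip v e *\<^sub>R e)"
  using orthonormal_expand[OF EB(1)] EB(2) by blast

lemma ip_br_EB: "e \<in> EB \<Longrightarrow> h \<in> a \<Longrightarrow> ip (br h v) e = wt e h * ip v e"
  using sym_op_ad[of h] a_pp EB_eig[of e h] by (auto simp: sym_op_def)

lemma wt_add: "wt e (x + y) = wt e x + wt e y" and wt_scale: "wt e (c *\<^sub>R x) = c * wt e x"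
  by (simp_all add: wt_def)

abbreviation RR where "RR \<equiv> restricted_roots br a"

text \<open>The weight as a functional on \<open>a\<close>, in the representation by functions vanishing outside \<open>a\<close>.\<close>

definition rt where "rt e = (\<lambda>h. if h \<in> a then wt e h else 0)"

lemma rt_dual: "rt e \<in> dual_of a"
  using a_subspace by (auto simp: dual_of_def rt_def wt_add wt_scale subspace_add subspace_scale)

lemma root_spaceI: "e \<in> EB \<Longrightarrow> e \<in> restricted_root_space br a (rt e)"
  using EB_eig by (simp add: restricted_root_space_def rt_def)

lemma rt_cases: "e \<in> EB \<Longrightarrow> rt e = (\<lambda>_. 0) \<or> rt e \<in> RR"
  using root_spaceI[of e] EB_ne[of e] rt_dual[of e] by (auto simp: restricted_roots_def)

lemma root_vector:
  assumes "\<alpha> \<in> RR"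
  obtains v where "v \<noteq> 0" "\<And>h. h \<in> a \<Longrightarrow> br h v = \<alpha> h *\<^sub>R v"
proof -
  have "0 \<in> restricted_root_space br a \<alpha>" by (simp add: restricted_root_space_def)
  then obtain v where "v \<in> restricted_root_space br a \<alpha>" "v \<noteq> 0"
    using assms by (auto simp: restricted_roots_def)
  then show thesis using that by (auto simp: restricted_root_space_def)
qed

lemma root_dual: "\<alpha> \<in> RR \<Longrightarrow> \<alpha> \<in> dual_of a" and root_nonzero: "\<alpha> \<in> RR \<Longrightarrow> \<alpha> \<noteq> (\<lambda>_. 0)"
  by (auto simp: restricted_roots_def)

lemma rootI:
  assumes "\<alpha> \<in> dual_of a" "\<alpha> \<noteq> (\<lambda>_. 0)" "v \<noteq> 0" "\<And>h. h \<in> a \<Longrightarrow> br h v = \<alpha> h *\<^sub>R v"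
  shows "\<alpha> \<in> RR"
  using assms by (auto simp: restricted_roots_def restricted_root_space_def)

lemma dual_eqI: "f \<in> dual_of a \<Longrightarrow> g \<in> dual_of a \<Longrightarrow> (\<And>h. h \<in> a \<Longrightarrow> f h = g h) \<Longrightarrow> f = g"
  by (rule ext) (metis (mono_tags, lifting) dual_of_def mem_Collect_eq)

lemma dual_zero_outside: "f \<in> dual_of a \<Longrightarrow> h \<notin> a \<Longrightarrow> f h = 0"
  and dual_add: "f \<in> dual_of a \<Longrightarrow> x \<in> a \<Longrightarrow> y \<in> a \<Longrightarrow> f (x + y) = f x + f y"
  and dual_scale: "f \<in> dual_of a \<Longrightarrow> x \<in> a \<Longrightarrow> f (c *\<^sub>R x) = c * f x"
  by (auto simp: dual_of_def)

lemma dual_combination: "f \<in> dual_of a \<Longrightarrow> g \<in> dual_of a \<Longrightarrow> (\<lambda>y. s * f y + t * g y) \<in> dual_of a"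
  by (auto simp: dual_of_def algebra_simps)

lemma dual_zero: "(\<lambda>_. 0) \<in> dual_of a"
  by (simp add: dual_of_def)

lemma dual_minus: "f \<in> dual_of a \<Longrightarrow> (\<lambda>y. - f y) \<in> dual_of a"
  using dual_combination[of f f "-1" 0] by simp

lemma dual_diff: "f \<in> dual_of a \<Longrightarrow> g \<in> dual_of a \<Longrightarrow> (\<lambda>y. f y - g y) \<in> dual_of a"
  using dual_combination[of f g 1 "-1"] by simp

lemma root_is_rt:
  assumes "\<alpha> \<in> RR"
  obtains e where "e \<in> EB" "rt e = \<alpha>"
proof -
  obtain v where v: "v \<noteq> 0" "\<And>h. h \<in> a \<Longrightarrow> br h v = \<alpha> h *\<^sub>R v" using root_vector[OF assms] by blast
  obtain e where e: "e \<in> EB" "ip v e \<noteq> 0"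
    using EB_expand[of v] v(1) by (metis (no_types, lifting) scaleR_eq_0_iff sum.neutral)
  have "rt e h = \<alpha> h" if "h \<in> a" for h
    using ip_br_EB[OF e(1) that, of v] v(2)[OF that] e(2) that by (simp add: rt_def)
  then have "rt e = \<alpha>" by (intro dual_eqI rt_dual root_dual assms)
  then show thesis using that e(1) by blast
qed

lemma finite_RR: "finite RR"
proof -
  have "RR \<subseteq> rt ` EB" using root_is_rt by blast
  then show ?thesis using finite_EB finite_subset by blast
qed

lemma theta_root_vector:
  assumes "h \<in> a" "br h v = c *\<^sub>R v"
  shows "br h (\<theta> v) = - c *\<^sub>R \<theta> v"
proof -
  have "br h (\<theta> v) = \<theta> (br (\<theta> h) v)" by (simp add: theta_br)
  also have "\<theta> h = - h" using assms(1) a_pp by (auto simp: pp_def)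
  finally show ?thesis using assms(2) by simp
qed

lemma root_minus: assumes "\<alpha> \<in> RR" shows "(\<lambda>h. - \<alpha> h) \<in> RR"
proof -
  obtain v where v: "v \<noteq> 0" "\<And>h. h \<in> a \<Longrightarrow> br h v = \<alpha> h *\<^sub>R v" using root_vector[OF assms] by blast
  show ?thesis
  proof (rule rootI[of _ "\<theta> v"])
    show "\<theta> v \<noteq> 0" using v(1) theta_theta theta_simps(5) by metis
    show "br h (\<theta> v) = - \<alpha> h *\<^sub>R \<theta> v" if "h \<in> a" for h using theta_root_vector[OF that v(2)[OF that]] .
  qed (use root_dual[OF assms] root_nonzero[OF assms] dual_minus in \<open>auto simp: fun_eq_iff\<close>)
qed

lemma B_EB: assumes "x \<in> a" "y \<in> a" shows "B x y = (\<Sum>e\<in>EB. wt e x * wt e y)"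
proof -
  have "B x y = (\<Sum>e\<in>EB. ip ((br x \<circ> br y) e) e)"
    unfolding killing_form_def by (rule lin_trace_orthonormal[OF EB linear_br_br])
  also have "\<dots> = (\<Sum>e\<in>EB. wt e x * wt e y)"
    using assms EB(1) by (intro sum.cong refl) (simp add: ip_br_EB EB_eig orthonormal_def)
  finally show ?thesis .
qed

lemma a_eq_0I: assumes "h \<in> a" "\<And>\<alpha>. \<alpha> \<in> RR \<Longrightarrow> \<alpha> h = 0" shows "h = 0"
proof -
  have "wt e h = 0" if "e \<in> EB" for e
    using rt_cases[OF that] assms by (metis rt_def)
  then have "B h h = 0" using B_EB[OF assms(1,1)] by simp
  then show ?thesis using B_pos[of h] assms(1) a_pp by fastforce
qed

lemma h_vec:
  assumes "f \<in> dual_of a"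
  shows "h_vec br a f \<in> a" "y \<in> a \<Longrightarrow> B (h_vec br a f) y = f y"
proof -
  obtain h where h: "h \<in> a" "\<And>v. v \<in> a \<Longrightarrow> ip h v = f v"
    using riesz[OF a_subspace, of f] dual_add[OF assms] dual_scale[OF assms] by blast
  have "h_vec br a f = h"
    unfolding h_vec_def
  proof (rule the_equality)
    show "h \<in> a \<and> (\<forall>y\<in>a. B h y = f y)" using h a_pp by (auto simp: ip_pp[symmetric])
    fix h' assume h': "h' \<in> a \<and> (\<forall>y\<in>a. B h' y = f y)"
    have "ip (h' - h) v = 0" if "v \<in> a" for v using that h' h(2)[OF that] a_pp by (simp add: ip_pp subset_iff)
    then have "ip (h' - h) (h' - h) = 0" using h(1) h' subspace_diff[OF a_subspace] by blast
    then show "h' = h" by (simp add: ip_eq_0_iff del: ip_simps)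
  qed
  then show "h_vec br a f \<in> a" "y \<in> a \<Longrightarrow> B (h_vec br a f) y = f y"
    using h a_pp by (auto simp: ip_pp[symmetric])
qed

end

section \<open>Positive and simple roots\<close>

locale ordered_restricted = restricted br \<theta> a
  for br :: "'g::euclidean_space \<Rightarrow> 'g \<Rightarrow> 'g" and \<theta> a +
  fixes r :: "(('g \<Rightarrow> real) \<times> ('g \<Rightarrow> real)) set"
  assumes r_ord: "dual_ordering a r"
begin

abbreviation PR where "PR \<equiv> positive_roots br a r"
abbreviation SR where "SR \<equiv> simple_roots br a r"
abbreviation C where "C \<equiv> weyl_chamber a SR"

lemma r_linear: "linear_order_on (dual_of a) r"
  and r_add: "(f, g) \<in> r \<Longrightarrow> h \<in> dual_of a \<Longrightarrow> ((\<lambda>y. f y + h y), (\<lambda>y. g y + h y)) \<in> r"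
  using r_ord by (auto simp: dual_ordering_def)

lemma r_trans: "(f, g) \<in> r \<Longrightarrow> (g, h) \<in> r \<Longrightarrow> (f, h) \<in> r"
  and r_antisym: "(f, g) \<in> r \<Longrightarrow> (g, f) \<in> r \<Longrightarrow> f = g"
  and r_total: "f \<in> dual_of a \<Longrightarrow> g \<in> dual_of a \<Longrightarrow> f \<noteq> g \<Longrightarrow> (f, g) \<in> r \<or> (g, f) \<in> r"
  and r_refl: "f \<in> dual_of a \<Longrightarrow> (f, f) \<in> r"
  using r_linear unfolding linear_order_on_def partial_order_on_def preorder_on_def
    antisym_def total_on_def refl_on_def by (auto dest: transD)

lemma SR_PR: "\<alpha> \<in> SR \<Longrightarrow> \<alpha> \<in> PR" and PR_RR: "\<alpha> \<in> PR \<Longrightarrow> \<alpha> \<in> RR"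
  by (auto simp: simple_roots_def positive_roots_def)

lemma root_sign: assumes "\<alpha> \<in> RR" shows "\<alpha> \<in> PR \<or> (\<lambda>h. - \<alpha> h) \<in> PR"
proof -
  have "((\<lambda>_. 0), \<alpha>) \<in> r \<or> (\<alpha>, (\<lambda>_. 0)) \<in> r"
    using r_total[OF dual_zero root_dual[OF assms]] root_nonzero[OF assms] by auto
  moreover have "((\<lambda>_. 0), (\<lambda>h. - \<alpha> h)) \<in> r" if "(\<alpha>, (\<lambda>_. 0)) \<in> r"
    using r_add[OF that dual_minus[OF root_dual[OF assms]]] by simp
  ultimately show ?thesis using assms root_minus[OF assms] by (auto simp: positive_roots_def)
qed

text \<open>A positive root that is not simple is a sum of two positive roots, both of which are smaller in
  the ordering; there are finitely many roots.\<close>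

lemma positive_root_induct [consumes 1, case_names simple sum]:
  assumes "\<alpha> \<in> PR"
    and simple: "\<And>\<alpha>. \<alpha> \<in> SR \<Longrightarrow> P \<alpha>"
    and sum: "\<And>\<beta> \<gamma>. \<beta> \<in> PR \<Longrightarrow> \<gamma> \<in> PR \<Longrightarrow> P \<beta> \<Longrightarrow> P \<gamma> \<Longrightarrow> P (\<lambda>y. \<beta> y + \<gamma> y)"
  shows "P \<alpha>"
  using assms(1)
proof (induction "card {\<delta> \<in> PR. (\<delta>, \<alpha>) \<in> r}" arbitrary: \<alpha> rule: less_induct)
  case less
  have finP: "finite PR" using finite_RR by (rule finite_subset[rotated]) (auto simp: positive_roots_def)
  have smaller: "card {\<delta> \<in> PR. (\<delta>, \<beta>) \<in> r} < card {\<delta> \<in> PR. (\<delta>, \<alpha>) \<in> r}"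
    if "\<beta> \<in> PR" "\<gamma> \<in> PR" "\<alpha> = (\<lambda>y. \<beta> y + \<gamma> y)" for \<beta> \<gamma>
  proof (rule psubset_card_mono)
    show "finite {\<delta> \<in> PR. (\<delta>, \<alpha>) \<in> r}" using finP by simp
    have d: "\<beta> \<in> dual_of a" "\<gamma> \<in> dual_of a" using that PR_RR root_dual by blast+
    have "((\<lambda>_. 0), \<gamma>) \<in> r" using that(2) by (simp add: positive_roots_def)
    from r_add[OF this d(1)] have ba: "(\<beta>, \<alpha>) \<in> r" using that(3) by (simp add: add.commute)
    have "\<alpha> \<noteq> \<beta>"
    proof
      assume "\<alpha> = \<beta>"
      then have "\<gamma> = (\<lambda>_. 0)" using that(3) by (metis add_cancel_left_right ext)
      then show False using root_nonzero PR_RR that(2) by blast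
    qed
    then have "(\<alpha>, \<beta>) \<notin> r" using ba r_antisym by blast
    moreover have "(\<alpha>, \<alpha>) \<in> r" using less.prems PR_RR root_dual r_refl by blast
    ultimately show "{\<delta> \<in> PR. (\<delta>, \<beta>) \<in> r} \<subset> {\<delta> \<in> PR. (\<delta>, \<alpha>) \<in> r}"
      using less.prems ba r_trans by blast
  qed
  show ?case
  proof (cases "\<alpha> \<in> SR")
    case False
    then obtain \<beta> \<gamma> where bg: "\<beta> \<in> PR" "\<gamma> \<in> PR" "\<alpha> = (\<lambda>y. \<beta> y + \<gamma> y)"
      using less.prems by (auto simp: simple_roots_def)
    have bg': "\<alpha> = (\<lambda>y. \<gamma> y + \<beta> y)" using bg(3) by (simp add: add.commute)
    have "P \<beta>" using less.hyps[OF smaller[OF bg] bg(1)] .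
    moreover have "P \<gamma>" using less.hyps[OF smaller[OF bg(2,1) bg'] bg(2)] .
    ultimately show ?thesis unfolding bg(3) by (rule sum[OF bg(1,2)])
  qed (rule simple)
qed

lemma C_a: "x \<in> C \<Longrightarrow> x \<in> a" and C_pp: "x \<in> C \<Longrightarrow> x \<in> pp"
  using a_pp by (auto simp: weyl_chamber_def)

lemma C_nonneg: assumes "x \<in> C" "\<alpha> \<in> PR" shows "0 \<le> \<alpha> x"
  using assms(2)
proof (induction rule: positive_root_induct)
  case (simple \<alpha>)
  then show ?case using assms(1) by (simp add: weyl_chamber_def)
qed simp

text \<open>Every root is positive or negative, hence has the same sign on all of \<open>C\<close>.\<close>

lemma wt_sign_agree:
  assumes e: "e \<in> EB" and "x \<in> C" "y \<in> C"
  shows "(0 \<le> wt e x \<and> 0 \<le> wt e y) \<or> (wt e x \<le> 0 \<and> wt e y \<le> 0)"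
proof -
  have xy: "wt e x = rt e x" "wt e y = rt e y" using assms C_a by (auto simp: rt_def)
  consider "rt e = (\<lambda>_. 0)" | "rt e \<in> PR" | "(\<lambda>h. - rt e h) \<in> PR"
    using rt_cases[OF e] root_sign by blast
  then show ?thesis
    using C_nonneg[OF assms(2)] C_nonneg[OF assms(3)] by cases (simp_all add: xy, force+)
qed

lemma B_C_terms: "x \<in> C \<Longrightarrow> y \<in> C \<Longrightarrow> e \<in> EB \<Longrightarrow> 0 \<le> wt e x * wt e y"
  using wt_sign_agree[of e x y] by (auto intro: mult_nonneg_nonneg mult_nonpos_nonpos)

lemma B_C_nonneg: "x \<in> C \<Longrightarrow> y \<in> C \<Longrightarrow> 0 \<le> B x y"
  using B_EB[of x y] B_C_terms C_a by (simp add: sum_nonneg)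

section \<open>The maximum of a linear functional over an orbit\<close>

lemma wt_span:
  assumes A: "A \<subseteq> EB" and h: "h \<in> a" and v: "br h v = s *\<^sub>R v"
    and in_A: "\<And>e. e \<in> EB \<Longrightarrow> wt e h = s \<Longrightarrow> e \<in> A"
  shows "v \<in> span A"
proof -
  have "ip v e *\<^sub>R e \<in> span A" if e: "e \<in> EB" for e
  proof (cases "ip v e = 0")
    case False
    then have "wt e h = s" using ip_br_EB[OF e h, of v] v by simp
    then show ?thesis using in_A e by (simp add: span_base span_scale)
  qed (simp add: span_zero)
  then have "(\<Sum>e\<in>EB. ip v e *\<^sub>R e) \<in> span A" by (rule span_sum)
  then show ?thesis using EB_expand[of v] by simp
qed

lemma br_EB:
  assumes "e \<in> EB" "f \<in> EB" "h \<in> a"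
  shows "br h (br e f) = (wt e h + wt f h) *\<^sub>R br e f"
  using jacobi[of h e f] EB_eig[OF assms(1,3)] EB_eig[OF assms(2,3)] by (simp add: scaleR_add_left)

text \<open>\<open>L\<close> and \<open>M\<close> are upper level sets of the eigenvalues of \<open>ad x\<close> and \<open>ad y\<close>. Eigenvectors with
  \<open>ad x \<ge> 0\<close> preserve \<open>span L\<close>. Those with \<open>ad x < 0\<close> do not raise eigenvalues of \<open>ad y\<close>, because \<open>x\<close> and
  \<open>y\<close> lie in the same chamber, so they preserve the complement of \<open>span M\<close>.\<close>

theorem orbit_maximum:
  assumes x: "x \<in> C" and y: "y \<in> C" and k: "\<phi> \<in> K"
  shows "B (\<phi> x) y \<le> B x y"
proof -
  have xa: "x \<in> a" and ya: "y \<in> a" using x y C_a by auto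
  obtain \<psi> where \<psi>: "\<psi> \<in> K" "\<And>v. \<psi> (\<phi> v) = v" "\<And>v. \<phi> (\<psi> v) = v" using K_inverse[OF k] by blast
  have tr: "ip (\<psi> m) l = ip m (\<phi> l)" for m l using K_ip[OF k, of "\<psi> m" l] \<psi>(3) by simp
  have unit: "ip m m = 1" if "m \<in> EB" for m using that EB(1) by (simp add: orthonormal_def)
  have diag: "ip (br (\<phi> x) m) m = (\<Sum>l\<in>EB. wt l x * (ip m (\<phi> l))\<^sup>2)" for m
  proof -
    have "br (\<phi> x) m = \<phi> (br x (\<psi> m))" by (simp add: K_br[OF k] \<psi>(3))
    then have "ip (br (\<phi> x) m) m = ip (br x (\<psi> m)) (\<psi> m)" using K_ip[OF k, of "br x (\<psi> m)" "\<psi> m"] \<psi>(3) by simp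
    also have "\<dots> = (\<Sum>l\<in>EB. ip (br x (\<psi> m)) l * ip (\<psi> m) l)" using parseval[OF EB(1)] EB(2) by blast
    also have "\<dots> = (\<Sum>l\<in>EB. wt l x * (ip m (\<phi> l))\<^sup>2)"
      by (intro sum.cong refl) (simp add: ip_br_EB xa tr power2_eq_square)
    finally show ?thesis .
  qed
  have "B (\<phi> x) y = (\<Sum>m\<in>EB. ip ((br (\<phi> x) \<circ> br y) m) m)"
    unfolding killing_form_def by (rule lin_trace_orthonormal[OF EB linear_br_br])
  also have "\<dots> = (\<Sum>m\<in>EB. \<Sum>l\<in>EB. wt m y * wt l x * (ip m (\<phi> l))\<^sup>2)"
    by (intro sum.cong refl) (simp add: EB_eig ya diag sum_distrib_left mult.assoc)
  also have "\<dots> \<le> (\<Sum>m\<in>EB. wt m y * wt m x)"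
  proof (rule rearrangement_bistochastic[OF finite_EB])
    show "(\<Sum>l\<in>EB. (ip m (\<phi> l))\<^sup>2) = 1" if "m \<in> EB" for m
      using parseval[OF EB(1), of "\<psi> m" "\<psi> m"] EB(2) K_ip[OF \<psi>(1), of m m] unit[OF that]
      by (simp add: tr power2_eq_square)
    show "(\<Sum>m\<in>EB. (ip m (\<phi> l))\<^sup>2) = 1" if "l \<in> EB" for l
    proof -
      have "(\<Sum>m\<in>EB. (ip m (\<phi> l))\<^sup>2) = (\<Sum>m\<in>EB. ip (\<phi> l) m * ip (\<phi> l) m)"
        by (intro sum.cong refl) (simp only: power2_eq_square ip_sym[of "\<phi> l"])
      also have "\<dots> = ip (\<phi> l) (\<phi> l)" using parseval[OF EB(1), of "\<phi> l" "\<phi> l"] EB(2) by simp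
      finally show ?thesis using K_ip[OF k, of l l] unit[OF that] by simp
    qed
    fix s t
    let ?M = "{m \<in> EB. s \<le> wt m y}" and ?L = "{l \<in> EB. t \<le> wt l x}"
    let ?N = "{e \<in> EB. wt e x < 0}" and ?Q = "{e \<in> EB. 0 \<le> wt e x}"
    show "(\<Sum>m\<in>?M. \<Sum>l\<in>?L. (ip m (\<phi> l))\<^sup>2) \<le> real (card (?M \<inter> ?L))"
    proof (rule flag_overlap_bound[OF EB(1) _ _ _ _ _ k, of ?L ?M "span ?Q" "span ?N"])
      show "br e u \<in> span ?L" if "e \<in> span ?Q" "u \<in> span ?L" for e u
      proof (rule br_span[OF _ subspace_span that])
        fix e l assume e: "e \<in> ?Q" and l: "l \<in> ?L"
        have "br x (br e l) = (wt e x + wt l x) *\<^sub>R br e l" using e l xa br_EB by simp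
        from wt_span[OF _ xa this, of ?L] show "br e l \<in> span ?L" using e l by auto
      qed
      show "\<exists>f\<in>span ?N. \<exists>e\<in>span ?Q. v = f + e" for v
      proof -
        have NQ: "?N \<union> ?Q = EB" by auto
        have "v = (\<Sum>e\<in>?N \<union> ?Q. ip v e *\<^sub>R e)" unfolding NQ by (rule EB_expand)
        also have "\<dots> = (\<Sum>e\<in>?N. ip v e *\<^sub>R e) + (\<Sum>e\<in>?Q. ip v e *\<^sub>R e)"
          using finite_EB by (intro sum.union_disjoint) auto
        finally have "v = (\<Sum>e\<in>?N. ip v e *\<^sub>R e) + (\<Sum>e\<in>?Q. ip v e *\<^sub>R e)" .
        moreover have "(\<Sum>e\<in>A. ip v e *\<^sub>R e) \<in> span A" for A by (intro span_sum span_scale span_base)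
        ultimately show ?thesis by blast
      qed
      show "ip (br f v) m = 0" if f: "f \<in> span ?N" and v: "\<And>m. m \<in> ?M \<Longrightarrow> ip v m = 0" and m: "m \<in> ?M" for f v m
      proof -
        let ?S = "{v. \<forall>m\<in>?M. ip v m = 0}"
        have "v \<in> span (EB - ?M)"
        proof -
          have "ip v e *\<^sub>R e \<in> span (EB - ?M)" if "e \<in> EB" for e
            using v[of e] that by (cases "e \<in> ?M") (simp_all add: span_zero span_base span_scale)
          then have "(\<Sum>e\<in>EB. ip v e *\<^sub>R e) \<in> span (EB - ?M)" by (rule span_sum)
          then show ?thesis using EB_expand[of v] by simp
        qed
        moreover have "subspace ?S" by (auto simp: subspace_def)
        moreover have "br e e' \<in> ?S" if e: "e \<in> ?N" and e': "e' \<in> EB - ?M" for e e'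
        proof -
          have "wt e y \<le> 0" using wt_sign_agree[of e x y] e x y by auto
          then have less: "wt e y + wt e' y < s" using e' by auto
          have "(wt e y + wt e' y) * ip (br e e') m = wt m y * ip (br e e') m" if "m \<in> EB" for m
            using ip_br_EB[OF that ya, of "br e e'"] br_EB[OF _ _ ya, of e e'] e e' by simp
          then show ?thesis using less by force
        qed
        ultimately have "br f v \<in> ?S" using br_span[OF _ _ f, of "EB - ?M" ?S v] by blast
        then show ?thesis using m by blast
      qed
    qed auto
  qed
  also have "\<dots> = B x y" using B_EB[OF xa ya] by (simp add: mult.commute)
  finally show ?thesis .
qed

text \<open>At a maximizer \<open>z\<close> of \<open>B(\<cdot>, h0)\<close>, the first derivative in direction \<open>[z, h0]\<close> shows \<open>[z, h0] = 0\<close>, and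
  regularity of \<open>h0\<close> gives \<open>z \<in> a\<close>. The second derivative in direction \<open>e + \<theta> e\<close>, for a vector \<open>e\<close> of the
  root \<open>\<alpha>\<close>, is a negative multiple of \<open>\<alpha> z * \<alpha> h0\<close>.\<close>

lemma orbit_meets_chamber:
  assumes h0: "h0 \<in> a" "\<And>\<alpha>. \<alpha> \<in> PR \<Longrightarrow> 0 < \<alpha> h0" and y: "y \<in> pp"
  obtains \<phi> c where "\<phi> \<in> K" "c \<in> C" "y = \<phi> c"
proof -
  have h0p: "h0 \<in> pp" using h0(1) a_pp by blast
  have "continuous_on (orb y) (\<lambda>z. B z h0)"
    using bounded_bilinear.continuous_on[OF bilinear_conv_bounded_bilinear[THEN iffD1, OF killing_bilinear] continuous_on_id continuous_on_const] .
  then obtain z where z: "z \<in> orb y" "\<And>w. w \<in> orb y \<Longrightarrow> B w h0 \<le> B z h0"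
    using continuous_attains_sup[OF compact_orb[OF y], of "\<lambda>z. B z h0"] orb_self by blast
  have zp: "z \<in> pp" using z(1) orb_sub_pp[OF y] by blast
  have critical: "B (br \<xi> z) h0 = 0 \<and> B (br \<xi> (br \<xi> z)) h0 \<le> 0" if \<xi>: "\<xi> \<in> kk" for \<xi>
  proof -
    let ?e = "\<lambda>t. lin_exp (br (t *\<^sub>R \<xi>)) z"
    have e0: "?e 0 = z" using lin_exp_zero[of z] by (simp add: bilinear_lzero[OF br_bilinear, abs_def])
    have lin: "bounded_linear (\<lambda>w. B w h0)" "bounded_linear (\<lambda>w. B (br \<xi> w) h0)"
      using linear_conv_bounded_linear killing_bilinear linear_compose[OF linear_br, of "\<lambda>w. B w h0" \<xi>]
      by (auto simp: bilinear_def o_def)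
    have d1: "((\<lambda>t. B (?e t) h0) has_real_derivative B (br \<xi> (?e t)) h0) (at t)" for t
      using bounded_linear.has_vector_derivative[OF lin(1) exp_curve] by (simp add: has_real_derivative_iff_has_vector_derivative)
    have d2: "((\<lambda>t. B (br \<xi> (?e t)) h0) has_real_derivative B (br \<xi> (br \<xi> (?e 0))) h0) (at 0)"
      using bounded_linear.has_vector_derivative[OF lin(2) exp_curve[of \<xi> z 0]] by (simp add: has_real_derivative_iff_has_vector_derivative)
    have "t *\<^sub>R \<xi> \<in> kk" for t using \<xi> subspace_kk subspace_scale by blast
    then have "B (?e t) h0 \<le> B (?e 0) h0" for t using z(2) orb_K[OF K_exp z(1)] e0 by simp
    from second_derivative_test_max[OF d1 d2 this] show ?thesis using e0 by simp
  qed
  have bz: "br z h0 \<in> kk" by (rule br_pp[OF zp h0p])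
  have "B (br z h0) (br z h0) = 0" using critical[OF bz] killing_invariant[of "br z h0" z h0] by simp
  then have "ip (br z h0) (br z h0) = 0" by (simp add: ip_kk[OF bz])
  then have hz: "br h0 z = 0" using br_anti[of h0 z] by (simp add: ip_eq_0_iff)
  have za: "z \<in> a"
  proof (rule a_self_centralizing[OF zp])
    fix h assume h: "h \<in> a"
    have "ip (br h z) e = 0" if e: "e \<in> EB" for e
    proof (cases "rt e = (\<lambda>_. 0)")
      case True
      then have "wt e h = 0" using h by (metis rt_def)
      then show ?thesis using ip_br_EB[OF e h] by simp
    next
      case False
      then have "rt e \<in> PR \<or> (\<lambda>h. - rt e h) \<in> PR" using rt_cases[OF e] root_sign by blast
      then have "rt e h0 \<noteq> 0" using h0(2) by force
      then have "wt e h0 \<noteq> 0" using h0(1) by (simp add: rt_def)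
      then have "ip z e = 0" using ip_br_EB[OF e h0(1), of z] hz by simp
      then show ?thesis using ip_br_EB[OF e h] by simp
    qed
    then show "br h z = 0" using EB_expand[of "br h z"] by simp
  qed
  have "0 \<le> \<alpha> z" if al: "\<alpha> \<in> PR" for \<alpha>
  proof -
    obtain e where e: "e \<noteq> 0" "\<And>h. h \<in> a \<Longrightarrow> br h e = \<alpha> h *\<^sub>R e" using root_vector[OF PR_RR[OF al]] by blast
    define \<xi> where "\<xi> = e + \<theta> e" define \<eta> where "\<eta> = e - \<theta> e"
    have \<xi>: "\<xi> \<in> kk" and \<eta>: "\<eta> \<in> pp" by (simp_all add: \<xi>_def \<eta>_def kk_def pp_def add.commute)
    have ad: "br h \<xi> = \<alpha> h *\<^sub>R \<eta>" if "h \<in> a" for h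
      using e(2)[OF that] theta_root_vector[OF that e(2)[OF that]] by (simp add: \<xi>_def \<eta>_def scaleR_diff_right)
    have "\<eta> \<noteq> 0"
    proof
      assume "\<eta> = 0"
      then have "\<theta> e = e" by (simp add: \<eta>_def)
      then have "br h0 e = - \<alpha> h0 *\<^sub>R e"
        using theta_root_vector[OF h0(1) e(2)[OF h0(1)]] by (simp only:)
      then have "\<alpha> h0 *\<^sub>R e + \<alpha> h0 *\<^sub>R e = 0" unfolding e(2)[OF h0(1)] by (metis add.right_inverse scaleR_minus_left)
      then have "(2 * \<alpha> h0) *\<^sub>R e = 0" by (simp only: mult_2 scaleR_add_left)
      then show False using e(1) h0(2)[OF al] by simp
    qed
    then have pos: "0 < B \<eta> \<eta>" using B_pos \<eta> by blast
    have "B (br \<xi> (br \<xi> z)) h0 = - B (br (br \<xi> z) \<xi>) h0" using br_anti[of \<xi> "br \<xi> z"] by simp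
    also have "\<dots> = - B (br \<xi> z) (br \<xi> h0)" by (simp add: killing_invariant)
    also have "\<dots> = - (\<alpha> z * \<alpha> h0 * B \<eta> \<eta>)"
      using ad[OF za] ad[OF h0(1)] br_anti[of \<xi> z] br_anti[of \<xi> h0] by simp
    finally have "0 \<le> \<alpha> z * \<alpha> h0 * B \<eta> \<eta>" using critical[OF \<xi>] by simp
    then show ?thesis using pos h0(2)[OF al] by (simp add: zero_le_mult_iff)
  qed
  then have "z \<in> C" using za SR_PR by (simp add: weyl_chamber_def)
  obtain \<psi> where \<psi>: "\<psi> \<in> K" "z = \<psi> y" using z(1) by (rule orbE)
  obtain \<phi> where \<phi>: "\<phi> \<in> K" "\<And>v. \<phi> (\<psi> v) = v" "\<And>v. \<psi> (\<phi> v) = v" using K_inverse[OF \<psi>(1)] by blast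
  have "y = \<phi> z" unfolding \<psi>(2) \<phi>(2) ..
  then show thesis by (rule that[OF \<phi>(1) \<open>z \<in> C\<close>])
qed

end

section \<open>Root strings, reflections and full-dimensional Weyl polytopes\<close>

context restricted
begin

lemma B_separates: assumes "u \<in> a" "v \<in> a" "\<And>y. y \<in> a \<Longrightarrow> B u y = B v y" shows "u = v"
proof -
  have "u - v \<in> a" using assms subspace_diff[OF a_subspace] by blast
  then have "ip (u - v) (u - v) = 0" using assms(3)[of "u - v"] a_pp by (subst ip_pp) auto
  then show ?thesis by (simp add: ip_eq_0_iff del: ip_simps)
qed

lemma dual_inner_eq: "f \<in> dual_of a \<Longrightarrow> g \<in> dual_of a \<Longrightarrow> dual_inner br a f g = f (h_vec br a g)"
  unfolding dual_inner_def by (rule h_vec(2)[OF _ h_vec(1)])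

lemma root_norm_pos: assumes "\<alpha> \<in> RR" shows "0 < dual_inner br a \<alpha> \<alpha>"
proof -
  note d = root_dual[OF assms]
  have "h_vec br a \<alpha> \<noteq> 0"
  proof
    assume "h_vec br a \<alpha> = 0"
    then have "\<alpha> y = 0" for y using h_vec(2)[OF d, of y] dual_zero_outside[OF d, of y] by (cases "y \<in> a") auto
    then show False using root_nonzero[OF assms] by blast
  qed
  then show ?thesis unfolding dual_inner_def using h_vec(1)[OF d] a_pp B_pos by blast
qed

lemma root_triple:
  assumes \<alpha>: "\<alpha> \<in> RR" and e: "\<And>h. h \<in> a \<Longrightarrow> br h e = \<alpha> h *\<^sub>R e"
  shows "br (\<theta> e) e = ip e e *\<^sub>R h_vec br a \<alpha>"
proof -
  let ?t = "br (\<theta> e) e"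
  note d = root_dual[OF \<alpha>]
  have tp: "?t \<in> pp" using br_anti[of "\<theta> e" e] by (simp add: pp_def theta_br)
  have ta: "?t \<in> a"
  proof (rule a_self_centralizing[OF tp])
    fix h assume h: "h \<in> a"
    show "br h ?t = 0"
      using jacobi[of h "\<theta> e" e] theta_root_vector[OF h e[OF h]] e[OF h] by simp
  qed
  show ?thesis
  proof (rule B_separates[OF ta])
    show "ip e e *\<^sub>R h_vec br a \<alpha> \<in> a" using h_vec(1)[OF d] subspace_scale[OF a_subspace] by blast
    fix y assume y: "y \<in> a"
    have "B ?t y = B (\<theta> e) (br e y)" by (rule killing_invariant)
    also have "br e y = - \<alpha> y *\<^sub>R e" using br_anti[of e y] e[OF y] by simp
    also have "B (\<theta> e) (- \<alpha> y *\<^sub>R e) = \<alpha> y * ip e e" by (simp add: ip_def killing_sym[of "\<theta> e"])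
    finally show "B ?t y = B (ip e e *\<^sub>R h_vec br a \<alpha>) y" using h_vec(2)[OF d y] by simp
  qed
qed

text \<open>If \<open>\<alpha> - \<beta>\<close> were not a root, \<open>\<theta> e\<close> would annihilate a vector \<open>v\<close> of \<open>\<alpha>\<close>, for \<open>e\<close> in the root space of
  \<open>\<beta>\<close>. Then \<open>|[e, v]|\<^sup>2\<close> would be negative, namely a negative multiple of the positive inner product of \<open>\<alpha>\<close> and \<open>\<beta>\<close>.\<close>

lemma root_difference:
  assumes \<alpha>: "\<alpha> \<in> RR" and \<beta>: "\<beta> \<in> RR" and pos: "0 < dual_inner br a \<alpha> \<beta>" and ne: "\<alpha> \<noteq> \<beta>"
  shows "(\<lambda>y. \<alpha> y - \<beta> y) \<in> RR"
proof -
  obtain v where v: "v \<noteq> 0" "\<And>h. h \<in> a \<Longrightarrow> br h v = \<alpha> h *\<^sub>R v" using root_vector[OF \<alpha>] by blast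
  obtain e where e: "e \<noteq> 0" "\<And>h. h \<in> a \<Longrightarrow> br h e = \<beta> h *\<^sub>R e" using root_vector[OF \<beta>] by blast
  let ?w = "br (\<theta> e) v"
  have "?w \<noteq> 0"
  proof
    assume w: "?w = 0"
    have "br (\<theta> e) (br e v) = br (br (\<theta> e) e) v" using jacobi[of "\<theta> e" e v] w by simp
    also have "\<dots> = (ip e e * \<alpha> (h_vec br a \<beta>)) *\<^sub>R v"
      using root_triple[OF \<beta> e(2)] v(2)[OF h_vec(1)[OF root_dual[OF \<beta>]]] by simp
    finally have "ip (br e v) (br e v) = - (ip e e * dual_inner br a \<alpha> \<beta> * ip v v)"
      using ad_adjoint[of e v "br e v"] dual_inner_eq[OF root_dual[OF \<alpha>] root_dual[OF \<beta>]] by simp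
    moreover have "0 < ip e e * dual_inner br a \<alpha> \<beta> * ip v v" using pos ip_pos e(1) v(1) by simp
    ultimately show False using ip_nonneg[of "br e v"] by linarith
  qed
  moreover have "br h ?w = (\<alpha> h - \<beta> h) *\<^sub>R ?w" if h: "h \<in> a" for h
    using jacobi[of h "\<theta> e" v] theta_root_vector[OF h e(2)[OF h]] v(2)[OF h] by (simp add: scaleR_diff_left)
  moreover have "(\<lambda>y. \<alpha> y - \<beta> y) \<noteq> (\<lambda>_. 0)" using ne by (auto simp: fun_eq_iff)
  ultimately show ?thesis using rootI[OF dual_diff[OF root_dual[OF \<alpha>] root_dual[OF \<beta>]]] by blast
qed

lemma reflection_value:
  "y \<in> a \<Longrightarrow> root_reflection br a \<alpha> y = y - (2 * \<alpha> y / dual_inner br a \<alpha> \<alpha>) *\<^sub>R h_vec br a \<alpha>"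
  by (simp add: root_reflection_def)

lemma reflection_involution:
  assumes \<alpha>: "\<alpha> \<in> RR" and y: "y \<in> a"
  shows "root_reflection br a \<alpha> y \<in> a" "root_reflection br a \<alpha> (root_reflection br a \<alpha> y) = y"
proof -
  note d = root_dual[OF \<alpha>]
  let ?h = "h_vec br a \<alpha>" and ?c = "2 * \<alpha> y / dual_inner br a \<alpha> \<alpha>"
  have ha: "?c *\<^sub>R ?h \<in> a" "- ?c *\<^sub>R ?h \<in> a" using h_vec(1)[OF d] subspace_scale[OF a_subspace] by blast+
  have eq: "root_reflection br a \<alpha> y = y - ?c *\<^sub>R ?h" by (rule reflection_value[OF y])
  show in_a: "root_reflection br a \<alpha> y \<in> a" unfolding eq using y ha subspace_diff[OF a_subspace] by blast
  have "\<alpha> ?h = dual_inner br a \<alpha> \<alpha>" using dual_inner_eq[OF d d] by simp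
  moreover have "\<alpha> (y - ?c *\<^sub>R ?h) = \<alpha> y - ?c * \<alpha> ?h"
    using dual_add[OF d y ha(2)] dual_scale[OF d h_vec(1)[OF d], of "- ?c"] by simp
  ultimately have "\<alpha> (root_reflection br a \<alpha> y) = - \<alpha> y" unfolding eq using root_norm_pos[OF \<alpha>] by simp
  then show "root_reflection br a \<alpha> (root_reflection br a \<alpha> y) = y"
    using reflection_value[OF in_a, of \<alpha>] eq by simp
qed

lemma reflection_Bij: assumes "\<alpha> \<in> RR" shows "root_reflection br a \<alpha> \<in> Bij a"
proof -
  have "bij_betw (root_reflection br a \<alpha>) a a"
    by (rule bij_betw_byWitness[of _ "root_reflection br a \<alpha>"]) (use reflection_involution[OF assms] in auto)
  then show ?thesis by (simp add: Bij_def root_reflection_def)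
qed

lemma weyl_group_invariant:
  assumes S: "S \<subseteq> a" "\<And>\<alpha> z. \<alpha> \<in> RR \<Longrightarrow> z \<in> S \<Longrightarrow> root_reflection br a \<alpha> z \<in> S" and "w \<in> weyl_group br a" "z \<in> S"
  shows "w z \<in> S"
proof -
  have "w \<in> Bij a \<and> (\<forall>z\<in>S. w z \<in> S)"
    using assms(3) unfolding weyl_group_def
  proof induction
    case one
    have one: "\<one>\<^bsub>BijGroup a\<^esub> = (\<lambda>z\<in>a. z)" by (simp add: BijGroup_def)
    show ?case
      unfolding one
    proof (intro conjI ballI)
      show "(\<lambda>z\<in>a. z) \<in> Bij a" by (rule id_Bij)
      show "(\<lambda>z\<in>a. z) z \<in> S" if "z \<in> S" for z using S(1) that by auto
    qed
  next
    case (incl s)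
    then show ?case using reflection_Bij S(2) by auto
  next
    case (inv s)
    then obtain \<alpha> where \<alpha>: "\<alpha> \<in> RR" "s = root_reflection br a \<alpha>" by blast
    have s: "s \<in> Bij a" using reflection_Bij[OF \<alpha>(1)] \<alpha>(2) by simp
    have "inv\<^bsub>BijGroup a\<^esub> s = s"
    proof (rule group.inv_equality[OF group_BijGroup])
      show "s \<otimes>\<^bsub>BijGroup a\<^esub> s = \<one>\<^bsub>BijGroup a\<^esub>"
      proof -
        have "s \<otimes>\<^bsub>BijGroup a\<^esub> s = (\<lambda>z\<in>a. s (s z))" using s by (simp add: BijGroup_def compose_def)
        also have "\<dots> = (\<lambda>z\<in>a. z)" using reflection_involution(2)[OF \<alpha>(1)] \<alpha>(2) by (intro restrict_ext) simp
        finally show ?thesis by (simp add: BijGroup_def)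
      qed
    qed (use s in \<open>simp_all add: BijGroup_def\<close>)
    then show ?case using s \<alpha> S(2) by auto
  next
    case (eng f g)
    then have "f \<otimes>\<^bsub>BijGroup a\<^esub> g = compose a f g" by (simp add: BijGroup_def)
    moreover have "compose a f g \<in> Bij a" using eng by (intro compose_Bij) auto
    moreover have "compose a f g z \<in> S" if "z \<in> S" for z using eng S(1) that by (auto simp: compose_def)
    ultimately show ?case by (simp only:) blast
  qed
  then show ?thesis using assms(4) by blast
qed

text \<open>If \<open>\<alpha> z \<noteq> 0\<close> then \<open>\<alpha> h' = 0\<close>, so \<open>l = e + \<theta> e\<close> commutes with \<open>h'\<close>. As \<open>[l, [l, z]]\<close> is a nonzero
  multiple of \<open>h\<^sub>\<alpha>\<close>, the vector \<open>h\<^sub>\<alpha>\<close> and with it the reflected point satisfy the same equation.\<close>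

lemma reflection_preserves_annihilator:
  assumes h': "h' \<in> a" and \<alpha>: "\<alpha> \<in> RR" and z: "z \<in> a" "\<And>v. br z (br h' v) = 0"
  shows "br (root_reflection br a \<alpha> z) (br h' v) = 0"
proof -
  have "br (h_vec br a \<alpha>) (br h' v) = 0" if nz: "\<alpha> z \<noteq> 0" for v
  proof -
    obtain e where e: "e \<noteq> 0" "\<And>h. h \<in> a \<Longrightarrow> br h e = \<alpha> h *\<^sub>R e" using root_vector[OF \<alpha>] by blast
    have "br z (br h' e) = (\<alpha> h' * \<alpha> z) *\<^sub>R e" using e(2)[OF h'] e(2)[OF z(1)] by simp
    then have "\<alpha> h' = 0" using z(2)[of e] e(1) nz by simp
    \<comment> \<open>\<open>l\<close> commutes with \<open>h'\<close>, so bracketing with \<open>l\<close> preserves the annihilator of \<open>ad h'\<close>\<close>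
    define l where "l = e + \<theta> e"
    have hl: "br h' l = 0"
      using e(2)[OF h'] theta_root_vector[OF h' e(2)[OF h']] \<open>\<alpha> h' = 0\<close> by (simp add: l_def)
    have comm: "br h' (br l v) = br l (br h' v)" for v using jacobi[of h' l v] hl by simp
    have ann: "br (br l u) (br h' v) = 0" if "\<And>v. br u (br h' v) = 0" for u v
      using jacobi[of l u "br h' v"] that[of v] that[of "br l v"] comm[of v] by simp
    have "br l z = - \<alpha> z *\<^sub>R (e - \<theta> e)"
      using br_anti[of l z] e(2)[OF z(1)] theta_root_vector[OF z(1) e(2)[OF z(1)]]
      by (simp add: l_def scaleR_diff_right)
    moreover have "br l (e - \<theta> e) = 2 *\<^sub>R br (\<theta> e) e"
      using br_anti[of e "\<theta> e"] by (simp add: l_def scaleR_2)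
    ultimately have "br l (br l z) = (- 2 * \<alpha> z * ip e e) *\<^sub>R h_vec br a \<alpha>"
      using root_triple[OF \<alpha> e(2)] by simp
    moreover have "br (br l (br l z)) (br h' v) = 0" by (rule ann[OF ann[OF z(2)]])
    ultimately have "(- 2 * \<alpha> z * ip e e) *\<^sub>R br (h_vec br a \<alpha>) (br h' v) = 0" by simp
    then show ?thesis using nz ip_pos[OF e(1)] by simp
  qed
  then show ?thesis using z by (cases "\<alpha> z = 0") (simp_all add: reflection_value)
qed

end

context ordered_restricted
begin

lemma simple_obtuse:
  assumes "\<alpha> \<in> SR" "\<beta> \<in> SR" "\<alpha> \<noteq> \<beta>"
  shows "dual_inner br a \<alpha> \<beta> \<le> 0"
proof (rule ccontr)
  assume "\<not> ?thesis"
  then have d: "(\<lambda>y. \<alpha> y - \<beta> y) \<in> RR" using root_difference assms SR_PR PR_RR by force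
  have "False" if "(\<lambda>y. \<alpha> y - \<beta> y) \<in> PR"
  proof -
    have "\<exists>\<delta>\<in>PR. \<exists>\<gamma>\<in>PR. \<alpha> = (\<lambda>y. \<delta> y + \<gamma> y)"
      by (rule bexI[OF bexI[OF _ that] SR_PR[OF assms(2)]]) simp
    then show False using assms(1) unfolding simple_roots_def by blast
  qed
  moreover have "False" if "(\<lambda>y. - (\<alpha> y - \<beta> y)) \<in> PR"
  proof -
    have "\<exists>\<delta>\<in>PR. \<exists>\<gamma>\<in>PR. \<beta> = (\<lambda>y. \<delta> y + \<gamma> y)"
      by (rule bexI[OF bexI[OF _ that] SR_PR[OF assms(1)]]) simp
    then show False using assms(2) unfolding simple_roots_def by blast
  qed
  ultimately show False using root_sign[OF d] by blast
qed

text \<open>\<open>B(x, h')\<close> is a sum over roots of nonnegative terms. If it vanishes, then so do all terms, that is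
  \<open>ad x \<circ> ad h' = 0\<close>. This equation defines a proper subspace of \<open>a\<close> which is stable under reflections, so
  it contains the whole Weyl polytope of \<open>x\<close>.\<close>

lemma full_dim_B_pos:
  assumes x: "x \<in> C" and h': "h' \<in> C" "h' \<noteq> 0" and full: "aff_dim (weyl_polytope br a x) = int (dim a)"
  shows "0 < B x h'"
proof (rule ccontr)
  assume "\<not> ?thesis"
  then have zero: "B x h' = 0" using B_C_nonneg[OF x h'(1)] by simp
  note xa = C_a[OF x] and ha = C_a[OF h'(1)]
  have terms: "wt e x * wt e h' = 0" if "e \<in> EB" for e
    using zero sum_nonneg_eq_0_iff[OF finite_EB, of "\<lambda>e. wt e x * wt e h'"] B_C_terms[OF x h'(1)] B_EB[OF xa ha] that
    by simp
  \<comment> \<open>a reflection-stable subspace; \<open>h'\<close> does not belong to it since \<open>B(h', h') \<noteq> 0\<close>\<close>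
  define S where "S = {z \<in> a. \<forall>v. br z (br h' v) = 0}"
  have "br x (br h' v) = 0" for v
  proof -
    have "(br x \<circ> br h') e = 0" if "e \<in> EB" for e
      using EB_eig[OF that xa] EB_eig[OF that ha] terms[OF that] by auto
    then have "(br x \<circ> br h') v = 0"
      using linear_eq_0_on_span[OF linear_br_br[of x h'], of EB v] EB(2) by blast
    then show ?thesis by simp
  qed
  then have xS: "x \<in> S" using xa by (simp add: S_def)
  have sub: "subspace S" unfolding S_def using a_subspace by (auto simp: subspace_def)
  have "w x \<in> S" if "w \<in> weyl_group br a" for w
  proof (rule weyl_group_invariant[OF _ _ that xS])
    show "root_reflection br a \<alpha> z \<in> S" if "\<alpha> \<in> RR" "z \<in> S" for \<alpha> z
      using reflection_preserves_annihilator[OF ha that(1), of z] reflection_involution(1)[OF that(1), of z] that(2)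
      by (simp add: S_def)
  qed (auto simp: S_def)
  then have "weyl_polytope br a x \<subseteq> S"
    unfolding weyl_polytope_def using subspace_imp_convex[OF sub] by (intro hull_minimal) auto
  then have "aff_dim (weyl_polytope br a x) \<le> int (dim S)"
    using aff_dim_subset aff_dim_subspace[OF sub] by metis
  then have "dim a \<le> dim S" using full by simp
  then have "S = a" using subspace_dim_equal[OF sub a_subspace] by (auto simp: S_def)
  then have "br h' (br h' v) = 0" for v using ha by (auto simp: S_def)
  then have "br h' \<circ> br h' = (\<lambda>v. 0)" by (simp add: fun_eq_iff)
  then have "B h' h' = 0" by (simp add: killing_form_def lin_trace_def)
  then show False using B_pos[OF C_pp[OF h'(1)] h'(2)] by simp
qed

end

section \<open>The vertices of the coorbitope\<close>

text \<open>The data of the theorem, for the decomposition given by the Cartan involution \<open>\<theta>\<close>.\<close>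

locale coorbit = ordered_restricted br \<theta> a r
  for br :: "'g::euclidean_space \<Rightarrow> 'g \<Rightarrow> 'g" and \<theta> a r +
  fixes n :: nat and \<beta> \<mu> :: "nat \<Rightarrow> 'g \<Rightarrow> real" and x :: 'g and z :: "nat \<Rightarrow> 'g"
  assumes pp_nontrivial: "pp \<noteq> {0}"
    and \<beta>: "bij_betw \<beta> {1..n} SR"
    and \<mu>: "i \<in> {1..n} \<Longrightarrow> \<mu> i \<in> dual_of a"
    and dual: "j \<in> {1..n} \<Longrightarrow> i \<in> {1..n} \<Longrightarrow> dual_inner br a (\<beta> j) (\<mu> i) = (if j = i then 1 else 0)"
    and x: "x \<in> C" and full: "aff_dim (weyl_polytope br a x) = int (dim a)"
    and z: "i \<in> {1..n} \<Longrightarrow> z i = h_vec br a (\<mu> i) /\<^sub>R \<mu> i x"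
begin

abbreviation hv where "hv i \<equiv> h_vec br a (\<mu> i)"
abbreviation hb where "hb i \<equiv> h_vec br a (\<beta> i)"
abbreviation IX where "IX \<equiv> I_set br a n \<beta> x"

lemma \<beta>_SR: "i \<in> {1..n} \<Longrightarrow> \<beta> i \<in> SR"
  using \<beta> by (rule bij_betwE[THEN bspec])

lemma \<beta>_dual: "i \<in> {1..n} \<Longrightarrow> \<beta> i \<in> dual_of a"
  using \<beta>_SR SR_PR PR_RR root_dual by blast

lemma \<beta>_inj: "i \<in> {1..n} \<Longrightarrow> j \<in> {1..n} \<Longrightarrow> \<beta> i = \<beta> j \<longleftrightarrow> i = j"
  by (rule inj_on_eq_iff[OF bij_betw_imp_inj_on[OF \<beta>]])

lemma SR_\<beta>: "\<alpha> \<in> SR \<Longrightarrow> \<exists>i\<in>{1..n}. \<alpha> = \<beta> i"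
  using \<beta> by (auto simp: bij_betw_def)

lemma hv_a: "i \<in> {1..n} \<Longrightarrow> hv i \<in> a" and hb_a: "i \<in> {1..n} \<Longrightarrow> hb i \<in> a"
  and B_hv: "i \<in> {1..n} \<Longrightarrow> y \<in> a \<Longrightarrow> B (hv i) y = \<mu> i y"
  and B_hb: "i \<in> {1..n} \<Longrightarrow> y \<in> a \<Longrightarrow> B (hb i) y = \<beta> i y"
  using h_vec \<mu> \<beta>_dual by blast+

lemma \<beta>_hv: "j \<in> {1..n} \<Longrightarrow> i \<in> {1..n} \<Longrightarrow> \<beta> j (hv i) = (if j = i then 1 else 0)"
  using dual dual_inner_eq[OF \<beta>_dual \<mu>] by metis

lemma \<beta>_scale: "i \<in> {1..n} \<Longrightarrow> u \<in> a \<Longrightarrow> \<beta> i (c *\<^sub>R u) = c * \<beta> i u"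
  using dual_scale[OF \<beta>_dual] by blast

lemma \<beta>_diff: "i \<in> {1..n} \<Longrightarrow> u \<in> a \<Longrightarrow> v \<in> a \<Longrightarrow> \<beta> i (u - v) = \<beta> i u - \<beta> i v"
  using B_hb[of i] subspace_diff[OF a_subspace, of u v] by (metis bilinear_rsub[OF killing_bilinear])

lemma \<beta>_separates:
  assumes "h \<in> a" "\<And>i. i \<in> {1..n} \<Longrightarrow> \<beta> i h = 0"
  shows "h = 0"
proof (rule a_eq_0I[OF assms(1)])
  have pos: "\<alpha> h = 0" if "\<alpha> \<in> PR" for \<alpha>
    using that
  proof (induction rule: positive_root_induct)
    case (simple \<alpha>)
    then show ?case using SR_\<beta> assms(2) by blast
  qed simp
  show "\<alpha> h = 0" if "\<alpha> \<in> RR" for \<alpha> using root_sign[OF that] pos by force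
qed

lemma chamber_coordinates:
  assumes h: "h \<in> a"
  shows "h = (\<Sum>i\<in>{1..n}. \<beta> i h *\<^sub>R hv i)"
proof -
  let ?s = "\<Sum>i\<in>{1..n}. \<beta> i h *\<^sub>R hv i"
  have s: "?s \<in> a" using hv_a by (rule a_combination)
  have "\<beta> j ?s = \<beta> j h" if j: "j \<in> {1..n}" for j
  proof -
    have "\<beta> j ?s = B (hb j) ?s" using B_hb[OF j s] by simp
    also have "\<dots> = (\<Sum>i\<in>{1..n}. \<beta> i h * B (hb j) (hv i))" by (rule B_sum_right)
    also have "\<dots> = (\<Sum>i\<in>{1..n}. if j = i then \<beta> i h else 0)"
      using j by (intro sum.cong refl) (simp add: B_hb hv_a \<beta>_hv)
    also have "\<dots> = \<beta> j h" using j by simp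
    finally show ?thesis .
  qed
  then have "\<beta> j (h - ?s) = 0" if "j \<in> {1..n}" for j using \<beta>_diff[OF that h s] that by simp
  then have "h - ?s = 0" using \<beta>_separates[of "h - ?s"] subspace_diff[OF a_subspace h s] by blast
  then show ?thesis by simp
qed

lemma hv_C: assumes i: "i \<in> {1..n}" shows "hv i \<in> C"
proof -
  have "0 \<le> \<alpha> (hv i)" if "\<alpha> \<in> SR" for \<alpha>
  proof -
    obtain j where "j \<in> {1..n}" "\<alpha> = \<beta> j" using SR_\<beta>[OF \<open>\<alpha> \<in> SR\<close>] by blast
    then show ?thesis using \<beta>_hv[of j i] i by simp
  qed
  then show ?thesis using hv_a[OF i] by (simp add: weyl_chamber_def)
qed

lemma hv_nonzero: assumes "i \<in> {1..n}" shows "hv i \<noteq> 0"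
proof
  assume "hv i = 0"
  then have "\<beta> i (hv i) = 0" using B_hb[OF assms hv_a[OF assms]] by simp
  then show False using \<beta>_hv[OF assms assms] by simp
qed

lemma \<mu>_pos: assumes i: "i \<in> {1..n}" shows "0 < \<mu> i x"
  using full_dim_B_pos[OF x hv_C[OF i] hv_nonzero[OF i] full] B_hv[OF i C_a[OF x]] killing_sym[of x "hv i"] by simp

lemma z_C: assumes i: "i \<in> {1..n}" shows "z i \<in> C"
  unfolding weyl_chamber_def
proof (intro CollectI conjI ballI)
  show "z i \<in> a" using z[OF i] hv_a[OF i] subspace_scale[OF a_subspace] by simp
  fix \<alpha> assume "\<alpha> \<in> SR"
  then obtain j where j: "j \<in> {1..n}" "\<alpha> = \<beta> j" using SR_\<beta> by blast
  show "0 \<le> \<alpha> (z i)" using \<beta>_scale[OF j(1) hv_a[OF i]] \<beta>_hv[OF j(1) i] \<mu>_pos[OF i] z[OF i] j(2) by simp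
qed

lemma B_z_x: assumes i: "i \<in> {1..n}" shows "B (z i) x = 1"
  using z[OF i] B_hv[OF i C_a[OF x]] \<mu>_pos[OF i] by simp

lemma \<beta>_z: "j \<in> {1..n} \<Longrightarrow> i \<in> {1..n} \<Longrightarrow> \<beta> j (z i) = (if j = i then 1 / \<mu> i x else 0)"
  using \<beta>_scale[OF _ hv_a] \<beta>_hv z by (simp add: divide_inverse)

lemma n_pos: "1 \<le> n"
proof (rule ccontr)
  assume "\<not> 1 \<le> n"
  then have "a \<subseteq> {0}" using \<beta>_separates by force
  moreover obtain u where u: "u \<in> pp" "u \<noteq> 0" using pp_nontrivial subspace_0[OF subspace_pp] by blast
  ultimately have "br h u = 0" if "h \<in> a" for h using that by auto
  then have "u \<in> a" using a_self_centralizing[OF u(1)] by blast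
  then show False using u(2) \<open>a \<subseteq> {0}\<close> by blast
qed

lemma regular_element:
  obtains h0 where "h0 \<in> a" "\<And>\<alpha>. \<alpha> \<in> PR \<Longrightarrow> 0 < \<alpha> h0"
proof -
  define h0 where "h0 = (\<Sum>i\<in>{1..n}. 1 *\<^sub>R hv i)"
  have ha: "h0 \<in> a" unfolding h0_def using hv_a by (rule a_combination)
  have one: "\<beta> j h0 = 1" if j: "j \<in> {1..n}" for j
  proof -
    have "\<beta> j h0 = B (hb j) h0" using B_hb[OF j ha] by simp
    also have "\<dots> = (\<Sum>i\<in>{1..n}. 1 * B (hb j) (hv i))" unfolding h0_def by (rule B_sum_right)
    also have "\<dots> = (\<Sum>i\<in>{1..n}. if j = i then 1 else 0)"
      using j by (intro sum.cong refl) (simp add: B_hb hv_a \<beta>_hv)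
    also have "\<dots> = 1" using j by simp
    finally show ?thesis .
  qed
  have "0 < \<alpha> h0" if "\<alpha> \<in> PR" for \<alpha>
    using that
  proof (induction rule: positive_root_induct)
    case (simple \<alpha>)
    then show ?case using SR_\<beta> one by force
  qed simp
  then show thesis using that ha by blast
qed

text \<open>Simple roots form obtuse angles. Writing \<open>q = qp - qn\<close> with the positive and the negative
  coefficients, this gives \<open>B(qp, qn) \<le> 0\<close>, while \<open>B(q, qn) \<ge> 0\<close> by hypothesis; hence \<open>qn = 0\<close>.\<close>

lemma obtuse_combination_dominates:
  assumes J: "J \<subseteq> {1..n}" and q: "q = (\<Sum>j\<in>J. c j *\<^sub>R hb j)" "\<And>j. j \<in> J \<Longrightarrow> 0 \<le> \<beta> j q" and y: "y \<in> C"
  shows "0 \<le> B q y"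
proof -
  have fin: "finite J" using J finite_subset by blast
  define P where "P = {j \<in> J. 0 \<le> c j}" define N where "N = {j \<in> J. c j < 0}"
  define qp where "qp = (\<Sum>j\<in>P. c j *\<^sub>R hb j)" define qn where "qn = (\<Sum>j\<in>N. (- c j) *\<^sub>R hb j)"
  have "P \<union> N = J" "P \<inter> N = {}" by (auto simp: P_def N_def)
  then have "q = qp + (\<Sum>j\<in>N. c j *\<^sub>R hb j)"
    unfolding q(1) qp_def using fin sum.union_disjoint[of P N "\<lambda>j. c j *\<^sub>R hb j"] by (metis finite_Un)
  then have qq: "q = qp - qn" by (simp add: qn_def sum_negf)
  have qa: "q \<in> a" unfolding q(1) using J hb_a by (intro a_combination) auto
  have na: "qn \<in> a" unfolding qn_def using J hb_a by (intro a_combination) (auto simp: N_def)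
  have "0 \<le> B qn q"
    unfolding qn_def B_sum_left
  proof (rule sum_nonneg)
    fix j assume j: "j \<in> N"
    then have "B (hb j) q = \<beta> j q" using B_hb[of j q] qa J by (auto simp: N_def)
    then show "0 \<le> - c j * B (hb j) q" using q(2)[of j] j by (auto simp: N_def mult_nonpos_nonneg)
  qed
  moreover have "B qp qn \<le> 0"
    unfolding qp_def B_sum_left
  proof (rule sum_nonpos)
    fix i assume i: "i \<in> P"
    have "B qn (hb i) \<le> 0"
      unfolding qn_def B_sum_left
    proof (rule sum_nonpos)
      fix j assume j: "j \<in> N"
      have ij: "i \<in> {1..n}" "j \<in> {1..n}" "j \<noteq> i" using i j J by (auto simp: P_def N_def)
      then have "B (hb j) (hb i) \<le> 0" using simple_obtuse[OF \<beta>_SR \<beta>_SR, of j i] \<beta>_inj by (simp add: dual_inner_def)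
      then show "- c j * B (hb j) (hb i) \<le> 0" using j by (simp add: N_def mult_nonpos_nonpos)
    qed
    then show "c i * B (hb i) qn \<le> 0" using i killing_sym[of "hb i" qn] by (simp add: P_def mult_nonneg_nonpos)
  qed
  ultimately have "B qn qn \<le> 0" unfolding qq using killing_sym[of qn qp] by simp
  then have "qn = 0" using B_pos[of qn] na a_pp by force
  then have "B q y = (\<Sum>j\<in>P. c j * B (hb j) y)" unfolding qq qp_def by (simp add: B_sum_left)
  also have "0 \<le> \<dots>"
  proof (rule sum_nonneg)
    fix j assume j: "j \<in> P"
    then have j': "j \<in> {1..n}" using J by (auto simp: P_def)
    have "0 \<le> B (hb j) y" using B_hb[OF j' C_a[OF y]] y \<beta>_SR[OF j'] by (simp add: weyl_chamber_def)
    then show "0 \<le> c j * B (hb j) y" using j by (simp add: P_def)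
  qed
  finally show ?thesis .
qed

text \<open>\<open>q\<close> lies in the span of a component \<open>D\<close> of \<open>\<Gamma> - {\<beta>\<^sub>i}\<close> that vanishes at \<open>x\<close>. The difference
  \<open>z j0 - q\<close> is orthogonal to \<open>D\<close> and to all other simple roots except \<open>\<beta>\<^sub>i\<close>, hence a multiple of
  \<open>h\<^sub>\<mu>\<close> for \<open>\<mu> = \<mu>\<^sub>i\<close>. As \<open>B(q, x) = 0\<close>, pairing with \<open>x\<close> identifies it as \<open>z i\<close>,
  and \<open>obtuse_combination_dominates\<close> applies to \<open>q = z j0 - z i\<close>.\<close>

lemma not_connected_dominated:
  assumes i: "i \<in> {1..n}" "i \<notin> IX"
  obtains j where "j \<in> {1..n}" "\<And>y. y \<in> C \<Longrightarrow> B (z i) y \<le> B (z j) y" "B (z i) (z i) < B (z j) (z j)"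
proof -
  let ?G = "\<beta> ` {1..n} - {\<beta> i}"
  obtain D where D: "D \<in> dynkin_components br a ?G" "\<And>b. b \<in> D \<Longrightarrow> b x = 0"
    using i unfolding I_set_def x_connected_def by blast
  then obtain \<gamma> where \<gamma>: "\<gamma> \<in> ?G" "D = (dynkin_edges br a ?G)\<^sup>* `` {\<gamma>}" unfolding dynkin_components_def by blast
  have D_G: "b \<in> ?G" if "b \<in> D" for b
  proof -
    have "(\<gamma>, b) \<in> (dynkin_edges br a ?G)\<^sup>*" using that \<gamma>(2) by simp
    then show ?thesis by (cases rule: rtranclE) (use \<gamma>(1) in \<open>auto simp: dynkin_edges_def\<close>)
  qed
  have D_step: "b' \<in> D" if "b \<in> D" "b' \<in> ?G" "b \<noteq> b'" "dual_inner br a b b' \<noteq> 0" for b b'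
  proof -
    have "(b, b') \<in> dynkin_edges br a ?G" using that D_G by (auto simp: dynkin_edges_def)
    then show ?thesis using that(1) \<gamma>(2) by (auto intro: rtrancl_into_rtrancl)
  qed
  define J where "J = {j \<in> {1..n}. \<beta> j \<in> D}"
  have J: "J \<subseteq> {1..n}" "finite J" by (auto simp: J_def)
  have iJ: "i \<notin> J" using D_G by (auto simp: J_def)
  obtain j0 where j0: "j0 \<in> {1..n}" "\<gamma> = \<beta> j0" using \<gamma>(1) by blast
  have j0J: "j0 \<in> J" using j0 \<gamma>(2) by (auto simp: J_def)
  have orth: "B (hb j) (hb m) = 0" if "j \<in> J" "m \<in> {1..n}" "m \<notin> J" "m \<noteq> i" for j m
  proof (rule ccontr)
    assume "B (hb j) (hb m) \<noteq> 0"
    moreover have "\<beta> m \<in> ?G" "\<beta> j \<noteq> \<beta> m" using that i(1) J(1) \<beta>_inj by auto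
    ultimately have "\<beta> m \<in> D" using D_step[of "\<beta> j" "\<beta> m"] that(1) by (auto simp: J_def dual_inner_def)
    then show False using that by (simp add: J_def)
  qed
  have inj: "inj_on hb J"
  proof (rule inj_onI)
    fix j m assume jm: "j \<in> J" "m \<in> J" "hb j = hb m"
    then have "\<beta> j (hv j) = \<beta> m (hv j)" using B_hb hv_a J(1) by (metis subsetD)
    then show "j = m" using \<beta>_hv jm J(1) by (metis subsetD zero_neq_one)
  qed
  \<comment> \<open>\<open>q\<close> is the orthogonal projection of \<open>z j0\<close> to the span of the component\<close>
  obtain q where q: "q \<in> span (hb ` J)" "\<And>w. w \<in> span (hb ` J) \<Longrightarrow> ip (z j0 - q) w = 0"
    using obtain_orthogonal_projection[of "span (hb ` J)" "z j0"] by (metis subspace_span)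
  obtain c where c: "q = (\<Sum>j\<in>J. c j *\<^sub>R hb j)"
  proof -
    obtain s where "q = (\<Sum>v\<in>hb ` J. s v *\<^sub>R v)" using q(1) span_finite[of "hb ` J"] J(2) by auto
    then have "q = (\<Sum>j\<in>J. s (hb j) *\<^sub>R hb j)" using sum.reindex[OF inj, of "\<lambda>v. s v *\<^sub>R v"] by (simp add: o_def)
    then show thesis by (rule that)
  qed
  have za: "z l \<in> a" if "l \<in> {1..n}" for l using z_C[OF that] C_a by blast
  have qa: "q \<in> a" unfolding c using J hb_a by (intro a_combination) auto
  have da: "z j0 - q \<in> a" using za[OF j0(1)] qa subspace_diff[OF a_subspace] by blast
  have \<beta>q: "\<beta> j q = \<beta> j (z j0)" if j: "j \<in> J" for j
  proof -
    have j': "j \<in> {1..n}" using j J by blast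
    have "ip (z j0 - q) (hb j) = 0" by (rule q(2)) (use j in \<open>simp add: span_base\<close>)
    then have "B (z j0 - q) (hb j) = 0" by (subst ip_pp[symmetric]) (use hb_a[OF j'] a_pp in auto)
    then have "\<beta> j (z j0 - q) = 0" using B_hb[OF j' da] killing_sym[of "hb j" "z j0 - q"] by (simp only:)
    then show ?thesis using \<beta>_diff[OF j' za[OF j0(1)] qa] by simp
  qed
  have "\<beta> m (z j0 - q) = 0" if m: "m \<in> {1..n}" "m \<noteq> i" for m
  proof (cases "m \<in> J")
    case True
    then show ?thesis using \<beta>q[OF True] \<beta>_diff[OF m(1) za[OF j0(1)] qa] by simp
  next
    case False
    have "\<beta> m q = B q (hb m)" using B_hb[OF m(1) qa] killing_sym[of "hb m" q] by simp
    also have "\<dots> = 0" unfolding c B_sum_left using orth False m by simp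
    finally show ?thesis using \<beta>_diff[OF m(1) za[OF j0(1)] qa] \<beta>_z[OF m(1) j0(1)] False j0J by auto
  qed
  then have "(\<Sum>m\<in>{1..n}. \<beta> m (z j0 - q) *\<^sub>R hv m) = (\<Sum>m\<in>{1..n}. if m = i then \<beta> i (z j0 - q) *\<^sub>R hv i else 0)"
    by (intro sum.cong refl) auto
  then have d: "z j0 - q = \<beta> i (z j0 - q) *\<^sub>R hv i" using chamber_coordinates[OF da] i(1) by simp
  have "B q x = (\<Sum>j\<in>J. c j * B (hb j) x)" unfolding c B_sum_left ..
  also have "\<dots> = 0" using B_hb[OF _ C_a[OF x]] D(2) J(1) by (intro sum.neutral) (auto simp: J_def)
  finally have "B (z j0 - q) x = 1" using B_z_x[OF j0(1)] by simp
  then have "\<beta> i (z j0 - q) * \<mu> i x = 1" using d B_hv[OF i(1) C_a[OF x]] by (metis bilinear_lmul[OF killing_bilinear] real_scaleR_def)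
  then have "\<beta> i (z j0 - q) = inverse (\<mu> i x)" using \<mu>_pos[OF i(1)] by (simp add: field_simps)
  then have zi: "z j0 = z i + q" using d z[OF i(1)] by (simp add: algebra_simps)
  show thesis
  proof (rule that[OF j0(1)])
    fix y assume y: "y \<in> C"
    have "0 \<le> B q y"
    proof (rule obtuse_combination_dominates[OF J(1) c _ y])
      show "0 \<le> \<beta> j q" if "j \<in> J" for j
        using \<beta>q[OF that] \<beta>_z[of j j0] that J(1) j0(1) \<mu>_pos[OF j0(1)] by auto
    qed
    then show "B (z i) y \<le> B (z j0) y" unfolding zi by simp
  next
    have "B q (z i) = (\<Sum>j\<in>J. c j * B (hb j) (z i))" unfolding c B_sum_left ..
    also have "\<dots> = 0"
    proof (intro sum.neutral ballI)
      fix j assume j: "j \<in> J"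
      then have "j \<noteq> i" "j \<in> {1..n}" using iJ J(1) by auto
      then show "c j * B (hb j) (z i) = 0" using B_hb[OF _ za[OF i(1)]] \<beta>_z[of j i] i(1) by simp
    qed
    finally have "B (z j0) (z j0) = B (z i) (z i) + B q q" unfolding zi using killing_sym[of "z i" q] by simp
    moreover have "\<beta> j0 q \<noteq> 0" using \<beta>q[OF j0J] \<beta>_z[OF j0(1) j0(1)] \<mu>_pos[OF j0(1)] by simp
    then have "q \<noteq> 0" using B_hb[OF j0(1) qa] by auto
    then have "0 < B q q" using B_pos qa a_pp by blast
    ultimately show "B (z i) (z i) < B (z j0) (z j0)" by simp
  qed
qed

lemma IX_sub: "IX \<subseteq> {1..n}" by (auto simp: I_set_def)

text \<open>Among the indices that dominate \<open>i\<close>, one with the longest vector lies in \<open>I(x)\<close>.\<close>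

lemma IX_dominates:
  assumes i: "i \<in> {1..n}"
  obtains j where "j \<in> IX" "\<And>y. y \<in> C \<Longrightarrow> B (z i) y \<le> B (z j) y"
proof -
  define A where "A = {j \<in> {1..n}. \<forall>y\<in>C. B (z i) y \<le> B (z j) y}"
  have A: "finite A" "i \<in> A" using i by (auto simp: A_def)
  define m where "m = Max ((\<lambda>j. B (z j) (z j)) ` A)"
  have "m \<in> (\<lambda>j. B (z j) (z j)) ` A" unfolding m_def using A by (intro Max_in) auto
  then obtain j where j: "j \<in> A" "m = B (z j) (z j)" by blast
  have max: "B (z l) (z l) \<le> B (z j) (z j)" if "l \<in> A" for l
    unfolding j(2)[symmetric] m_def using A(1) that by simp
  have "j \<in> IX"
  proof (rule ccontr)
    assume "j \<notin> IX"
    then obtain l where l: "l \<in> {1..n}" "\<And>y. y \<in> C \<Longrightarrow> B (z j) y \<le> B (z l) y" "B (z j) (z j) < B (z l) (z l)"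
      using not_connected_dominated[of j] j(1) by (auto simp: A_def)
    have "l \<in> A" using l(1,2) j(1) order_trans unfolding A_def by blast
    then show False using max l(3) by fastforce
  qed
  then show thesis using that j(1) by (auto simp: A_def)
qed

lemma B_orbit_le:
  assumes "c \<in> C" "d \<in> C" "\<phi> \<in> K" "\<psi> \<in> K"
  shows "B (\<phi> c) (\<psi> d) \<le> B c d"
proof -
  obtain \<tau> where \<tau>: "\<tau> \<in> K" "\<And>v. \<tau> (\<psi> v) = v" "\<And>v. \<psi> (\<tau> v) = v" using K_inverse[OF assms(4)] by blast
  have "B (\<phi> c) (\<psi> d) = B ((\<tau> \<circ> \<phi>) c) d" using K_B[OF \<tau>(1), of "\<phi> c" "\<psi> d"] \<tau>(2) by simp
  also have "\<dots> \<le> B c d" by (rule orbit_maximum[OF assms(1,2) K_comp[OF \<tau>(1) assms(3)]])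
  finally show ?thesis .
qed

text \<open>The coordinates \<open>t i\<close> of \<open>y\<close> with respect to the \<open>z i\<close> are nonnegative and add up to \<open>B(x, y) \<le> 1\<close>.\<close>

lemma chamber_polar_bound:
  assumes c: "c \<in> C" and y: "y \<in> C" "B x y \<le> 1"
  obtains j where "j \<in> IX" "B c y \<le> B c (z j)"
proof -
  define M where "M = Max ((\<lambda>i. B c (z i)) ` IX)"
  have finI: "finite IX" using IX_sub finite_subset by blast
  obtain j1 where "j1 \<in> IX" using IX_dominates[of 1] n_pos by auto
  then have "M \<in> (\<lambda>i. B c (z i)) ` IX" unfolding M_def using finI by (intro Max_in) auto
  then obtain j where j: "j \<in> IX" "M = B c (z j)" by blast
  have bound: "B c (z i) \<le> M" if i: "i \<in> {1..n}" for i
  proof -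
    obtain l where l: "l \<in> IX" "\<And>y. y \<in> C \<Longrightarrow> B (z i) y \<le> B (z l) y" using IX_dominates[OF i] by blast
    have "B c (z i) \<le> B c (z l)" using l(2)[OF c] killing_sym[of c] by simp
    also have "\<dots> \<le> M" unfolding M_def using finI l(1) by simp
    finally show ?thesis .
  qed
  have M0: "0 \<le> M" using B_C_nonneg[OF c z_C] j IX_sub by blast
  define t where "t = (\<lambda>i. \<beta> i y * \<mu> i x)"
  have t: "0 \<le> t i" if i: "i \<in> {1..n}" for i
    using y(1) \<beta>_SR[OF i] \<mu>_pos[OF i] by (simp add: t_def weyl_chamber_def)
  have hvz: "hv i = \<mu> i x *\<^sub>R z i" if "i \<in> {1..n}" for i using z[OF that] \<mu>_pos[OF that] by simp
  have "y = (\<Sum>i\<in>{1..n}. \<beta> i y *\<^sub>R hv i)" by (rule chamber_coordinates[OF C_a[OF y(1)]])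
  also have "\<dots> = (\<Sum>i\<in>{1..n}. t i *\<^sub>R z i)" by (intro sum.cong refl) (simp add: hvz t_def)
  finally have yt: "y = (\<Sum>i\<in>{1..n}. t i *\<^sub>R z i)" .
  have By: "B u y = (\<Sum>i\<in>{1..n}. t i * B u (z i))" for u by (subst yt) (rule B_sum_right)
  have "B x y = (\<Sum>i\<in>{1..n}. t i)" unfolding By using B_z_x killing_sym[of x] by simp
  then have "(\<Sum>i\<in>{1..n}. t i) \<le> 1" using y(2) by simp
  moreover have "B c y \<le> (\<Sum>i\<in>{1..n}. t i * M)" unfolding By by (intro sum_mono mult_left_mono bound t)
  ultimately have "B c y \<le> M" using M0 mult_right_mono[of "\<Sum>i\<in>{1..n}. t i" 1 M] by (simp add: sum_distrib_right)
  then show thesis using that j by simp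
qed

theorem coorbitope_eq: "coorbitope br kk pp x = convex hull (\<Union>i\<in>IX. orb (z i))"
proof (rule antisym)
  let ?Q = "coorbitope br kk pp x" and ?R = "convex hull (\<Union>i\<in>IX. orb (z i))"
  have zp: "z i \<in> pp" if "i \<in> IX" for i using z_C C_pp IX_sub that by blast
  show "?R \<subseteq> ?Q"
  proof (rule hull_minimal)
    show "convex ?Q"
    proof (rule convexI)
      fix y y' and s t :: real assume y: "y \<in> ?Q" "y' \<in> ?Q" and st: "0 \<le> s" "0 \<le> t" "s + t = 1"
      have "s *\<^sub>R y + t *\<^sub>R y' \<in> pp"
        using y subspace_add[OF subspace_pp] subspace_scale[OF subspace_pp] by (simp add: coorbitope_def)
      moreover have "B w (s *\<^sub>R y + t *\<^sub>R y') \<le> 1" if "w \<in> orbitope br kk x" for w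
        using convex_bound_le[of "B w y" 1 "B w y'" s t] y st that by (simp add: coorbitope_def)
      ultimately show "s *\<^sub>R y + t *\<^sub>R y' \<in> ?Q" by (simp add: coorbitope_def)
    qed
    show "(\<Union>i\<in>IX. orb (z i)) \<subseteq> ?Q"
    proof
      fix y assume "y \<in> (\<Union>i\<in>IX. orb (z i))"
      then obtain i where i: "i \<in> IX" "y \<in> orb (z i)" by blast
      then obtain \<psi> where \<psi>: "\<psi> \<in> K" "y = \<psi> (z i)" by (auto elim: orbE)
      have i': "i \<in> {1..n}" using i IX_sub by blast
      have "orb x \<subseteq> {w. B w y \<le> 1}"
        using B_orbit_le[OF x z_C[OF i'] _ \<psi>(1)] B_z_x[OF i'] killing_sym[of x "z i"] \<psi>(2) by (auto elim!: orbE)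
      moreover have "convex {w. B w y \<le> 1}"
      proof (rule convexI)
        fix u v and s t :: real assume "u \<in> {w. B w y \<le> 1}" "v \<in> {w. B w y \<le> 1}" "0 \<le> s" "0 \<le> t" "s + t = 1"
        then show "s *\<^sub>R u + t *\<^sub>R v \<in> {w. B w y \<le> 1}" using convex_bound_le[of "B u y" 1 "B v y" s t] by simp
      qed
      ultimately have "orbitope br kk x \<subseteq> {w. B w y \<le> 1}" unfolding orbitope_def by (rule hull_minimal)
      moreover have "y \<in> pp" using K_pp[OF \<psi>(1) zp[OF i(1)]] \<psi>(2) by simp
      ultimately show "y \<in> ?Q" by (auto simp: coorbitope_def)
    qed
  qed
  obtain h0 where h0: "h0 \<in> a" "\<And>\<alpha>. \<alpha> \<in> PR \<Longrightarrow> 0 < \<alpha> h0" using regular_element by blast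
  show "?Q \<subseteq> ?R"
  proof (rule subsetI, rule ccontr)
    fix y assume y: "y \<in> ?Q" and "y \<notin> ?R"
    have "finite IX" using IX_sub finite_subset by blast
    then have "compact ?R" by (intro compact_convex_hull compact_UN compact_orb zp)
    then obtain v b where v: "v \<bullet> y < b" "\<And>w. w \<in> ?R \<Longrightarrow> b < v \<bullet> w"
      using separating_hyperplane_closed_point[of ?R y] \<open>y \<notin> ?R\<close> compact_imp_closed by (metis convex_convex_hull)
    obtain w where w: "w \<in> pp" "\<And>u. u \<in> pp \<Longrightarrow> ip w u = - (v \<bullet> u)"
      by (rule riesz[OF subspace_pp, of "\<lambda>u. - (v \<bullet> u)"]) (auto simp: inner_add_right)
    have yp: "y \<in> pp" using y by (simp add: coorbitope_def)
    obtain \<phi> c where \<phi>: "\<phi> \<in> K" "c \<in> C" "w = \<phi> c" using orbit_meets_chamber[OF h0(1) _ w(1)] h0(2) by blast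
    obtain \<psi> d where \<psi>: "\<psi> \<in> K" "d \<in> C" "y = \<psi> d" using orbit_meets_chamber[OF h0(1) _ yp] h0(2) by blast
    have "\<psi> x \<in> orbitope br kk x" unfolding orbitope_def using orbI[OF \<psi>(1)] by (rule hull_inc)
    then have "B (\<psi> x) (\<psi> d) \<le> 1" using y \<psi>(3) by (simp add: coorbitope_def)
    then have "B x d \<le> 1" by (simp add: K_B[OF \<psi>(1)])
    then obtain j where j: "j \<in> IX" "B c d \<le> B c (z j)" using chamber_polar_bound[OF \<phi>(2) \<psi>(2)] by blast
    have "\<phi> (z j) \<in> ?R" using j(1) orbI[OF \<phi>(1)] by (intro hull_inc) blast
    then have "b < v \<bullet> \<phi> (z j)" by (rule v(2))
    have "- b < B w y" using w(2)[OF yp] v(1) ip_pp[OF yp, of w] by simp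
    also have "\<dots> \<le> B c d" unfolding \<phi>(3) \<psi>(3) by (rule B_orbit_le[OF \<phi>(2) \<psi>(2) \<phi>(1) \<psi>(1)])
    also have "\<dots> \<le> B c (z j)" by (rule j(2))
    also have "\<dots> = B w (\<phi> (z j))" unfolding \<phi>(3) by (simp add: K_B[OF \<phi>(1)])
    also have "\<dots> = - (v \<bullet> \<phi> (z j))"
      using w(2)[OF K_pp[OF \<phi>(1) zp[OF j(1)]]] ip_pp[OF K_pp[OF \<phi>(1) zp[OF j(1)]], of w] by simp
    also have "\<dots> < - b" using \<open>b < v \<bullet> \<phi> (z j)\<close> by simp
    finally show False .
  qed
qed

end

theorem corollary6p6:
  fixes br :: "'g::euclidean_space \<Rightarrow> 'g \<Rightarrow> 'g"
    and k p a :: "'g set"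
    and r :: "(('g \<Rightarrow> real) \<times> ('g \<Rightarrow> real)) set"
    and n :: nat
    and \<beta> \<mu> :: "nat \<Rightarrow> 'g \<Rightarrow> real"
    and x :: 'g
    and z :: "nat \<Rightarrow> 'g"
  assumes "semisimple_lie_algebra br"
    and "cartan_decomposition br k p"
    and "p \<noteq> {0}"
    and "maximal_commutative br p a"
    and "dual_ordering a r"
    and "bij_betw \<beta> {1..n} (simple_roots br a r)"
    and "\<forall>i\<in>{1..n}. \<mu> i \<in> dual_of a"
    and "\<forall>j\<in>{1..n}. \<forall>i\<in>{1..n}. dual_inner br a (\<beta> j) (\<mu> i) = (if j = i then 1 else 0)"
    and "x \<in> weyl_chamber a (simple_roots br a r)"
    and "aff_dim (weyl_polytope br a x) = int (dim a)"
    and "\<forall>i\<in>{1..n}. z i = h_vec br a (\<mu> i) /\<^sub>R \<mu> i x"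
  shows "(\<forall>i\<in>I_set br a n \<beta> x. z i \<in> weyl_chamber a (simple_roots br a r)) \<and>
    coorbitope br k p x = convex hull (\<Union>i\<in>I_set br a n \<beta> x. K_orbit br k (z i))"
proof -
  obtain \<theta> where \<theta>: "cartan_involution br \<theta>" "k = {x. \<theta> x = x}" "p = {x. \<theta> x = - x}"
    using assms(2) by (auto simp: cartan_decomposition_def)
  interpret cartan br \<theta>
    using assms(1) \<theta>(1) by unfold_locales (simp_all add: semisimple_lie_algebra_def)
  have k: "k = kk" and p: "p = pp" using \<theta> by (simp_all add: kk_def pp_def)
  interpret coorbit br \<theta> a r n \<beta> \<mu> x z
    using assms p by unfold_locales auto
  show ?thesis unfolding k p using z_C IX_sub coorbitope_eq by blast
qed

end
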